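(* Uniformly for $m=O(n\log n)$ with $m-n\to\infty$ (as $n\to\infty$), the number of digraphs with $n$ vertices and $m$ arcs in which every vertex has indegree at least $1$ and outdegree at least $1$ is asymptotic to $$\frac{m!\,(e^\lambda-1)^{2n}}{2\pi n c(1+\lambda-c)\,\lambda^{2m}}\exp(-\lambda^2/2),$$ where $c=m/n$ and $\lambda>0$ is determined by $c=\lambda e^\lambda/(e^\lambda-1)$.
   Context: Digraphs are labelled (vertex set $\{1,\dots,n\}$), may have loops, but have no multiple arcs. A loop contributes $1$ to both the indegree and the outdegree of its vertex. Here $m=m(n)$ is a function of $n$. "Uniformly asymptotic" means that for every function $m=m(n)$ satisfying the stated growth conditions, the ratio of the two quantities tends to $1$ as $n\to\infty$. Logarithms are natural. *)

theory Defs
  imports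
    Complex_Main
    "HOL-Library.Landau_Symbols"
    "Graph_Theory.Pair_Digraph"
begin

text \<open>
  In a \<open>pair_fin_digraph\<close> the arcs form a finite set of ordered pairs of vertices: loops are
  allowed, multiple arcs are not, and a loop at \<open>v\<close> counts once in each of
  \<open>in_degree\<close> and \<open>out_degree\<close>.
\<close>

definition core_digraphs :: "nat \<Rightarrow> nat \<Rightarrow> nat pair_pre_digraph set" where
  "core_digraphs n m =
     {G. pair_fin_digraph G \<and> pverts G = {1..n} \<and> card (parcs G) = m \<and>
         (\<forall>v \<in> pverts G. in_degree (with_proj G) v \<ge> 1 \<and> out_degree (with_proj G) v \<ge> 1)}"

text \<open>
  The description is proper exactly for \<open>c > 1\<close> (see \<open>lambda_param_ex1\<close>), which holds
  eventually for \<open>c = m / n\<close> if \<open>m - n\<close> tends to infinity; otherwise the value is irrelevant.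
\<close>

definition lambda_param :: "real \<Rightarrow> real" where
  "lambda_param c = (THE l. l > 0 \<and> c = l * exp l / (exp l - 1))"

lemma lambda_param_ex1:
  fixes c :: real
  assumes "c > 1"
  shows "\<exists>!l. l > 0 \<and> c = l * exp l / (exp l - 1)"
proof -
  define f :: "real \<Rightarrow> real" where "f = (\<lambda>l. l * exp l / (exp l - 1))"
  have mono: "f a < f b" if "0 < a" "a < b" for a b
  proof (rule DERIV_pos_imp_increasing[OF \<open>a < b\<close>])
    fix x assume "a \<le> x" "x \<le> b"
    hence x: "x > 0" using that by simp
    have e: "exp x > 1 + x" using exp_ge_add_one_self[of x] exp_minus_greater[of "-x"] x by force
    let ?D = "exp x * (exp x - 1 - x) / (exp x - 1)^2"
    have "(f has_real_derivative ?D) (at x)"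
      unfolding f_def using e x
      by (auto intro!: derivative_eq_intros simp: power2_eq_square algebra_simps)
    moreover have "?D > 0" using e x by simp
    ultimately show "\<exists>y. DERIV f x :> y \<and> y > 0" by blast
  qed
  have "\<exists>l\<ge>c - 1. l \<le> c \<and> f l = c"
  proof (rule IVT')
    have "exp (c - 1) \<ge> 1 + (c - 1)" by (rule exp_ge_add_one_self)
    thus "f (c - 1) \<le> c"
      using assms by (simp add: f_def field_simps)
    show "c \<le> f c" using assms by (simp add: f_def field_simps)
    show "continuous_on {c - 1..c} f"
      unfolding f_def using assms by (auto intro!: continuous_intros)
  qed auto
  then obtain l where "l > 0" "f l = c" using assms by force
  moreover have "l' = l" if "l' > 0" "f l' = c" for l'
    using mono[of l l'] mono[of l' l] that \<open>l > 0\<close> \<open>f l = c\<close> by force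
  ultimately show ?thesis unfolding f_def by metis
qed

end

(*
  Labelling the arcs, a digraph with all in- and outdegrees positive is a pair of surjections
  from {1..m} onto {1..n} whose m pairs of values are distinct.  Hence the number of such digraphs
  is T^2 / m! times P, where T = n! S(m,n) is the number of surjections and P is the probability
  that two independent uniform surjections produce no repeated pair.

  T is estimated by the local limit theorem for sums of positive Poisson variables; the bound
  |e^x - 1| <= (e^|x| - 1) exp (-(|x| - Re x) / 2), from e^x - 1 = 2 e^(x/2) sinh (x/2), makes it
  uniform from lambda -> 0 up to lambda = O(log n).

  P is exp (-lambda^2/2) up to 1 + o(1), which may be smaller than any power of 1/n, so the
  alternating sum P = sum_k s(m,m-k) (S(m-k,n) / S(m,n))^2 with signed Stirling numbers of the
  first kind cannot be treated termwise.  As S(n+k,n) is the coefficient of z^k in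
  prod_(i<=n) 1 / (1 - i z), it is a double Fourier integral of two such products against
  prod_(i<m) (1 - i z w).  With |z| = |w| = r := S(m-1,n) / S(m,n), log-concavity of S(.,n) makes
  m - n the mode of the law with weights proportional to S(n+k,n) r^k, and Parseval's identity
  bounds the mass of the integral near the origin.  There the last product is nearly constant and
  equals about exp (-(m r)^2 / 2); away from the origin the integrand is negligible.  Finally
  m r = lambda + o(1 / lambda), because log-concavity traps r^K between ratios S(m-K,n) / S(m,n)
  and S(m,n) / S(m+K,n) that are known up to constant factors, with K = log^4 n.
  For lambda <= 1 / log n the first term of the sum dominates, and for m / n > 1.1 log n almost
  all pairs of maps are pairs of surjections.
*)
theory Submission
  imports
    Defs
    "HOL-Combinatorics.Stirling"
    "HOL-Probability.Probability"
    "HOL-Real_Asymp.Real_Asymp"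
begin

section \<open>Core digraphs and surjections\<close>

text \<open>Three constraints shape the argument. (1) The local limit theorem comes without a rate,
  so it gives S(m-1,n) / S(m,n) only up to a factor 1 + o(1), whereas lambda^2, possibly of order
  log^2 n, is needed up to o(1). Over K steps a constant factor costs only its K-th root e^(O(1/K));
  this asks for K well above log^2 n, while the shift of lambda by at most 2K/n stays harmless. (2)
  Errors in P must be relative to exp (-lambda^2/2). Near the origin the product is therefore
  compared multiplicatively with its value at angle 0, and far from it the characteristic function
  must decay faster than every exp (-O(log^2 n)). (3) The law with weights S(n+k,n) r^k is that of a
  sum of geometric variables with ratios i r, i <= n, and need not be near a Gaussian, since 1 - n r
  may be far below 1/n. So only its mode, its variance and Parseval's identity are used. The cut at
  m = 1.1 n log n keeps 1 - n r >= n^(-6/5) below it; above it, a random map misses on average at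
  most n^(-1/10) values.\<close>

lemma prod_one_plus_stirling:
  fixes u :: "'a::comm_ring_1"
  shows "(\<Prod>i<m. 1 + of_nat i * u) = (\<Sum>k\<le>m. of_nat (stirling m (m - k)) * u ^ k)"
proof (induction m)
  case 0
  then show ?case by simp
next
  case (Suc m)
  have "(\<Sum>k\<le>Suc m. of_nat (stirling (Suc m) (Suc m - k)) * u ^ k) =
        1 + (\<Sum>k\<le>m. of_nat (stirling (Suc m) (m - k)) * u ^ Suc k)"
    by (subst sum.atMost_Suc_shift) simp
  also have "(\<Sum>k\<le>m. of_nat (stirling (Suc m) (m - k)) * u ^ Suc k) =
      (\<Sum>k\<le>m. of_nat m * u * (of_nat (stirling m (m - k)) * u ^ k)) +
      (\<Sum>k<m. of_nat (stirling m (m - Suc k)) * u ^ Suc k)"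
  proof -
    \<comment> \<open>The conditional guards against truncated subtraction: at \<open>k = m\<close>
      the index \<open>m - Suc k\<close> would become 0 and, for \<open>m = 0\<close>, contribute a
      spurious term.\<close>
    have "(\<Sum>k\<le>m. of_nat (stirling (Suc m) (m - k)) * u ^ Suc k) =
      (\<Sum>k\<le>m. of_nat m * u * (of_nat (stirling m (m - k)) * u ^ k) +
           (if k < m then of_nat (stirling m (m - Suc k)) * u ^ Suc k else 0))"
    proof (rule sum.cong[OF refl])
      fix k assume k: "k \<in> {..m}"
      show "of_nat (stirling (Suc m) (m - k)) * u ^ Suc k =
        of_nat m * u * (of_nat (stirling m (m - k)) * u ^ k) +
           (if k < m then of_nat (stirling m (m - Suc k)) * u ^ Suc k else 0)"
      proof (cases "k < m")
        case True
        then have "m - k = Suc (m - Suc k)" by simp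
        then show ?thesis using True by (simp add: algebra_simps)
      next
        case False
        with k have "k = m" by simp
        then show ?thesis by (cases m) simp_all
      qed
    qed
    also have "\<dots> = (\<Sum>k\<le>m. of_nat m * u * (of_nat (stirling m (m - k)) * u ^ k)) +
      (\<Sum>k\<le>m. if k < m then of_nat (stirling m (m - Suc k)) * u ^ Suc k else 0)"
      by (rule sum.distrib)
    also have "(\<Sum>k\<le>m. if k < m then of_nat (stirling m (m - Suc k)) * u ^ Suc k else 0) =
      (\<Sum>k<m. of_nat (stirling m (m - Suc k)) * u ^ Suc k)"
      by (rule sum.mono_neutral_cong_right) auto
    finally show ?thesis .
  qed
  also have "1 + ((\<Sum>k\<le>m. of_nat m * u * (of_nat (stirling m (m - k)) * u ^ k)) +
      (\<Sum>k<m. of_nat (stirling m (m - Suc k)) * u ^ Suc k)) =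
      of_nat m * u * (\<Sum>k\<le>m. of_nat (stirling m (m - k)) * u ^ k) +
      (\<Sum>k\<le>m. of_nat (stirling m (m - k)) * u ^ k)"
  proof -
    have "1 + (\<Sum>k<m. of_nat (stirling m (m - Suc k)) * u ^ Suc k) =
        (\<Sum>k\<le>m. of_nat (stirling m (m - k)) * u ^ k)"
      by (cases m) (simp_all only: sum.atMost_Suc_shift lessThan_Suc_atMost, simp_all)
    then show ?thesis by (simp add: sum_distrib_left algebra_simps)
  qed
  also have "\<dots> = (\<Prod>i<Suc m. 1 + of_nat i * u)"
    using Suc.IH by (simp add: algebra_simps)
  finally show ?case by simp
qed

lemma falling_factorial_stirling:
  fixes x :: real
  shows "(\<Prod>i<m. x - of_nat i) = (\<Sum>k\<le>m. (-1) ^ k * of_nat (stirling m (m - k)) * x ^ (m - k))"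
proof (cases "x = 0")
  case True
  show ?thesis
  proof (cases m)
    case (Suc m')
    have "(\<Sum>k\<le>m. (-1) ^ k * of_nat (stirling m (m - k)) * x ^ (m - k)) = 0"
    proof (rule sum.neutral, rule ballI)
      fix k assume "k \<in> {..m}"
      then show "(-1) ^ k * of_nat (stirling m (m - k)) * x ^ (m - k) = 0"
        using True Suc by (cases "k = m") auto
    qed
    moreover have "(\<Prod>i<m. x - of_nat i) = 0" using True Suc by (simp add: prod.lessThan_Suc_shift del: prod.lessThan_Suc)
    ultimately show ?thesis by simp
  qed simp
next
  case False
  have "(\<Prod>i<m. x - of_nat i) = (\<Prod>i<m. x * (1 + of_nat i * (- 1 / x)))"
    using False by (intro prod.cong) (auto simp: field_simps)
  also have "\<dots> = x ^ m * (\<Sum>k\<le>m. of_nat (stirling m (m - k)) * (- 1 / x) ^ k)"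
    by (simp add: prod.distrib flip: prod_one_plus_stirling)
  also have "\<dots> = (\<Sum>k\<le>m. (-1) ^ k * of_nat (stirling m (m - k)) * x ^ (m - k))"
    unfolding sum_distrib_left
    by (intro sum.cong) (use False in \<open>auto simp: power_diff field_simps power_minus' power_divide\<close>)
  finally show ?thesis .
qed

text \<open>Classifies the maps from an \<open>l\<close>-set to an \<open>x\<close>-set by the size
  of their image. The proof is algebraic, by induction on \<open>l\<close>: \<open>eq\<close>
  expresses multiplication by \<open>x\<close> in the basis of binomial coefficients.\<close>

lemma power_eq_sum_Stirling: "x ^ l = (\<Sum>i\<le>x. (x choose i) * (fact i * Stirling l i))"
proof (induction l)
  case 0
  have "(\<Sum>i\<le>x. (x choose i) * (fact i * Stirling 0 i)) = (\<Sum>i\<in>{0}. (x choose i) * (fact i * Stirling 0 i))"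
  proof (rule sum.mono_neutral_right)
    show "\<forall>i\<in>{..x} - {0}. (x choose i) * (fact i * Stirling 0 i) = 0"
      using gr0_implies_Suc by fastforce
  qed auto
  then show ?case by simp
next
  case (Suc l)
  have eq: "x * (x choose i) = i * (x choose i) + Suc i * (x choose Suc i)" for i
  proof (cases "i \<le> x")
    case True
    have "Suc i * (x choose Suc i) = (x - i) * (x choose i)"
      by (simp only: binomial_absorb_comp binomial_absorption)
    then show ?thesis using True by (simp add: diff_mult_distrib)
  qed (simp add: binomial_eq_0)
  have "x ^ Suc l = (\<Sum>i\<le>x. (x * (x choose i)) * (fact i * Stirling l i))"
    by (simp add: Suc.IH sum_distrib_left mult.assoc)
  also have "\<dots> = (\<Sum>i\<le>x. i * (x choose i) * (fact i * Stirling l i)) +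
      (\<Sum>i\<le>x. Suc i * (x choose Suc i) * (fact i * Stirling l i))"
    unfolding eq by (simp add: algebra_simps sum.distrib)
  also have "(\<Sum>i\<le>x. Suc i * (x choose Suc i) * (fact i * Stirling l i)) =
      (\<Sum>i<x. Suc i * (x choose Suc i) * (fact i * Stirling l i))"
    by (rule sum.mono_neutral_right) auto
  also have "(\<Sum>i\<le>x. i * (x choose i) * (fact i * Stirling l i)) =
      (\<Sum>i<x. Suc i * (x choose Suc i) * (fact (Suc i) * Stirling l (Suc i)))"
    by (cases x) (simp_all only: sum.atMost_Suc_shift lessThan_Suc_atMost, simp_all)
  also have "(\<Sum>i<x. Suc i * (x choose Suc i) * (fact (Suc i) * Stirling l (Suc i))) +
      (\<Sum>i<x. Suc i * (x choose Suc i) * (fact i * Stirling l i)) =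
      (\<Sum>i<x. (x choose Suc i) * (fact (Suc i) * Stirling (Suc l) (Suc i)))"
    unfolding sum.distrib[symmetric] by (intro sum.cong) (auto simp: algebra_simps)
  also have "\<dots> = (\<Sum>i\<le>x. (x choose i) * (fact i * Stirling (Suc l) i))"
    by (cases x) (simp_all only: sum.atMost_Suc_shift lessThan_Suc_atMost, simp_all)
  finally show ?case .
qed

lemma sum_Pow_card:
  fixes g :: "nat \<Rightarrow> real"
  assumes "finite X"
  shows "(\<Sum>I\<in>Pow X. g (card I)) = (\<Sum>i\<le>card X. real (card X choose i) * g i)"
proof -
  have "(\<Sum>I\<in>Pow X. g (card I)) = (\<Sum>i\<le>card X. \<Sum>I | I \<in> Pow X \<and> card I = i. g (card I))"
    by (rule sum.group[symmetric]) (use assms in \<open>auto intro: card_mono\<close>)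
  also have "\<dots> = (\<Sum>i\<le>card X. real (card X choose i) * g i)"
  proof (rule sum.cong[OF refl])
    fix i
    have "(\<Sum>I | I \<in> Pow X \<and> card I = i. g (card I)) = real (card {I. I \<subseteq> X \<and> card I = i}) * g i"
      by simp
    then show "(\<Sum>I | I \<in> Pow X \<and> card I = i. g (card I)) = real (card X choose i) * g i"
      using n_subsets[OF assms] by simp
  qed
  finally show ?thesis .
qed

text \<open>Each map from an \<open>l\<close>-set into \<open>X\<close> is a surjection onto exactly
  one subset of \<open>X\<close>.\<close>

lemma sum_Pow_fact_Stirling:
  assumes "finite X"
  shows "(\<Sum>I\<in>Pow X. fact (card I) * real (Stirling l (card I))) = real (card X) ^ l"
  using sum_Pow_card[OF assms, of "\<lambda>i. fact i * real (Stirling l i)"]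
  by (simp add: of_nat_power[symmetric] power_eq_sum_Stirling[of "card X" l] del: of_nat_power)

text \<open>Sources and targets are separate arbitrary sets, so that the inversion below can shrink
  either of them.\<close>

definition covering_relations :: "'a set \<Rightarrow> 'b set \<Rightarrow> nat \<Rightarrow> ('a \<times> 'b) set set" where
  "covering_relations X Y m = {A. fst ` A = X \<and> snd ` A = Y \<and> card A = m \<and> finite A}"

lemma finite_covering_relations:
  assumes "finite X" "finite Y" shows "finite (covering_relations X Y m)"
proof (rule finite_subset)
  show "covering_relations X Y m \<subseteq> Pow (X \<times> Y)"
    unfolding covering_relations_def by force
qed (use assms in auto)

text \<open>Inversion over pairs of subsets, by strong induction on \<open>card X + card Y\<close>.
  Summed over all I <= X and J <= Y, both sides give the number of ordered \<open>m\<close>-tuples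
  of distinct pairs: the left one because an \<open>m\<close>-set of pairs covers exactly its two
  projections, the right one because the inner sums are powers and
  \<open>falling_factorial_stirling\<close> applies. The terms of all smaller pairs agree by
  induction, hence so do the terms at (X, Y).\<close>

lemma card_covering_relations:
  assumes "finite X" "finite Y"
  shows "fact m * real (card (covering_relations X Y m)) =
    (\<Sum>k\<le>m. (-1) ^ k * of_nat (stirling m (m - k)) *
      ((fact (card X) * real (Stirling (m - k) (card X))) * (fact (card Y) * real (Stirling (m - k) (card Y)))))"
    (is "_ = ?F (card X) (card Y)")
  using assms
proof (induction "card X + card Y" arbitrary: X Y rule: less_induct)
  case less
  note fin = \<open>finite X\<close> \<open>finite Y\<close>
  let ?P = "Pow X \<times> Pow Y"
  define N where "N = (\<lambda>(I::'a set, J::'b set). real (card (covering_relations I J m)))"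
  define F where "F = (\<lambda>(I::'a set, J::'b set). ?F (card I) (card J))"
  have "(\<Sum>p\<in>?P. N p) = real (card X * card Y choose m)"
  proof -
    have "card X * card Y choose m = card {A. A \<subseteq> X \<times> Y \<and> card A = m}"
      using n_subsets[of "X \<times> Y" m] fin by (simp add: card_cartesian_product)
    also have "{A. A \<subseteq> X \<times> Y \<and> card A = m} = (\<Union>p\<in>?P. (\<lambda>(I, J). covering_relations I J m) p)"
    proof (intro equalityI subsetI)
      fix A assume A: "A \<in> {A. A \<subseteq> X \<times> Y \<and> card A = m}"
      then have "finite A" using fin finite_subset by auto
      then show "A \<in> (\<Union>p\<in>?P. (\<lambda>(I, J). covering_relations I J m) p)"
        using A by (intro UN_I[of "(fst ` A, snd ` A)"]) (auto simp: covering_relations_def)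
    next
      fix A assume "A \<in> (\<Union>p\<in>?P. (\<lambda>(I, J). covering_relations I J m) p)"
      then have "fst ` A \<subseteq> X" "snd ` A \<subseteq> Y" "card A = m" by (auto simp: covering_relations_def)
      moreover from this have "A \<subseteq> X \<times> Y" by force
      ultimately show "A \<in> {A. A \<subseteq> X \<times> Y \<and> card A = m}" by simp
    qed
    also have "card \<dots> = (\<Sum>p\<in>?P. card ((\<lambda>(I, J). covering_relations I J m) p))"
    proof (rule card_UN_disjoint)
      show "\<forall>i\<in>?P. finite (case i of (I, J) \<Rightarrow> covering_relations I J m)"
        using fin by (auto intro!: finite_covering_relations intro: finite_subset)
    qed (use fin in \<open>auto simp: covering_relations_def\<close>)
    finally show ?thesis by (simp add: N_def case_prod_unfold)
  qed
  then have 1: "(\<Sum>p\<in>?P. fact m * N p) = fact m * real (card X * card Y choose m)"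
    by (simp flip: sum_distrib_left)
  have "(\<Sum>p\<in>?P. F p) = (\<Sum>k\<le>m. \<Sum>p\<in>?P. (-1) ^ k * of_nat (stirling m (m - k)) *
      ((fact (card (fst p)) * real (Stirling (m - k) (card (fst p)))) * (fact (card (snd p)) * real (Stirling (m - k) (card (snd p))))))"
    unfolding F_def case_prod_unfold by (rule sum.swap)
  also have "\<dots> = (\<Sum>k\<le>m. (-1) ^ k * of_nat (stirling m (m - k)) * (real (card X) * real (card Y)) ^ (m - k))"
  proof (rule sum.cong[OF refl])
    fix k
    have "(\<Sum>p\<in>?P. (-1) ^ k * of_nat (stirling m (m - k)) *
      ((fact (card (fst p)) * real (Stirling (m - k) (card (fst p)))) * (fact (card (snd p)) * real (Stirling (m - k) (card (snd p)))))) =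
      (-1) ^ k * of_nat (stirling m (m - k)) * ((\<Sum>I\<in>Pow X. fact (card I) * real (Stirling (m - k) (card I))) *
        (\<Sum>I\<in>Pow Y. fact (card I) * real (Stirling (m - k) (card I))))"
      unfolding sum_product sum.cartesian_product by (simp add: case_prod_unfold sum_distrib_left)
    then show "(\<Sum>p\<in>?P. (-1) ^ k * of_nat (stirling m (m - k)) *
      ((fact (card (fst p)) * real (Stirling (m - k) (card (fst p)))) * (fact (card (snd p)) * real (Stirling (m - k) (card (snd p)))))) =
      (-1) ^ k * of_nat (stirling m (m - k)) * (real (card X) * real (card Y)) ^ (m - k)"
      using fin by (simp only: sum_Pow_fact_Stirling power_mult_distrib)
  qed
  also have "\<dots> = (\<Prod>i<m. real (card X * card Y) - of_nat i)"
    by (simp add: falling_factorial_stirling)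
  also have "\<dots> = fact m * real (card X * card Y choose m)"
    by (simp only: binomial_gbinomial gbinomial_prod_rev lessThan_atLeast0) simp
  finally have 2: "(\<Sum>p\<in>?P. F p) = fact m * real (card X * card Y choose m)" .
  have "(\<Sum>p\<in>?P - {(X, Y)}. fact m * N p) = (\<Sum>p\<in>?P - {(X, Y)}. F p)"
  proof (rule sum.cong[OF refl])
    fix p assume p: "p \<in> ?P - {(X, Y)}"
    obtain I J where [simp]: "p = (I, J)" by force
    have IJ: "I \<subseteq> X" "J \<subseteq> Y" "I \<noteq> X \<or> J \<noteq> Y" using p by auto
    then have "card I + card J < card X + card Y"
      using fin by (metis add_le_less_mono add_less_le_mono card_mono psubset_card_mono psubsetI)
    moreover have "finite I" "finite J" using IJ fin finite_subset by auto
    ultimately show "fact m * N p = F p" using less.hyps[of I J] by (simp add: N_def F_def)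
  qed
  then have "fact m * N (X, Y) = F (X, Y)"
    using 1 2 sum.remove[of ?P "(X, Y)" "\<lambda>p. fact m * N p"] sum.remove[of ?P "(X, Y)" F] fin by simp
  then show ?case by (simp add: N_def F_def)
qed

text \<open>With the vertex set fixed, a digraph is its set of arcs; positive outdegree of
  \<open>v\<close> means that \<open>v\<close> is a first component of some arc, positive indegree
  that it is a second component.\<close>

lemma card_core_digraphs: "card (core_digraphs n m) = card (covering_relations {1..n} {1..n} m)"
proof -
  have "bij_betw parcs (core_digraphs n m) (covering_relations {1..n} {1..n} m)"
  proof (rule bij_betwI')
    fix G H assume GH: "G \<in> core_digraphs n m" "H \<in> core_digraphs n m"
    then have "pverts G = pverts H" unfolding core_digraphs_def by blast
    then show "(parcs G = parcs H) = (G = H)"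
      using pair_pre_digraph.equality[of G H] by auto
  next
    fix G assume G: "G \<in> core_digraphs n m"
    then interpret pair_fin_digraph G by (simp add: core_digraphs_def)
    have [simp]: "pverts G = {1..n}" "card (parcs G) = m" using G by (auto simp: core_digraphs_def)
    have ne: "in_arcs (with_proj G) v \<noteq> {}" "out_arcs (with_proj G) v \<noteq> {}" if "v \<in> {1..n}" for v
    proof -
      have "card (in_arcs (with_proj G) v) \<ge> 1" "card (out_arcs (with_proj G) v) \<ge> 1"
        using G that by (simp_all add: core_digraphs_def in_degree_def out_degree_def)
      then show "in_arcs (with_proj G) v \<noteq> {}" "out_arcs (with_proj G) v \<noteq> {}" by auto
    qed
    have "fst ` parcs G = {1..n}"
    proof (intro equalityI subsetI)
      fix v assume "v \<in> {1..n}"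
      with ne(2)[of v] show "v \<in> fst ` parcs G" by (force simp: out_arcs_def)
    qed (use arc_fst_in_verts in auto)
    moreover have "snd ` parcs G = {1..n}"
    proof (intro equalityI subsetI)
      fix v assume "v \<in> {1..n}"
      with ne(1)[of v] show "v \<in> snd ` parcs G" by (force simp: in_arcs_def)
    qed (use arc_snd_in_verts in auto)
    ultimately show "parcs G \<in> covering_relations {1..n} {1..n} m"
      using pair_finite_arcs by (simp add: covering_relations_def)
  next
    fix A assume "A \<in> covering_relations {1..n} {1..n} m"
    then have A: "fst ` A = {1..n}" "snd ` A = {1..n}" "card A = m" "finite A"
      by (auto simp: covering_relations_def)
    define G where "G = \<lparr>pverts = {1..n}, parcs = A\<rparr>"
    have [simp]: "pverts G = {1..n}" "parcs G = A" by (simp_all add: G_def)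
    have "fst e \<in> {1..n}" "snd e \<in> {1..n}" if "e \<in> A" for e
      using that A(1,2) by blast+
    then have "pair_fin_digraph G"
      using A(4) by unfold_locales simp_all
    moreover have "in_degree (with_proj G) v \<ge> 1 \<and> out_degree (with_proj G) v \<ge> 1" if "v \<in> {1..n}" for v
    proof -
      have "in_arcs (with_proj G) v \<noteq> {}"
        using that unfolding A(2)[symmetric] by (auto simp: in_arcs_def)
      moreover have "out_arcs (with_proj G) v \<noteq> {}"
        using that unfolding A(1)[symmetric] by (auto simp: out_arcs_def)
      moreover have "finite (in_arcs (with_proj G) v)" "finite (out_arcs (with_proj G) v)"
        using A(4) by (auto simp: in_arcs_def out_arcs_def)
      ultimately show ?thesis
        unfolding in_degree_def out_degree_def by (simp add: Suc_le_eq card_gt_0_iff)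
    qed
    ultimately have "G \<in> core_digraphs n m"
      unfolding core_digraphs_def mem_Collect_eq \<open>pverts G = {1..n}\<close> \<open>parcs G = A\<close> using A(3) by blast
    then show "\<exists>G\<in>core_digraphs n m. A = parcs G" using \<open>parcs G = A\<close> by blast
  qed
  then show ?thesis by (rule bij_betw_same_card)
qed

section \<open>Counts by the union bound, for large m / n\<close>

lemma card_covering_relations_le:
  assumes "finite X" "finite Y"
  shows "card (covering_relations X Y m) \<le> (card X * card Y) choose m"
proof -
  have "card (covering_relations X Y m) \<le> card {A. A \<subseteq> X \<times> Y \<and> card A = m}"
  proof (rule card_mono)
    show "finite {A. A \<subseteq> X \<times> Y \<and> card A = m}"
      by (rule finite_subset[of _ "Pow (X \<times> Y)"]) (use assms in auto)
    show "covering_relations X Y m \<subseteq> {A. A \<subseteq> X \<times> Y \<and> card A = m}"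
    proof
      fix A assume "A \<in> covering_relations X Y m"
      then have A: "fst ` A = X" "snd ` A = Y" "card A = m" by (auto simp: covering_relations_def)
      then have "A \<subseteq> X \<times> Y" by force
      with A show "A \<in> {A. A \<subseteq> X \<times> Y \<and> card A = m}" by simp
    qed
  qed
  also have "\<dots> = (card X * card Y) choose m"
    using n_subsets[of "X \<times> Y" m] assms by (simp add: card_cartesian_product)
  finally show ?thesis .
qed

text \<open>An \<open>m\<close>-set of pairs that fails to cover misses some source \<open>x\<close>
  or some target \<open>y\<close>, so it lies in one of the smaller rectangles with \<open>x\<close>
  or \<open>y\<close> deleted.\<close>

lemma card_covering_relations_ge:
  assumes "finite X" "finite Y"
  shows "(card X * card Y) choose m \<le> card (covering_relations X Y m) +
     card X * (((card X - 1) * card Y) choose m) + card Y * ((card X * (card Y - 1)) choose m)"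
proof -
  let ?B = "\<lambda>X Y. {A. A \<subseteq> X \<times> Y \<and> card A = m}"
  have fB: "finite (?B X' Y')" if "X' \<subseteq> X" "Y' \<subseteq> Y" for X' Y'
    by (rule finite_subset[of _ "Pow (X \<times> Y)"]) (use that assms in auto)
  have cB: "card (?B X' Y') = (card X' * card Y') choose m" if "X' \<subseteq> X" "Y' \<subseteq> Y" for X' Y'
    using n_subsets[of "X' \<times> Y'" m] finite_subset[OF that(1) assms(1)] finite_subset[OF that(2) assms(2)]
    by (simp add: card_cartesian_product)
  have "?B X Y \<subseteq> covering_relations X Y m \<union> (\<Union>x\<in>X. ?B (X - {x}) Y) \<union> (\<Union>y\<in>Y. ?B X (Y - {y}))"
  proof
    fix A assume A: "A \<in> ?B X Y"
    then have "finite A" using assms finite_subset by auto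
    show "A \<in> covering_relations X Y m \<union> (\<Union>x\<in>X. ?B (X - {x}) Y) \<union> (\<Union>y\<in>Y. ?B X (Y - {y}))"
    proof (cases "fst ` A = X \<and> snd ` A = Y")
      case True
      then show ?thesis using A \<open>finite A\<close> by (simp add: covering_relations_def)
    next
      case False
      moreover have "fst ` A \<subseteq> X" "snd ` A \<subseteq> Y" using A by auto
      ultimately have "(\<exists>x\<in>X. x \<notin> fst ` A) \<or> (\<exists>y\<in>Y. y \<notin> snd ` A)" by blast
      then show ?thesis
      proof (elim disjE bexE)
        fix x assume x: "x \<in> X" "x \<notin> fst ` A"
        have "p \<in> (X - {x}) \<times> Y" if "p \<in> A" for p
          using that A x(2) by (cases p) force
        then have "A \<in> ?B (X - {x}) Y" using A by blast
        then show ?thesis using x by blast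
      next
        fix y assume y: "y \<in> Y" "y \<notin> snd ` A"
        have "p \<in> X \<times> (Y - {y})" if "p \<in> A" for p
          using that A y(2) by (cases p) force
        then have "A \<in> ?B X (Y - {y})" using A by blast
        then show ?thesis using y by blast
      qed
    qed
  qed
  then have "card (?B X Y) \<le> card (covering_relations X Y m \<union> (\<Union>x\<in>X. ?B (X - {x}) Y) \<union> (\<Union>y\<in>Y. ?B X (Y - {y})))"
    by (intro card_mono finite_UnI finite_UN_I finite_covering_relations fB assms Diff_subset subset_refl)
  also have "\<dots> \<le> card (covering_relations X Y m) + card (\<Union>x\<in>X. ?B (X - {x}) Y) + card (\<Union>y\<in>Y. ?B X (Y - {y}))"
    by (meson add_le_mono card_Un_le le_refl le_trans)
  also have "card (\<Union>x\<in>X. ?B (X - {x}) Y) \<le> (\<Sum>x\<in>X. card (?B (X - {x}) Y))"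
    by (rule card_UN_le) fact
  also have "(\<Sum>x\<in>X. card (?B (X - {x}) Y)) = card X * (((card X - 1) * card Y) choose m)"
    using assms by (simp add: cB)
  also have "card (\<Union>y\<in>Y. ?B X (Y - {y})) \<le> (\<Sum>y\<in>Y. card (?B X (Y - {y})))"
    by (rule card_UN_le) fact
  also have "(\<Sum>y\<in>Y. card (?B X (Y - {y}))) = card Y * ((card X * (card Y - 1)) choose m)"
    using assms by (simp add: cB)
  finally show ?thesis by (simp add: cB)
qed

lemma fact_Stirling_le: "fact n * Stirling m n \<le> n ^ m"
proof -
  have "(n choose n) * (fact n * Stirling m n) \<le> (\<Sum>i\<le>n. (n choose i) * (fact i * Stirling m i))"
    by (rule member_le_sum) auto
  then show ?thesis by (simp flip: power_eq_sum_Stirling)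
qed

text \<open>The union bound over missed values, read off from \<open>power_eq_sum_Stirling\<close>:
  for i < n one has C(n,i) <= (n-i) C(n,i) = n C(n-1,i), and summing against the surjection counts
  gives n (n-1)^m.\<close>

lemma fact_Stirling_ge: "n ^ m \<le> fact n * Stirling m n + n * (n - 1) ^ m"
proof (cases n)
  case 0
  then show ?thesis by (cases m) simp_all
next
  case (Suc k)
  have "n ^ m = (\<Sum>i\<le>k. (n choose i) * (fact i * Stirling m i)) + fact n * Stirling m n"
    unfolding power_eq_sum_Stirling[of n m] by (simp add: Suc del: fact_Suc binomial_Suc_Suc)
  also have "(\<Sum>i\<le>k. (n choose i) * (fact i * Stirling m i)) \<le>
      (\<Sum>i\<le>k. n * (k choose i) * (fact i * Stirling m i))"
  proof (intro sum_mono mult_right_mono)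
    fix i assume "i \<in> {..k}"
    then have "(n choose i) \<le> (n - i) * (n choose i)" using Suc by simp
    also have "(n - i) * (n choose i) = n * (k choose i)"
      using Suc binomial_absorb_comp[of n i] by simp
    finally show "n choose i \<le> n * (k choose i)" .
  qed simp
  also have "(\<Sum>i\<le>k. n * (k choose i) * (fact i * Stirling m i)) = n * k ^ m"
    unfolding power_eq_sum_Stirling[of k m] sum_distrib_left by (simp add: mult.assoc)
  finally show ?thesis using Suc by simp
qed

section \<open>Fourier series on the circle\<close>

text \<open>With x = |t|/2 <= 2 one has sin x >= x - x^3/6 >= x/3, and 1 - cos t = 2 sin^2 x. The
  constant 18 enters only the exponents of later tail bounds.\<close>

lemma one_minus_cos_ge:
  fixes t :: real
  assumes "\<bar>t\<bar> \<le> pi"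
  shows "t\<^sup>2 / 18 \<le> 1 - cos t"
proof -
  define x where "x = \<bar>t\<bar> / 2"
  have x: "0 \<le> x" "x \<le> 2" using assms pi_less_4 by (auto simp: x_def)
  have "\<bar>sin x - (\<Sum>m<3. sin_coeff m * x ^ m)\<bar> \<le> inverse (fact 3) * \<bar>x\<bar> ^ 3"
    by (rule Maclaurin_sin_bound)
  moreover have "(\<Sum>m<3. sin_coeff m * x ^ m) = x"
    by (simp add: numeral_3_eq_3 sin_coeff_def)
  moreover have "inverse (fact 3) * \<bar>x\<bar> ^ 3 = x ^ 3 / 6"
    using x by (simp add: fact_numeral)
  ultimately have "x - x ^ 3 / 6 \<le> sin x" by linarith
  moreover have "x ^ 3 / 6 \<le> 2 * x / 3"
    using mult_mono[OF x(2) x(2)] x mult_left_mono[of "x * x" 4 x] by (simp add: power3_eq_cube algebra_simps)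
  ultimately have "x / 3 \<le> sin x" by simp
  then have "(x / 3)\<^sup>2 \<le> (sin x)\<^sup>2" using x by (intro power_mono) auto
  moreover have "1 - cos t = 2 * (sin x)\<^sup>2"
    using cos_double_sin[of x] by (simp add: x_def)
  moreover have "(x / 3)\<^sup>2 = t\<^sup>2 / 36" by (simp add: x_def power2_eq_square)
  ultimately show ?thesis by simp
qed

lemma one_minus_cos_le: "2 * (1 - cos t) \<le> (t::real)\<^sup>2"
proof -
  have "\<bar>sin (t / 2)\<bar> \<le> \<bar>t / 2\<bar>" by (rule abs_sin_x_le_abs_x)
  then have "(sin (t / 2))\<^sup>2 \<le> (t / 2)\<^sup>2" by (simp only: abs_le_square_iff)
  moreover have "cos t = 1 - 2 * (sin (t / 2))\<^sup>2" using cos_double_sin[of "t / 2"] by simp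
  ultimately show ?thesis by (simp add: power_divide)
qed

text \<open>Left unnormalised: the total mass 2 pi is carried along explicitly. Finiteness of the
  measure makes bounded continuous functions integrable.\<close>

definition circ :: "real measure" where "circ = restrict_space lborel {- pi..pi}"

lemma space_circ [simp]: "space circ = {- pi..pi}"
  by (simp add: circ_def space_restrict_space)

lemma measurable_circI: "f \<in> borel_measurable borel \<Longrightarrow> f \<in> borel_measurable circ"
  unfolding circ_def by (intro measurable_restrict_space1) simp

lemma emeasure_circ: "emeasure circ {- pi..pi} = ennreal (2 * pi)"
  by (simp add: circ_def emeasure_restrict_space)

interpretation circ: finite_measure circ
  by standard (simp add: emeasure_circ)

lemma measure_circ: "measure circ {- pi..pi} = 2 * pi"
  by (simp add: measure_def emeasure_circ)

lemma integrable_circ: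
  fixes f :: "real \<Rightarrow> 'a::{banach, second_countable_topology}"
  assumes "continuous_on UNIV f" "\<And>t. norm (f t) \<le> B"
  shows "integrable circ f"
  by (rule circ.integrable_const_bound[where B = B])
    (use assms in \<open>auto intro!: measurable_circI borel_measurable_continuous_onI\<close>)

lemma integral_cis:
  "integral\<^sup>L circ (\<lambda>t. cis (of_int j * t)) = (if j = 0 then complex_of_real (2 * pi) else 0)"
proof (cases "j = 0")
  case True
  then show ?thesis by (simp add: measure_circ scaleR_conv_of_real)
next
  case False
  define F where "F = (\<lambda>t::real. cis (of_int j * t) / (\<i> * of_int j))"
  have "integral\<^sup>L circ (\<lambda>t. cis (of_int j * t)) = (\<integral>t. indicator {- pi..pi} t *\<^sub>R cis (of_int j * t) \<partial>lborel)"
    unfolding circ_def by (rule integral_restrict_space) auto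
  also have "\<dots> = F pi - F (- pi)"
  proof (rule integral_FTC_Icc)
    fix t
    have "((\<lambda>t. exp (\<i> * of_int j * of_real t) / (\<i> * of_int j)) has_vector_derivative
        exp (\<i> * of_int j * of_real t) * (\<i> * of_int j * 1) / (\<i> * of_int j)) (at t within {- pi..pi})"
      by (rule has_vector_derivative_real_field) (use False in \<open>auto intro!: derivative_eq_intros\<close>)
    then show "(F has_vector_derivative cis (of_int j * t)) (at t within {- pi..pi})"
      using False by (simp add: F_def cis_conv_exp mult.assoc)
  qed (auto intro!: continuous_intros)
  also have "F pi = F (- pi)"
  proof -
    have "cis (of_int j * pi) = cis (of_int j * - pi)"
      using sin_times_pi_eq_0[of "of_int j"] by (simp add: complex_eq_iff)
    then show ?thesis by (simp add: F_def)
  qed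
  finally show ?thesis using False by simp
qed

text \<open>The characteristic function of \<open>a\<close> when \<open>a\<close> is a probability
  law.\<close>

definition fseries :: "(nat \<Rightarrow> real) \<Rightarrow> real \<Rightarrow> complex" where
  "fseries a t = (\<Sum>k. of_real (a k) * cis (real k * t))"

lemma summable_fseries:
  assumes "summable (\<lambda>k. \<bar>a k\<bar>)"
  shows "summable (\<lambda>k. of_real (a k) * cis (real k * t))"
  by (rule summable_norm_cancel) (simp add: norm_mult assms)

lemma continuous_fseries [continuous_intros]:
  assumes "summable (\<lambda>k. \<bar>a k\<bar>)"
  shows "continuous_on UNIV (fseries a)"
proof -
  have "uniform_limit UNIV (\<lambda>n t. \<Sum>k<n. of_real (a k) * cis (real k * t)) (fseries a) sequentially"
    unfolding fseries_def
    by (rule Weierstrass_m_test[where M = "\<lambda>k. \<bar>a k\<bar>"]) (use assms in \<open>auto simp: norm_mult\<close>)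
  then show ?thesis
    by (rule uniform_limit_theorem[rotated]) (auto intro!: always_eventually continuous_intros)
qed

lemma norm_fseries_le:
  assumes "summable (\<lambda>k. \<bar>a k\<bar>)"
  shows "norm (fseries a t) \<le> (\<Sum>k. \<bar>a k\<bar>)"
  unfolding fseries_def by (rule norm_suminf_le) (use assms in \<open>auto simp: norm_mult\<close>)

text \<open>Integration term by term and orthogonality. Negative frequencies are included because
  later the frequency is \<open>d - k\<close> with \<open>k\<close> running beyond
  \<open>d\<close>.\<close>

lemma integral_fseries_cis:
  assumes "summable (\<lambda>k. \<bar>a k\<bar>)"
  shows "integral\<^sup>L circ (\<lambda>t. fseries a t * cis (- (of_int l * t))) =
    (if l < 0 then 0 else of_real (2 * pi * a (nat l)))"
proof -
  let ?f = "\<lambda>k t. of_real (a k) * cis (real k * t) * cis (- (of_int l * t))"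
  have f: "?f k = (\<lambda>t. of_real (a k) * cis (of_int (int k - l) * t))" for k
    by (auto simp: cis_mult mult.assoc algebra_simps fun_eq_iff)
  have "(\<lambda>t. fseries a t * cis (- (of_int l * t))) = (\<lambda>t. \<Sum>k. ?f k t)"
    unfolding fseries_def by (intro ext suminf_mult2 summable_fseries assms)
  then have "integral\<^sup>L circ (\<lambda>t. fseries a t * cis (- (of_int l * t))) = integral\<^sup>L circ (\<lambda>t. \<Sum>k. ?f k t)"
    by simp
  also have "\<dots> = (\<Sum>k. integral\<^sup>L circ (?f k))"
  proof (rule integral_suminf)
    show "integrable circ (?f k)" for k
      by (rule integrable_circ[where B = "\<bar>a k\<bar>"]) (auto intro!: continuous_intros simp: norm_mult)
    show "AE t in circ. summable (\<lambda>k. norm (?f k t))" using assms by (simp add: norm_mult)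
    show "summable (\<lambda>k. \<integral>t. norm (?f k t) \<partial>circ)"
      using assms by (simp add: norm_mult measure_circ)
  qed
  also have "\<dots> = (\<Sum>k. if int k = l then of_real (2 * pi * a k) else 0)"
    unfolding f integral_mult_right_zero integral_cis by (intro suminf_cong) auto
  also have "\<dots> = (\<Sum>k\<in>(if l < 0 then {} else {nat l}). if int k = l then of_real (2 * pi * a k) else 0)"
    by (rule suminf_finite) auto
  also have "\<dots> = (if l < 0 then 0 else of_real (2 * pi * a (nat l)))" by auto
  finally show ?thesis .
qed

text \<open>One factor of |f|^2 = f cnj f is expanded into its series and integrated term by term;
  absolute summability of \<open>a\<close> supplies the domination.\<close>

lemma parseval:
  assumes "summable (\<lambda>k. \<bar>a k\<bar>)"
  shows "summable (\<lambda>k. (a k)\<^sup>2)" "integral\<^sup>L circ (\<lambda>t. (norm (fseries a t))\<^sup>2) = 2 * pi * (\<Sum>k. (a k)\<^sup>2)"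
proof -
  define B where "B = (\<Sum>k. \<bar>a k\<bar>)"
  have aB: "\<bar>a k\<bar> \<le> B" for k
    unfolding B_def using sum_le_suminf[OF assms, of "{k}"] by simp
  show sq: "summable (\<lambda>k. (a k)\<^sup>2)"
  proof (rule summable_comparison_test'[of "\<lambda>k. B * \<bar>a k\<bar>" 0])
    fix k
    have "\<bar>a k\<bar> * \<bar>a k\<bar> \<le> B * \<bar>a k\<bar>" by (intro mult_right_mono aB) auto
    then show "norm ((a k)\<^sup>2) \<le> B * \<bar>a k\<bar>" by (simp add: power2_eq_square)
  qed (intro summable_mult assms)
  let ?f = "\<lambda>k t. of_real (a k) * (fseries a t * cis (- (of_int (int k) * t)))"
  have nf: "norm (fseries a t) \<le> B" for t unfolding B_def by (rule norm_fseries_le[OF assms])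
  have eq: "of_real ((norm (fseries a t))\<^sup>2) = (\<Sum>k. ?f k t)" for t
  proof -
    have "(\<lambda>k. cnj (of_real (a k) * cis (real k * t))) sums cnj (fseries a t)"
      unfolding fseries_def sums_cnj by (intro summable_sums summable_fseries assms)
    from sums_mult[OF this, of "fseries a t"] have "(\<lambda>k. ?f k t) sums (fseries a t * cnj (fseries a t))"
      by (simp add: cis_cnj algebra_simps)
    then show ?thesis by (simp add: sums_iff complex_norm_square[symmetric])
  qed
  have nb: "norm (?f k t) \<le> \<bar>a k\<bar> * B" for k t
    by (simp add: norm_mult mult_left_mono nf)
  have cf: "continuous_on UNIV (?f k)" for k by (intro continuous_intros assms)
  have "of_real (integral\<^sup>L circ (\<lambda>t. (norm (fseries a t))\<^sup>2)) = integral\<^sup>L circ (\<lambda>t. of_real ((norm (fseries a t))\<^sup>2) :: complex)"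
    by (rule integral_complex_of_real[symmetric])
  also have "\<dots> = integral\<^sup>L circ (\<lambda>t. \<Sum>k. ?f k t)" unfolding eq ..
  also have "\<dots> = (\<Sum>k. integral\<^sup>L circ (?f k))"
  proof (rule integral_suminf)
    show ik: "integrable circ (?f k)" for k
      by (rule integrable_circ[OF cf nb])
    show "AE t in circ. summable (\<lambda>k. norm (?f k t))"
      using summable_mult2[OF assms] by (simp add: norm_mult)
    show "summable (\<lambda>k. \<integral>t. norm (?f k t) \<partial>circ)"
    proof (rule summable_comparison_test'[of "\<lambda>k. (\<bar>a k\<bar> * B) * (2 * pi)" 0])
      fix k
      have "(\<integral>t. norm (?f k t) \<partial>circ) \<le> (\<integral>t. \<bar>a k\<bar> * B \<partial>circ)"
        by (intro integral_mono integrable_norm ik nb) auto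
      then show "norm (\<integral>t. norm (?f k t) \<partial>circ) \<le> (\<bar>a k\<bar> * B) * (2 * pi)"
        by (simp add: measure_circ mult_ac)
    qed (intro summable_mult2 assms)
  qed
  also have "\<dots> = (\<Sum>k. of_real (2 * pi * (a k)\<^sup>2))"
    unfolding integral_mult_right_zero integral_fseries_cis[OF assms] by (simp add: power2_eq_square algebra_simps)
  also have "\<dots> = of_real (2 * pi * (\<Sum>k. (a k)\<^sup>2))"
    by (subst suminf_of_real[symmetric]) (auto intro!: summable_mult sq simp: suminf_mult[OF sq])
  finally show "integral\<^sup>L circ (\<lambda>t. (norm (fseries a t))\<^sup>2) = 2 * pi * (\<Sum>k. (a k)\<^sup>2)"
    by (simp only: of_real_eq_iff)
qed

section \<open>A local limit theorem for the number of surjections\<close>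

definition surj_count :: "nat \<Rightarrow> nat \<Rightarrow> real" where
  "surj_count n m = fact n * real (Stirling m n)"

lemma surj_count_nonneg: "0 \<le> surj_count n m"
  by (simp add: surj_count_def)

lemma surj_count_le: "surj_count n m \<le> real n ^ m"
proof -
  have "real (fact n * Stirling m n) \<le> real (n ^ m)"
    by (rule of_nat_mono) (rule fact_Stirling_le)
  then show ?thesis by (simp add: surj_count_def)
qed

text \<open>Strong induction on \<open>n\<close>: exp (n x) = ((exp x - 1) + 1)^n expands over i <=
  n, and the coefficients of exp (n x) expand in the same way by
  \<open>power_eq_sum_Stirling\<close>; subtracting the terms i < n leaves the claim. It is used at
  real points and at points of a complex circle, hence the general field.\<close>

lemma surj_count_egf:
  fixes x :: "'a::{real_normed_field, banach}"
  shows "(\<lambda>k. of_real (surj_count n k / fact k) * x ^ k) sums ((exp x - 1) ^ n)"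
proof (induction n rule: less_induct)
  case (less n)
  have "(\<lambda>k. (of_nat n * x) ^ k /\<^sub>R fact k) sums exp (of_nat n * x)"
    by (rule exp_converges)
  moreover have "(\<lambda>k. \<Sum>i<n. of_nat (n choose i) * (of_real (surj_count i k / fact k) * x ^ k)) sums
      (\<Sum>i<n. of_nat (n choose i) * (exp x - 1) ^ i)"
    by (intro sums_sum sums_mult less) auto
  ultimately have "(\<lambda>k. (of_nat n * x) ^ k /\<^sub>R fact k - (\<Sum>i<n. of_nat (n choose i) * (of_real (surj_count i k / fact k) * x ^ k)))
      sums (exp (of_nat n * x) - (\<Sum>i<n. of_nat (n choose i) * (exp x - 1) ^ i))"
    by (rule sums_diff)
  moreover have "(of_nat n * x) ^ k /\<^sub>R fact k - (\<Sum>i<n. of_nat (n choose i) * (of_real (surj_count i k / fact k) * x ^ k)) =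
      of_real (surj_count n k / fact k) * x ^ k" for k
  proof -
    have "(of_nat n :: 'a) ^ k = of_nat (n ^ k)" by simp
    also have "\<dots> = (\<Sum>i\<le>n. of_nat (n choose i) * of_real (surj_count i k))"
      by (simp only: power_eq_sum_Stirling[of n k]) (simp add: surj_count_def)
    also have "\<dots> = (\<Sum>i<n. of_nat (n choose i) * of_real (surj_count i k)) + of_real (surj_count n k)"
      by (simp flip: lessThan_Suc_atMost)
    finally have "(of_nat n * x) ^ k /\<^sub>R fact k =
      ((\<Sum>i<n. of_nat (n choose i) * of_real (surj_count i k)) + of_real (surj_count n k)) * (x ^ k / fact k)"
      by (simp add: power_mult_distrib scaleR_conv_of_real divide_inverse mult_ac)
    moreover have "(\<Sum>i<n. of_nat (n choose i) * (of_real (surj_count i k / fact k) * x ^ k)) =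
        (\<Sum>i<n. of_nat (n choose i) * of_real (surj_count i k)) * (x ^ k / fact k)"
      unfolding sum_distrib_right by (intro sum.cong) (simp_all add: mult.assoc)
    ultimately show ?thesis
      by (simp add: distrib_right add_divide_distrib)
  qed
  moreover have "exp (of_nat n * x) - (\<Sum>i<n. of_nat (n choose i) * (exp x - 1) ^ i) = (exp x - 1) ^ n"
  proof -
    have "exp (of_nat n * x) = ((exp x - 1) + 1) ^ n" by (simp add: exp_of_nat_mult)
    also have "\<dots> = (\<Sum>i\<le>n. of_nat (n choose i) * (exp x - 1) ^ i)"
      by (subst binomial_ring) simp
    finally show ?thesis by (simp flip: lessThan_Suc_atMost)
  qed
  ultimately show ?case by simp
qed

lemma sums_transfer: "f sums s \<Longrightarrow> (\<And>k. g k = f k) \<Longrightarrow> s' = s \<Longrightarrow> g sums s'"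
  by presburger

lemma surj_count_integral:
  assumes "0 \<le> l"
  shows "integral\<^sup>L circ (\<lambda>t. (exp (of_real l * cis t) - 1) ^ n * cis (- (real m * t))) =
    of_real (2 * pi * (surj_count n m / fact m * l ^ m))"
proof -
  let ?a = "\<lambda>k. surj_count n k / fact k * l ^ k"
  have *: "(\<lambda>k. ?a k) sums ((exp l - 1) ^ n)"
    using surj_count_egf[of n l] by simp
  have sm: "summable (\<lambda>k. \<bar>?a k\<bar>)"
    using * assms by (simp add: sums_iff abs_mult surj_count_nonneg)
  have "(exp (of_real l * cis t) - 1) ^ n = fseries ?a t" for t
  proof -
    have "(\<lambda>k. of_real (?a k) * cis (real k * t)) sums ((exp (of_real l * cis t) - 1) ^ n)"
      by (rule sums_transfer[OF surj_count_egf[of n "of_real l * cis t"]])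
        (simp_all add: power_mult_distrib Complex.DeMoivre)
    then show ?thesis by (simp add: fseries_def sums_iff)
  qed
  then show ?thesis
    using integral_fseries_cis[OF sm, of "int m"] by simp
qed

text \<open>The factor \<open>l\<close> in the exponent matches the variance, which lies between l/2
  and 2l by \<open>variance_bounds\<close>. After scaling by the standard deviation the bound
  becomes a Gaussian independent of \<open>l\<close>.\<close>

lemma norm_exp_minus_one_le:
  fixes l t :: real
  assumes "0 \<le> l"
  shows "norm (exp (of_real l * cis t) - 1) \<le> (exp l - 1) * exp (- (l * (1 - cos t) / 2))"
proof -
  have split: "exp x - 1 = 2 * exp (x / 2) * sinh (x / 2)" for x :: "'a::{real_normed_field, banach}"
  proof -
    have "2 * sinh (x / 2) = exp (x / 2) - exp (- (x / 2))"
      by (simp add: sinh_def scaleR_conv_of_real)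
    then have "exp (x / 2) * (2 * sinh (x / 2)) = exp (x / 2) * exp (x / 2) - exp (x / 2) * exp (- (x / 2))"
      by (simp only: right_diff_distrib)
    also have "\<dots> = exp x - 1" by (simp flip: exp_add)
    finally show ?thesis by (simp add: mult_ac)
  qed
  define x where "x = of_real l * cis t"
  \<comment> \<open>The Taylor coefficients of sinh are nonnegative, so the series can be bounded
    term by term.\<close>
  have "norm (sinh (x / 2)) \<le> sinh (norm (x / 2))"
    by (rule norm_sums_le[OF sinh_converges sinh_converges]) (auto simp: norm_power norm_divide)
  also have "norm (x / 2) = l / 2" using assms by (simp add: x_def norm_mult)
  finally have 1: "norm (sinh (x / 2)) \<le> sinh (l / 2)" .
  have "norm (exp x - 1) = 2 * exp (l * cos t / 2) * norm (sinh (x / 2))"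
    by (subst split) (simp add: norm_mult x_def)
  also have "\<dots> \<le> 2 * exp (l * cos t / 2) * sinh (l / 2)"
    using 1 by (intro mult_left_mono) auto
  also have "\<dots> = (exp l - 1) * exp (- (l * (1 - cos t) / 2))"
    by (subst split) (simp add: algebra_simps flip: exp_add, simp add: field_simps)
  finally show ?thesis by (simp add: x_def)
qed

text \<open>Iterated from \<open>h = 1\<close>, this produces the factorial moments of the Poisson
  law.\<close>

lemma sums_nat_mult_exp:
  fixes l :: real
  assumes "(\<lambda>k. h (Suc k) * (l ^ k / fact k)) sums s"
  shows "(\<lambda>k. real k * h k * (l ^ k / fact k)) sums (l * s)"
proof -
  have "(\<lambda>k. real (Suc k) * h (Suc k) * (l ^ Suc k / fact (Suc k))) = (\<lambda>k. l * (h (Suc k) * (l ^ k / fact k)))"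
    by (rule ext) (simp add: field_simps del: of_nat_Suc)
  then have "(\<lambda>k. real (Suc k) * h (Suc k) * (l ^ Suc k / fact (Suc k))) sums (l * s)"
    using sums_mult[OF assms, of l] by simp
  then show ?thesis by (subst (asm) sums_Suc_iff) simp
qed

lemma exp_ratio_bounds:
  fixes l :: real
  assumes "0 < l"
  shows "l \<le> l * exp l / (exp l - 1)" "1 < l * exp l / (exp l - 1)" "l * exp l / (exp l - 1) \<le> 1 + l"
proof -
  have e: "exp l > 1" using assms by simp
  have e1: "1 + l \<le> exp l" by (rule exp_ge_add_one_self)
  have "1 - l < exp (- l)" using exp_minus_greater[of l] assms by simp
  then have "(1 - l) * exp l < exp (- l) * exp l" by (intro mult_strict_right_mono) auto
  then have e2: "exp l - l * exp l < 1" by (simp add: algebra_simps flip: exp_add)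
  show "l \<le> l * exp l / (exp l - 1)" "1 < l * exp l / (exp l - 1)" "l * exp l / (exp l - 1) \<le> 1 + l"
    using e e1 e2 assms by (simp_all add: field_simps)
qed

text \<open>For l > 0 this says that l e^l / (e^l - 1) has derivative at least 1/2. It serves both
  the lower bound for the variance and the Lipschitz bound for lambda as a function of c.\<close>

lemma exp_minus_one_squared_le:
  fixes l :: real
  assumes "0 \<le> l"
  shows "(exp l - 1)\<^sup>2 \<le> 2 * (exp l * (exp l - 1 - l))"
proof -
  define f where "f = (\<lambda>x::real. exp x * exp x - 2 * x * exp x - 1)"
  have "f 0 \<le> f l"
  proof (rule DERIV_nonneg_imp_nondecreasing[where f = f])
    fix x assume "0 \<le> x" "x \<le> l"
    have "(f has_real_derivative 2 * exp x * (exp x - 1 - x)) (at x)"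
      unfolding f_def by (auto intro!: derivative_eq_intros simp: algebra_simps)
    moreover have "0 \<le> 2 * exp x * (exp x - 1 - x)"
      using exp_ge_add_one_self[of x] by (intro mult_nonneg_nonneg) (simp_all del: exp_ge_add_one_self)
    ultimately show "\<exists>y. (f has_real_derivative y) (at x) \<and> 0 \<le> y" by blast
  qed (use assms in auto)
  then show ?thesis by (simp add: f_def power2_eq_square algebra_simps)
qed

text \<open>The variance of a Poisson variable of parameter \<open>l\<close> conditioned to be positive, whose mean is \<open>c\<close>.\<close>

lemma variance_bounds:
  fixes l :: real
  assumes "0 < l" and c: "c = l * exp l / (exp l - 1)"
  shows "l / 2 \<le> c * (1 + l - c)" "c * (1 + l - c) \<le> 2 * l"
proof -
  have e: "exp l > 1" using assms by simp
  have cb: "l \<le> c" "1 < c" "c \<le> 1 + l" using exp_ratio_bounds[OF assms(1)] c by simp_all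
  have "1 + l - c = (exp l - 1 - l) / (exp l - 1)"
    using e by (simp add: c field_simps)
  then have eq: "c * (1 + l - c) = l * (exp l * (exp l - 1 - l) / (exp l - 1)\<^sup>2)"
    using e by (simp add: c power2_eq_square)
  have "(exp l - 1)\<^sup>2 \<le> 2 * (exp l * (exp l - 1 - l))"
    using assms(1) by (intro exp_minus_one_squared_le) simp
  then have "1 / 2 \<le> exp l * (exp l - 1 - l) / (exp l - 1)\<^sup>2"
    using e by (simp add: field_simps)
  then show "l / 2 \<le> c * (1 + l - c)"
    unfolding eq using mult_left_mono[of "1 / 2" "exp l * (exp l - 1 - l) / (exp l - 1)\<^sup>2" l] assms(1) by linarith
  have "1 + l - c \<le> min 1 l" using cb by simp
  show "c * (1 + l - c) \<le> 2 * l"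
  proof (cases "l \<le> 1")
    case True
    have "c * (1 + l - c) \<le> 2 * l" by (rule mult_mono) (use cb True in auto)
    then show ?thesis .
  next
    case False
    have "c * (1 + l - c) \<le> (2 * l) * 1" by (rule mult_mono) (use cb False in auto)
    then show ?thesis by simp
  qed
qed

text \<open>Second-order expansion of the characteristic function of X - c, where X is Poisson with
  parameter \<open>l\<close> conditioned to be positive, with mean c and variance c (1 + l - c).
  Since |e^(ix) - 1 - ix + x^2/2| <= |x|^3/6, it remains to bound E|X - c|^3. The factor
  \<open>l\<close> in the result is essential, as the estimate must survive l -> 0.\<close>

lemma char_fun_cubic:
  fixes l t :: real
  assumes l: "0 < l" and c: "c = l * exp l / (exp l - 1)"
  shows "norm ((exp (of_real l * cis t) - 1) / of_real (exp l - 1) * cis (- (c * t)) -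
      of_real (1 - c * (1 + l - c) * t\<^sup>2 / 2)) \<le> l * (1 + l)\<^sup>2 * \<bar>t\<bar> ^ 3"
proof -
  have e: "exp l - 1 > 0" using l by simp
  have cb: "l \<le> c" "1 < c" "c \<le> 1 + l" using exp_ratio_bounds[OF l] c by simp_all
  define p where "p = (\<lambda>k. if k = 0 then 0 else l ^ k / fact k / (exp l - 1))"
  have p0: "0 \<le> p k" for k using l e by (simp add: p_def)
  have S0: "(\<lambda>k. l ^ k / fact k) sums exp l"
    using exp_converges[of l] by (simp add: divide_inverse mult.commute)
  have S1: "(\<lambda>k. real k * 1 * (l ^ k / fact k)) sums (l * exp l)"
    by (rule sums_nat_mult_exp) (use S0 in simp)
  have S2: "(\<lambda>k. real k * (real k - 1) * (l ^ k / fact k)) sums (l * (l * exp l))"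
    by (rule sums_nat_mult_exp) (use S1 in simp)
  have S3: "(\<lambda>k. real k * ((real k - 1) * (real k - 2)) * (l ^ k / fact k)) sums (l * (l * (l * exp l)))"
    by (rule sums_nat_mult_exp) (use S2 in \<open>simp add: mult.assoc\<close>)
  have P0: "p sums 1"
  proof -
    have "(\<lambda>k. l ^ Suc k / fact (Suc k)) sums (exp l - 1)"
      using S0 by (subst sums_Suc_iff) simp
    then have "(\<lambda>k. p (Suc k)) sums 1"
      by (rule sums_transfer[OF sums_divide[of _ _ "exp l - 1"]]) (use e in \<open>simp_all add: p_def\<close>)
    then show ?thesis by (subst (asm) sums_Suc_iff) (simp add: p_def)
  qed
  have P1: "(\<lambda>k. real k * p k) sums c"
    by (rule sums_transfer[OF sums_divide[OF S1, of "exp l - 1"]]) (simp_all add: p_def c)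
  have P2: "(\<lambda>k. real k * (real k - 1) * p k) sums (l * c)"
    by (rule sums_transfer[OF sums_divide[OF S2, of "exp l - 1"]]) (simp_all add: p_def c)
  have P3: "(\<lambda>k. real k * ((real k - 1) * (real k - 2)) * p k) sums (l * (l * c))"
    by (rule sums_transfer[OF sums_divide[OF S3, of "exp l - 1"]]) (simp_all add: p_def c)
  have V: "(\<lambda>k. p k * (real k - c)\<^sup>2) sums (c * (1 + l - c))"
    by (rule sums_transfer[OF sums_add[OF sums_add[OF P2 sums_mult[OF P1, of "1 - 2 * c"]] sums_mult[OF P0, of "c\<^sup>2"]]])
      (simp_all add: algebra_simps power2_eq_square)
  have M: "(\<lambda>k. p k * (real k - c)) sums 0"
    by (rule sums_transfer[OF sums_diff[OF P1 sums_mult[OF P0, of c]]]) (simp_all add: algebra_simps)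
  have T: "(\<lambda>k. real k * ((real k - 1) * (real k - 2)) * p k + 2 * (real k * (real k - 1) * p k) + (c - 1) ^ 3 * p k)
      sums (l * (l * c) + 2 * (l * c) + (c - 1) ^ 3 * 1)"
    by (intro sums_add P3 sums_mult P2 P0)
  have cis_sums: "(\<lambda>k. of_real (p k) * cis ((real k - c) * t)) sums
      ((exp (of_real l * cis t) - 1) / of_real (exp l - 1) * cis (- (c * t)))"
  proof -
    have "(\<lambda>k. (of_real l * cis t) ^ k /\<^sub>R fact k) sums exp (of_real l * cis t)"
      by (rule exp_converges)
    then have "(\<lambda>k. (of_real l * cis t) ^ Suc k /\<^sub>R fact (Suc k)) sums (exp (of_real l * cis t) - 1)"
      by (subst sums_Suc_iff) simp
    then have "(\<lambda>k. of_real (p (Suc k)) * cis ((real (Suc k) - c) * t)) sums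
      ((exp (of_real l * cis t) - 1) / of_real (exp l - 1) * cis (- (c * t)))"
    proof (rule sums_transfer[OF sums_mult[of _ _ "cis (- (c * t)) / of_real (exp l - 1)"]])
      fix k
      have "cis ((real (Suc k) - c) * t) = cis (- (c * t)) * cis t ^ Suc k"
        unfolding Complex.DeMoivre cis_mult by (simp add: algebra_simps)
      moreover have "of_real (p (Suc k)) = of_real l ^ Suc k / fact (Suc k) / complex_of_real (exp l - 1)"
        unfolding p_def by (simp del: power_Suc fact_Suc)
      ultimately show "of_real (p (Suc k)) * cis ((real (Suc k) - c) * t) =
        cis (- (c * t)) / complex_of_real (exp l - 1) * ((of_real l * cis t) ^ Suc k /\<^sub>R fact (Suc k))"
        by (simp only: power_mult_distrib scaleR_conv_of_real) (simp add: divide_inverse del: power_Suc fact_Suc)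
    qed simp
    then show ?thesis by (subst (asm) sums_Suc_iff) (simp add: p_def)
  qed
  have lin: "(\<lambda>k. of_real (p k * 1) + of_real (p k * (real k - c)) * (\<i> * of_real t) - of_real (p k * (real k - c)\<^sup>2) * of_real (t\<^sup>2 / 2))
      sums (of_real 1 + of_real 0 * (\<i> * of_real t) - of_real (c * (1 + l - c)) * of_real (t\<^sup>2 / 2))"
    using P0 by (intro sums_diff sums_add sums_mult2 sums_of_real V M) simp
  have cb3: "l * (l * c) + 2 * (l * c) + (c - 1) ^ 3 * 1 \<le> 2 * l * (1 + l)\<^sup>2"
  proof -
    have "(l * l + 2 * l) * c \<le> (l * l + 2 * l) * (1 + l)" using cb l by (intro mult_left_mono) auto
    moreover have "(c - 1) ^ 3 \<le> l ^ 3" using cb by (intro power_mono) auto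
    moreover have "(l * l + 2 * l) * (1 + l) + l ^ 3 \<le> 2 * l * (1 + l)\<^sup>2"
      using l by (simp add: algebra_simps power2_eq_square power3_eq_cube)
    moreover have "l * (l * c) + 2 * (l * c) = (l * l + 2 * l) * c" by (simp add: algebra_simps)
    ultimately show ?thesis by linarith
  qed
  have "norm ((exp (of_real l * cis t) - 1) / of_real (exp l - 1) * cis (- (c * t)) -
      (of_real 1 + of_real 0 * (\<i> * of_real t) - of_real (c * (1 + l - c)) * of_real (t\<^sup>2 / 2))) \<le>
      (l * (l * c) + 2 * (l * c) + (c - 1) ^ 3 * 1) * (\<bar>t\<bar> ^ 3 / 6)"
  proof (rule norm_sums_le[OF sums_diff[OF cis_sums lin] sums_mult2[OF T]])
    fix k
    define x where "x = (real k - c) * t"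
    have A: "norm (cis x - (1 + \<i> * x - of_real (x\<^sup>2 / 2))) \<le> \<bar>x\<bar> ^ 3 / 6"
    proof -
      have "(\<Sum>k\<le>2. (\<i> * of_real x) ^ k / fact k) = 1 + \<i> * x - complex_of_real (x\<^sup>2 / 2)"
        by (simp add: numeral_2_eq_2 power_mult_distrib del: power_Suc)
      then show ?thesis using iexp_approx1[of x 2] by (simp add: cis_conv_exp fact_numeral)
    qed
    have B: "of_real (p k) * cis ((real k - c) * t) - (of_real (p k * 1) + of_real (p k * (real k - c)) * (\<i> * of_real t) - of_real (p k * (real k - c)\<^sup>2) * of_real (t\<^sup>2 / 2))
       = of_real (p k) * (cis x - (1 + \<i> * x - of_real (x\<^sup>2 / 2)))"
    proof -
      have "x\<^sup>2 = (real k - c)\<^sup>2 * t\<^sup>2" by (simp add: x_def power_mult_distrib)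
      then have "complex_of_real (x\<^sup>2 / 2) = of_real ((real k - c)\<^sup>2) * of_real (t\<^sup>2 / 2)" by simp
      then show ?thesis
        by (simp only: of_real_mult) (simp add: x_def right_diff_distrib distrib_left mult_ac)
    qed
    have *: "norm (of_real (p k) * cis ((real k - c) * t) - (of_real (p k * 1) + of_real (p k * (real k - c)) * (\<i> * of_real t) - of_real (p k * (real k - c)\<^sup>2) * of_real (t\<^sup>2 / 2)))
       \<le> p k * (\<bar>x\<bar> ^ 3 / 6)"
      unfolding B norm_mult norm_of_real using mult_left_mono[OF A p0[of k]] p0[of k] by (simp only: abs_of_nonneg)
    also have "\<dots> = (p k * \<bar>real k - c\<bar> ^ 3) * (\<bar>t\<bar> ^ 3 / 6)"
      by (simp add: x_def abs_mult power_mult_distrib)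
    \<comment> \<open>As k >= 1 and c >= 1, |k - c| <= max (k - 1) (c - 1), and (k-1)^3 is dominated
      by factorial moments k(k-1)(k-2) and k(k-1), whose expectations contain a factor
      \<open>l\<close>. Bounding by k^3 instead would lose this factor.\<close>
    also have "p k * \<bar>real k - c\<bar> ^ 3 \<le> real k * ((real k - 1) * (real k - 2)) * p k + 2 * (real k * (real k - 1) * p k) + (c - 1) ^ 3 * p k"
    proof (cases "k = 0")
      case True then show ?thesis by (simp add: p_def)
    next
      case False
      then have k: "real k \<ge> 1" by simp
      have "\<bar>real k - c\<bar> ^ 3 \<le> (max (real k - 1) (c - 1)) ^ 3"
        using k cb by (intro power_mono) auto
      also have "\<dots> \<le> (real k - 1) ^ 3 + (c - 1) ^ 3" using k cb by (simp add: max_def)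
      also have "(real k - 1) ^ 3 \<le> real k * ((real k - 1) * (real k - 2)) + 2 * (real k * (real k - 1))"
      proof -
        have "(real k - 1) * ((real k - 1) * (real k - 1)) \<le> (real k - 1) * (real k * real k)"
          using k by (intro mult_left_mono mult_mono) auto
        then show ?thesis by (simp add: power3_eq_cube algebra_simps)
      qed
      finally have "p k * \<bar>real k - c\<bar> ^ 3 \<le> p k * (real k * ((real k - 1) * (real k - 2)) + 2 * (real k * (real k - 1)) + (c - 1) ^ 3)"
        using p0 by (intro mult_left_mono) auto
      then show ?thesis by (simp add: algebra_simps)
    qed
    finally show "norm (of_real (p k) * cis ((real k - c) * t) - (of_real (p k * 1) + of_real (p k * (real k - c)) * (\<i> * of_real t) - of_real (p k * (real k - c)\<^sup>2) * of_real (t\<^sup>2 / 2)))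
      \<le> (real k * ((real k - 1) * (real k - 2)) * p k + 2 * (real k * (real k - 1) * p k) + (c - 1) ^ 3 * p k) * (\<bar>t\<bar> ^ 3 / 6)"
      by (simp add: mult_right_mono)
  qed
  also have "\<dots> \<le> (2 * l * (1 + l)\<^sup>2) * (\<bar>t\<bar> ^ 3 / 6)"
    using cb3 by (intro mult_right_mono) auto
  also have "\<dots> \<le> l * (1 + l)\<^sup>2 * \<bar>t\<bar> ^ 3"
    using l by (simp add: field_simps)
  finally show ?thesis by simp
qed

text \<open>Since \<open>C k\<close> is exactly the mean, the linear term of the expansion vanishes.
  The error in the N-th power is at most N L (1+L)^2 |t/s|^3 with s^2 >= N L / 2, hence of order
  (1+L)^2 / sqrt (N L) for fixed t; \<open>lim\<close> says that its square tends to 0, and also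
  forces N and N L to infinity.\<close>

theorem surj_count_asymp:
  fixes N M :: "nat \<Rightarrow> nat" and L C :: "nat \<Rightarrow> real"
  assumes L: "\<And>k. 0 < L k" and C: "\<And>k. C k = L k * exp (L k) / (exp (L k) - 1)"
    and N: "\<And>k. 0 < N k" and M: "\<And>k. real (M k) = real (N k) * C k"
    and lim: "(\<lambda>k. (1 + L k) ^ 4 / (real (N k) * L k)) \<longlonglongrightarrow> 0"
  shows "(\<lambda>k. surj_count (N k) (M k) * L k ^ M k / (fact (M k) * (exp (L k) - 1) ^ N k) *
    sqrt (2 * pi * real (N k) * (C k * (1 + L k - C k)))) \<longlonglongrightarrow> 1"
proof -
  define v where "v = (\<lambda>k. C k * (1 + L k - C k))"
  define s where "s = (\<lambda>k. sqrt (real (N k) * v k))"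
  define \<psi> where "\<psi> = (\<lambda>k t. (exp (of_real (L k) * cis t) - 1) / of_real (exp (L k) - 1) * cis (- (C k * t)))"
  \<comment> \<open>The integrand scaled by the standard deviation and extended by 0, so that
    dominated convergence takes place on the whole line.\<close>
  define g where "g = (\<lambda>k t. indicator {- (pi * s k)..pi * s k} t *\<^sub>R \<psi> k (t / s k) ^ N k)"
  define q where "q = (\<lambda>k. surj_count (N k) (M k) * L k ^ M k / (fact (M k) * (exp (L k) - 1) ^ N k))"
  have e: "0 < exp (L k) - 1" for k using L[of k] by simp
  have v: "L k / 2 \<le> v k" "v k \<le> 2 * L k" for k
    unfolding v_def by (rule variance_bounds[OF L C])+
  have v0: "0 < v k" for k using v(1)[of k] L[of k] by simp
  have s0: "0 < s k" and s2: "(s k)\<^sup>2 = real (N k) * v k" for k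
    using N v0[of k] by (simp_all add: s_def)
  have \<psi>_le: "norm (\<psi> k t) \<le> exp (- (L k * (1 - cos t) / 2))" for k t
  proof -
    have "norm (\<psi> k t) = norm (exp (of_real (L k) * cis t) - 1) / (exp (L k) - 1)"
      unfolding \<psi>_def norm_mult norm_divide norm_of_real using e[of k] by simp
    then show ?thesis
      using norm_exp_minus_one_le[of "L k" t] L[of k] e[of k] by (simp add: divide_le_eq mult.commute)
  qed
  have int_\<psi>: "integral\<^sup>L circ (\<lambda>t. \<psi> k t ^ N k) = of_real (2 * pi * q k)" for k
  proof -
    have "\<psi> k t ^ N k = (exp (of_real (L k) * cis t) - 1) ^ N k * cis (- (real (M k) * t)) / of_real ((exp (L k) - 1) ^ N k)" for t
      by (simp add: \<psi>_def power_mult_distrib power_divide Complex.DeMoivre M mult_ac)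
    then have "integral\<^sup>L circ (\<lambda>t. \<psi> k t ^ N k) =
       of_real (2 * pi * (surj_count (N k) (M k) / fact (M k) * L k ^ M k)) / of_real ((exp (L k) - 1) ^ N k)"
      using surj_count_integral[of "L k" "N k" "M k"] L[of k] by simp
    then show ?thesis by (simp add: q_def)
  qed
  have int_g: "integral\<^sup>L lborel (g k) = of_real (s k * (2 * pi * q k))" for k
  proof -
    have "integral\<^sup>L circ (\<lambda>t. \<psi> k t ^ N k) = (\<integral>t. indicator {- pi..pi} t *\<^sub>R \<psi> k t ^ N k \<partial>lborel)"
      unfolding circ_def by (rule integral_restrict_space) auto
    also have "\<dots> = \<bar>1 / s k\<bar> *\<^sub>R (\<integral>t. indicator {- pi..pi} (0 + 1 / s k * t) *\<^sub>R \<psi> k (0 + 1 / s k * t) ^ N k \<partial>lborel)"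
      by (rule lborel_integral_real_affine) (use s0[of k] in simp)
    also have "(\<lambda>t. indicator {- pi..pi} (0 + 1 / s k * t) *\<^sub>R \<psi> k (0 + 1 / s k * t) ^ N k) = g k"
      using s0[of k] by (auto simp: g_def indicator_def field_simps fun_eq_iff)
    finally have "of_real (2 * pi * q k) = (1 / s k) *\<^sub>R integral\<^sup>L lborel (g k)"
      using s0[of k] unfolding int_\<psi> by simp
    then show ?thesis using s0[of k] by (simp add: scaleR_conv_of_real field_simps)
  qed
  have NL: "LIM k sequentially. real (N k) * L k :> at_top"
  proof -
    have "(\<lambda>k. inverse (real (N k) * L k)) \<longlonglongrightarrow> 0"
    proof (rule tendsto_sandwich[OF _ _ tendsto_const lim])
      show "\<forall>\<^sub>F k in sequentially. 0 \<le> inverse (real (N k) * L k)"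
        using L N by (intro always_eventually allI) (simp add: less_imp_le)
      show "\<forall>\<^sub>F k in sequentially. inverse (real (N k) * L k) \<le> (1 + L k) ^ 4 / (real (N k) * L k)"
      proof (intro always_eventually allI)
        fix k
        have "1 \<le> (1 + L k) ^ 4" using L[of k] by (intro one_le_power) simp
        then show "inverse (real (N k) * L k) \<le> (1 + L k) ^ 4 / (real (N k) * L k)"
          using L[of k] N[of k] by (simp add: divide_simps)
      qed
    qed
    from filterlim_inverse_at_top[OF this] show ?thesis using L N by simp
  qed
  have NN: "LIM k sequentially. N k :> sequentially"
  proof -
    have "(\<lambda>k. inverse (real (N k))) \<longlonglongrightarrow> 0"
    proof (rule tendsto_sandwich[OF _ _ tendsto_const lim])
      show "\<forall>\<^sub>F k in sequentially. inverse (real (N k)) \<le> (1 + L k) ^ 4 / (real (N k) * L k)"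
      proof (intro always_eventually allI)
        fix k
        have "(1 + L k) ^ 1 \<le> (1 + L k) ^ 4" using L[of k] by (intro power_increasing) auto
        then have "L k \<le> (1 + L k) ^ 4" by simp
        then show "inverse (real (N k)) \<le> (1 + L k) ^ 4 / (real (N k) * L k)"
          using L[of k] N[of k] by (simp add: divide_simps)
      qed
    qed (use N in auto)
    from filterlim_inverse_at_top[OF this] have "LIM k sequentially. real (N k) :> at_top" using N by simp
    then show ?thesis
      by (simp add: filterlim_sequentially_iff_filterlim_real)
  qed
  have s_top: "LIM k sequentially. s k :> at_top"
  proof -
    have "LIM k sequentially. sqrt (real (N k) * L k * (1 / 2)) :> at_top"
      by (intro filterlim_compose[OF sqrt_at_top] filterlim_at_top_mult_tendsto_pos[OF tendsto_const _ NL]) simp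
    then show ?thesis
    proof (rule filterlim_at_top_mono, intro always_eventually allI)
      fix k
      have "real (N k) * (L k / 2) \<le> real (N k) * v k" by (intro mult_left_mono v) simp
      then show "sqrt (real (N k) * L k * (1 / 2)) \<le> s k" by (simp add: s_def)
    qed
  qed
  have ptw: "(\<lambda>k. g k t) \<longlonglongrightarrow> of_real (exp (- t\<^sup>2 / 2))" for t
  proof -
    define D where "D = (\<lambda>k. (1 + (- t\<^sup>2 / 2) / real (N k)) ^ N k)"
    have D: "D \<longlonglongrightarrow> exp (- t\<^sup>2 / 2)"
      unfolding D_def by (rule filterlim_compose[OF tendsto_exp_limit_sequentially NN])
    have "(\<lambda>k. \<psi> k (t / s k) ^ N k - of_real (D k)) \<longlonglongrightarrow> 0"
    proof (rule Lim_null_comparison)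
      have "(\<lambda>k. 2 * sqrt 2 * \<bar>t\<bar> ^ 3 * sqrt ((1 + L k) ^ 4 / (real (N k) * L k))) \<longlonglongrightarrow> 2 * sqrt 2 * \<bar>t\<bar> ^ 3 * sqrt 0"
        by (intro tendsto_intros lim)
      then show "(\<lambda>k. 2 * sqrt 2 * \<bar>t\<bar> ^ 3 * sqrt ((1 + L k) ^ 4 / (real (N k) * L k))) \<longlonglongrightarrow> 0" by simp
      have "\<forall>\<^sub>F k in sequentially. t\<^sup>2 \<le> real (N k)"
        using NN[unfolded filterlim_sequentially_iff_filterlim_real] by (simp add: filterlim_at_top)
      then show "\<forall>\<^sub>F k in sequentially. norm (\<psi> k (t / s k) ^ N k - of_real (D k)) \<le>
          2 * sqrt 2 * \<bar>t\<bar> ^ 3 * sqrt ((1 + L k) ^ 4 / (real (N k) * L k))"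
      proof eventually_elim
        case (elim k)
        let ?\<theta> = "t / s k"
        have x: "v k * ?\<theta>\<^sup>2 = t\<^sup>2 / real (N k)"
          using v0[of k] N[of k] by (simp add: power_divide s2)
        have w: "1 - v k * ?\<theta>\<^sup>2 / 2 = 1 + (- t\<^sup>2 / 2) / real (N k)" unfolding x by simp
        have "0 \<le> t\<^sup>2 / real (N k)" "t\<^sup>2 / real (N k) \<le> 1" using elim N[of k] by simp_all
        then have w1: "\<bar>1 - v k * ?\<theta>\<^sup>2 / 2\<bar> \<le> 1" unfolding x by simp
        have p1: "norm (\<psi> k ?\<theta>) \<le> 1"
          by (rule order_trans[OF \<psi>_le]) (use L[of k] in simp)
        have "norm (\<psi> k ?\<theta> ^ N k - of_real (D k)) = norm (\<psi> k ?\<theta> ^ N k - of_real (1 - v k * ?\<theta>\<^sup>2 / 2) ^ N k)"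
          unfolding w D_def by simp
        \<comment> \<open>Both bases have modulus at most 1, so the N-th powers differ by at most N
          times the difference of the bases; this avoids complex logarithms.\<close>
        also have "\<dots> \<le> real (N k) * norm (\<psi> k ?\<theta> - of_real (1 - v k * ?\<theta>\<^sup>2 / 2))"
          by (rule norm_power_diff[OF p1]) (use w1 in \<open>simp only: norm_of_real\<close>)
        also have "\<dots> \<le> real (N k) * (L k * (1 + L k)\<^sup>2 * \<bar>?\<theta>\<bar> ^ 3)"
          unfolding \<psi>_def v_def by (intro mult_left_mono char_fun_cubic L C) simp
        also have "\<dots> = (1 + L k)\<^sup>2 * \<bar>t\<bar> ^ 3 * (real (N k) * L k / (s k) ^ 3)"
          using s0[of k] by (simp add: power_divide)
        also have "\<dots> \<le> (1 + L k)\<^sup>2 * \<bar>t\<bar> ^ 3 * (2 * sqrt 2 / sqrt (real (N k) * L k))"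
        proof (intro mult_left_mono)
          define y where "y = real (N k) * L k"
          have y: "0 < y" using L N by (simp add: y_def)
          have "y / 2 \<le> (s k)\<^sup>2" unfolding s2 y_def using v(1)[of k] N[of k] by simp
          then have "sqrt (y / 2) \<le> s k" using s0[of k] by (simp add: real_le_rsqrt real_sqrt_le_iff flip: real_sqrt_le_iff[of _ "(s k)\<^sup>2"])
          then have "(y / 2) * sqrt (y / 2) \<le> (s k)\<^sup>2 * s k"
            using \<open>y / 2 \<le> (s k)\<^sup>2\<close> y by (intro mult_mono) auto
          then have "(y / 2) * sqrt (y / 2) \<le> s k ^ 3" by (simp add: power3_eq_cube power2_eq_square)
          then have "y / (s k) ^ 3 \<le> y / ((y / 2) * sqrt (y / 2))"
            using y s0[of k] by (intro divide_left_mono) auto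
          also have "\<dots> = 2 * sqrt 2 / sqrt y" using y by (simp add: real_sqrt_divide)
          finally show "real (N k) * L k / (s k) ^ 3 \<le> 2 * sqrt 2 / sqrt (real (N k) * L k)"
            by (simp add: y_def)
        qed auto
        also have "\<dots> = 2 * sqrt 2 * \<bar>t\<bar> ^ 3 * sqrt ((1 + L k) ^ 4 / (real (N k) * L k))"
        proof -
          have "sqrt ((1 + L k) ^ 4) = (1 + L k)\<^sup>2"
            by (rule real_sqrt_unique) (simp_all flip: power_mult)
          then show ?thesis by (simp add: real_sqrt_divide)
        qed
        finally show ?case .
      qed
    qed
    from tendsto_add[OF this tendsto_of_real[OF D]]
    have "(\<lambda>k. \<psi> k (t / s k) ^ N k) \<longlonglongrightarrow> of_real (exp (- t\<^sup>2 / 2))" by simp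
    moreover have "\<forall>\<^sub>F k in sequentially. g k t = \<psi> k (t / s k) ^ N k"
    proof -
      have "\<forall>\<^sub>F k in sequentially. \<bar>t\<bar> / pi \<le> s k" using s_top by (simp add: filterlim_at_top)
      then show ?thesis
        by eventually_elim (auto simp: g_def indicator_def field_simps abs_le_iff)
    qed
    ultimately show ?thesis by (simp add: tendsto_cong)
  qed
  \<comment> \<open>72 = 18 * 2 * 2: the constant of \<open>one_minus_cos_ge\<close>, the halving in
    \<open>norm_exp_minus_one_le\<close>, and v <= 2 L.\<close>
  have dom: "norm (g k t) \<le> exp (- t\<^sup>2 / 72)" for k t
  proof (cases "t \<in> {- (pi * s k)..pi * s k}")
    case True
    define \<theta> where "\<theta> = t / s k"
    have "\<bar>\<theta>\<bar> \<le> pi" using True s0[of k] by (auto simp: \<theta>_def abs_le_iff field_simps)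
    then have c: "\<theta>\<^sup>2 / 18 \<le> 1 - cos \<theta>" by (rule one_minus_cos_ge)
    have "t\<^sup>2 = \<theta>\<^sup>2 * (s k)\<^sup>2" using s0[of k] by (simp add: \<theta>_def power_divide)
    also have "\<dots> \<le> \<theta>\<^sup>2 * (real (N k) * (2 * L k))"
      unfolding s2 using v(2)[of k] by (intro mult_left_mono) auto
    finally have "t\<^sup>2 / 72 \<le> real (N k) * L k * (\<theta>\<^sup>2 / 18) / 2" by (simp add: mult_ac)
    also have "\<dots> \<le> real (N k) * L k * (1 - cos \<theta>) / 2"
      using c L[of k] by (intro divide_right_mono mult_left_mono) auto
    finally have *: "t\<^sup>2 / 72 \<le> real (N k) * (L k * (1 - cos \<theta>) / 2)" by simp
    have "norm (g k t) = norm (\<psi> k \<theta>) ^ N k" using True by (simp add: g_def \<theta>_def norm_power)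
    also have "\<dots> \<le> exp (- (L k * (1 - cos \<theta>) / 2)) ^ N k"
      by (intro power_mono \<psi>_le) simp
    also have "\<dots> = exp (- (real (N k) * (L k * (1 - cos \<theta>) / 2)))"
      by (simp flip: exp_of_nat_mult)
    also have "\<dots> \<le> exp (- t\<^sup>2 / 72)" using * by simp
    finally show ?thesis .
  qed (simp add: g_def)
  have gauss: "integrable lborel (\<lambda>t::real. exp (- t\<^sup>2 / (2 * \<sigma>\<^sup>2)))"
      "integral\<^sup>L lborel (\<lambda>t::real. exp (- t\<^sup>2 / (2 * \<sigma>\<^sup>2))) = sqrt (2 * pi * \<sigma>\<^sup>2)" if "0 < \<sigma>" for \<sigma> :: real
  proof -
    have eq: "exp (- t\<^sup>2 / (2 * \<sigma>\<^sup>2)) = sqrt (2 * pi * \<sigma>\<^sup>2) * normal_density 0 \<sigma> t" for t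
      using that by (simp add: normal_density_def)
    show "integrable lborel (\<lambda>t::real. exp (- t\<^sup>2 / (2 * \<sigma>\<^sup>2)))"
      "integral\<^sup>L lborel (\<lambda>t::real. exp (- t\<^sup>2 / (2 * \<sigma>\<^sup>2))) = sqrt (2 * pi * \<sigma>\<^sup>2)"
      unfolding eq using that by simp_all
  qed
  have "(\<lambda>k. integral\<^sup>L lborel (g k)) \<longlonglongrightarrow> integral\<^sup>L lborel (\<lambda>t. complex_of_real (exp (- t\<^sup>2 / 2)))"
  proof (rule integral_dominated_convergence[where w = "\<lambda>t. exp (- t\<^sup>2 / 72)"])
    show "integrable lborel (\<lambda>t::real. exp (- t\<^sup>2 / 72))" using gauss(1)[of 6] by simp
    show "g k \<in> borel_measurable lborel" for k
    proof -
      have "continuous_on UNIV (\<lambda>t. \<psi> k (t / s k) ^ N k)"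
        unfolding \<psi>_def using e[of k] s0[of k] by (intro continuous_intros) auto
      then have [measurable]: "(\<lambda>t. \<psi> k (t / s k) ^ N k) \<in> borel_measurable borel"
        by (rule borel_measurable_continuous_onI)
      show ?thesis unfolding g_def by measurable
    qed
  qed (use ptw dom in auto)
  also have "integral\<^sup>L lborel (\<lambda>t. complex_of_real (exp (- t\<^sup>2 / 2))) = of_real (sqrt (2 * pi))"
    using gauss(2)[of 1] by (subst integral_complex_of_real) simp
  finally have "(\<lambda>k. s k * (2 * pi * q k)) \<longlonglongrightarrow> sqrt (2 * pi)"
    unfolding int_g by (simp only: tendsto_of_real_iff)
  then have "(\<lambda>k. s k * (2 * pi * q k) / sqrt (2 * pi)) \<longlonglongrightarrow> sqrt (2 * pi) / sqrt (2 * pi)"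
    by (intro tendsto_divide tendsto_const) auto
  moreover have "s k * (2 * pi * q k) / sqrt (2 * pi) = q k * sqrt (2 * pi * real (N k) * (C k * (1 + L k - C k)))" for k
  proof -
    have "2 * pi / sqrt (2 * pi) = sqrt (2 * pi)" by (rule real_div_sqrt) simp
    moreover have "sqrt (2 * pi * real (N k) * (C k * (1 + L k - C k))) = sqrt (2 * pi) * s k"
      by (simp add: s_def v_def real_sqrt_mult)
    moreover have "s k * (2 * pi * q k) / sqrt (2 * pi) = q k * (2 * pi / sqrt (2 * pi) * s k)"
      by simp
    ultimately show ?thesis by simp
  qed
  ultimately show ?thesis by (simp add: q_def)
qed

section \<open>Stirling numbers and the probability of a repeated arc\<close>

lemma Stirling_pos: "1 \<le> n \<Longrightarrow> n \<le> m \<Longrightarrow> 0 < Stirling m n"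
proof (induction m arbitrary: n)
  case (Suc m)
  then obtain k where n: "n = Suc k" by (cases n) auto
  show ?case
  proof (cases "Suc k \<le> m")
    case True
    then show ?thesis using Suc.IH[of n] by (simp add: n)
  next
    case False
    then show ?thesis using Suc.prems n by (simp add: le_Suc_eq)
  qed
qed simp

text \<open>Induction on \<open>n\<close>. Substituting the recurrence S(m+1,n+1) = (n+1) S(m,n+1) +
  S(m,n) into both sides cancels the common part and leaves \<open>Q\<close>: the quotient S(m,n+1)
  / S(m,n) of neighbouring columns does not decrease in \<open>m\<close>. This follows by an inner
  induction on \<open>m\<close> from log-concavity of column \<open>n\<close>.\<close>

lemma Stirling_log_concave: "Stirling m n * Stirling (Suc (Suc m)) n \<le> (Stirling (Suc m) n)\<^sup>2"
proof (induction n arbitrary: m)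
  case 0
  then show ?case by simp
next
  case (Suc n)
  note concave = Suc.IH
  let ?a = "\<lambda>m. Stirling m n" and ?b = "\<lambda>m. Stirling m (Suc n)"
  have Q: "?b m * ?a (Suc m) \<le> ?b (Suc m) * ?a m" for m
  proof (induction m)
    case 0
    then show ?case by simp
  next
    case (Suc m)
    have "?b m * ?a (Suc (Suc m)) \<le> ?b (Suc m) * ?a (Suc m)"
    \<comment> \<open>The inequality is obtained after multiplication by \<open>?a m\<close>, so a
      vanishing factor is treated apart; then one of the two factors on the left vanishes.\<close>
    proof (cases "?a m = 0")
      case True
      then have "m < n \<or> n = 0 \<and> 0 < m"
        using Stirling_pos[of n m] by (cases n; cases m) force+
      then show ?thesis by auto
    next
      case False
      have "?a m * (?b m * ?a (Suc (Suc m))) = ?b m * (?a m * ?a (Suc (Suc m)))" by (simp only: mult_ac)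
      also have "\<dots> \<le> ?b m * (?a (Suc m))\<^sup>2" by (intro mult_le_mono2 concave)
      also have "\<dots> = (?b m * ?a (Suc m)) * ?a (Suc m)" by (simp only: power2_eq_square mult_ac)
      also have "\<dots> \<le> (?b (Suc m) * ?a m) * ?a (Suc m)" by (intro mult_le_mono1 Suc.IH)
      also have "\<dots> = ?a m * (?b (Suc m) * ?a (Suc m))" by (simp only: mult_ac)
      finally show ?thesis using False nat_mult_le_cancel1[of "?a m"] by blast
    qed
    then have "Suc n * (?b m * ?a (Suc (Suc m))) + ?a m * ?a (Suc (Suc m)) \<le>
      Suc n * (?b (Suc m) * ?a (Suc m)) + (?a (Suc m))\<^sup>2"
      by (intro add_le_mono mult_le_mono2 concave)
    then show ?case
      unfolding Stirling.simps(4)[of "Suc m"] Stirling.simps(4)[of m n] distrib_right power2_eq_square mult.assoc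
      by (simp only:)
  qed
  have "?b m * ?b (Suc (Suc m)) = Suc n * (?b m * ?b (Suc m)) + ?b m * ?a (Suc m)"
    unfolding Stirling.simps(4)[of "Suc m"] distrib_left by (simp only: mult_ac)
  also have "\<dots> \<le> Suc n * (?b m * ?b (Suc m)) + ?b (Suc m) * ?a m"
    using Q by (rule add_left_mono)
  also have "\<dots> = ?b (Suc m) * ?b (Suc m)"
  proof -
    have "Suc n * (x * y) + y * z = y * y" if "y = Suc n * x + z" for x y z :: nat
      unfolding that by (simp add: algebra_simps)
    from this[OF Stirling.simps(4)] show ?thesis .
  qed
  finally show ?case by (simp only: power2_eq_square)
qed

text \<open>Chains log-concavity. The cross-multiplied form remains meaningful where the numbers
  vanish, below \<open>n\<close>.\<close>

lemma Stirling_ratio_mono: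
  assumes "1 \<le> n" "a \<le> b"
  shows "Stirling a n * Stirling (Suc b) n \<le> Stirling (Suc a) n * Stirling b n"
  using assms(2)
proof (induction b rule: dec_induct)
  case base
  then show ?case by (simp only: mult_ac)
next
  case (step b)
  show ?case
  proof (cases "n \<le> b")
    case False
    then show ?thesis using step by simp
  next
    case True
    have "Stirling b n * (Stirling a n * Stirling (Suc (Suc b)) n) = Stirling a n * (Stirling b n * Stirling (Suc (Suc b)) n)"
      by (simp only: mult_ac)
    also have "\<dots> \<le> Stirling a n * (Stirling (Suc b) n)\<^sup>2"
      by (rule mult_le_mono2, rule Stirling_log_concave)
    also have "\<dots> = (Stirling a n * Stirling (Suc b) n) * Stirling (Suc b) n"
      by (simp only: power2_eq_square mult_ac)
    also have "\<dots> \<le> (Stirling (Suc a) n * Stirling b n) * Stirling (Suc b) n"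
      by (intro mult_le_mono1 step.IH)
    also have "\<dots> = Stirling b n * (Stirling (Suc a) n * Stirling (Suc b) n)"
      by (simp only: mult_ac)
    finally show ?thesis using Stirling_pos[OF assms(1) True] nat_mult_le_cancel1 by blast
  qed
qed

text \<open>The recurrence says that the series s for n + 1 satisfies s - (n+1) z s = (series for
  n), which can be solved for s.\<close>

lemma Stirling_ogf:
  fixes z :: "'a::{real_normed_field, banach}"
  assumes "real n * norm z < 1"
  shows "(\<lambda>k. of_nat (Stirling (n + k) n) * z ^ k) sums (\<Prod>i=1..n. inverse (1 - of_nat i * z))"
  using assms
proof (induction n)
  case 0
  have "(\<lambda>k. of_nat (Stirling (0 + k) 0) * z ^ k) = (\<lambda>k. if k = 0 then 1 else 0)"
  proof
    fix k show "of_nat (Stirling (0 + k) 0) * z ^ k = (if k = 0 then 1 else 0)" by (cases k) auto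
  qed
  then show ?case using sums_single[of 0 "\<lambda>_. 1::'a"] by simp
next
  case (Suc n)
  let ?A = "\<lambda>k. of_nat (Stirling (Suc n + k) (Suc n)) * z ^ k"
  let ?B = "\<lambda>k. of_nat (Stirling (n + k) n) * z ^ k"
  \<comment> \<open>Convergence has to be known before the series is multiplied by z; it follows
    from n! S(m,n) <= n^m by comparison with a geometric series.\<close>
  have "summable ?A"
  proof (rule summable_comparison_test'[of "\<lambda>k. real (Suc n) ^ Suc n * (real (Suc n) * norm z) ^ k" 0])
    show "summable (\<lambda>k. real (Suc n) ^ Suc n * (real (Suc n) * norm z) ^ k)"
      using Suc.prems by (intro summable_mult summable_geometric) (simp del: of_nat_Suc)
    fix k
    have "Stirling (Suc n + k) (Suc n) \<le> fact (Suc n) * Stirling (Suc n + k) (Suc n)"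
      by (metis fact_ge_1 mult_le_mono1 nat_mult_1)
    also have "\<dots> \<le> Suc n ^ (Suc n + k)" by (rule fact_Stirling_le)
    finally have "real (Stirling (Suc n + k) (Suc n)) \<le> real (Suc n ^ (Suc n + k))" by (rule of_nat_mono)
    then have "real (Stirling (Suc n + k) (Suc n)) * norm z ^ k \<le> real (Suc n ^ (Suc n + k)) * norm z ^ k"
      by (intro mult_right_mono) auto
    then show "norm (?A k) \<le> real (Suc n) ^ Suc n * (real (Suc n) * norm z) ^ k"
      by (simp only: norm_mult norm_of_nat norm_power power_mult_distrib of_nat_power of_nat_mult power_add mult.assoc)
  qed
  then obtain s where s: "?A sums s" by (auto simp: summable_def)
  have "(\<lambda>k. if k = 0 then 0 else of_nat (Suc n) * z * ?A (k - 1)) sums (of_nat (Suc n) * z * s)"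
    using sums_mult[OF s, of "of_nat (Suc n) * z"]
    by (subst sums_Suc_iff[of "\<lambda>k. if k = 0 then 0 else of_nat (Suc n) * z * ?A (k - 1)", simplified, symmetric]) simp
  from sums_diff[OF s this]
  have "?B sums (s - of_nat (Suc n) * z * s)"
  proof (rule sums_transfer)
    fix k
    show "?B k = ?A k - (if k = 0 then 0 else of_nat (Suc n) * z * ?A (k - 1))"
      by (cases k) (simp_all add: algebra_simps)
  qed simp
  moreover have "?B sums (\<Prod>i=1..n. inverse (1 - of_nat i * z))"
  proof (rule Suc.IH)
    have "real n * norm z \<le> real (Suc n) * norm z" by (intro mult_right_mono) auto
    then show "real n * norm z < 1" using Suc.prems by linarith
  qed
  ultimately have "s * (1 - of_nat (Suc n) * z) = (\<Prod>i=1..n. inverse (1 - of_nat i * z))"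
    by (auto dest: sums_unique2 simp: algebra_simps)
  moreover have "1 - of_nat (Suc n) * z \<noteq> 0"
  proof
    assume "1 - of_nat (Suc n) * z = 0"
    then have "norm (of_nat (Suc n) * z) = 1" by simp
    then show False using Suc.prems by (simp add: norm_mult del: of_nat_Suc)
  qed
  ultimately have "s = (\<Prod>i=1..Suc n. inverse (1 - of_nat i * z))"
    by (simp add: field_simps del: of_nat_Suc)
  then show ?case using s by simp
qed

text \<open>The error is proportional to the value at angle 0, which may be smaller than any power
  of 1/n. Each factor is (1 - i rho)(1 + x_i) with |x_i| <= 2 i rho |alpha|, because 1 - i rho >=
  1/2; then |prod (1 + x_i) - 1| <= exp (sum |x_i|) - 1.\<close>

lemma norm_prod_ratio_le:
  fixes \<rho> \<alpha> :: real
  assumes "0 \<le> \<rho>" "real m * \<rho> \<le> 1 / 2"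
  shows "norm ((\<Prod>i<m. 1 - of_nat i * (of_real \<rho> * cis \<alpha>)) - of_real (\<Prod>i<m. 1 - real i * \<rho>)) \<le>
    (exp (real m ^ 2 * \<rho> * \<bar>\<alpha>\<bar>) - 1) * (\<Prod>i<m. 1 - real i * \<rho>)"
proof -
  have i: "real i * \<rho> \<le> 1 / 2" if "i < m" for i
    using mult_right_mono[of "real i" "real m" \<rho>] assms that by simp
  have pos: "0 < 1 - real i * \<rho>" if "i < m" for i using i[OF that] by simp
  have pn: "0 \<le> (\<Prod>i<m. 1 - real i * \<rho>)"
    using pos by (intro prod_nonneg) (simp add: less_imp_le)
  define x where "x = (\<lambda>i. of_real (real i * \<rho>) * (1 - cis \<alpha>) / of_real (1 - real i * \<rho>))"
  have cis1: "norm (1 - cis \<alpha>) \<le> \<bar>\<alpha>\<bar>"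
  proof -
    have "norm (iexp \<alpha> - (\<Sum>k\<le>0. (\<i> * complex_of_real \<alpha>) ^ k / fact k)) \<le> \<bar>\<alpha>\<bar> ^ Suc 0 / fact (Suc 0)"
      by (rule iexp_approx1)
    then show ?thesis by (simp add: cis_conv_exp norm_minus_commute)
  qed
  have x: "norm (x i) \<le> 2 * (real i * \<rho>) * \<bar>\<alpha>\<bar>" if "i < m" for i
  proof -
    have "norm (x i) = real i * \<rho> * norm (1 - cis \<alpha>) / (1 - real i * \<rho>)"
      using pos[OF that] assms(1) unfolding x_def norm_mult norm_divide norm_of_real by simp
    also have "\<dots> \<le> real i * \<rho> * \<bar>\<alpha>\<bar> / (1 / 2)"
      using i[OF that] assms(1) cis1 by (intro frac_le mult_left_mono) auto
    finally show ?thesis by simp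
  qed
  have eq: "(\<Prod>i<m. 1 - of_nat i * (of_real \<rho> * cis \<alpha>)) = (\<Prod>i<m. of_real (1 - real i * \<rho>) * (1 + x i))"
  proof (rule prod.cong[OF refl])
    fix i assume "i \<in> {..<m}"
    then have "of_real (1 - real i * \<rho>) \<noteq> (0::complex)" using pos[of i] by (simp only: of_real_eq_0_iff) simp
    then show "1 - of_nat i * (of_real \<rho> * cis \<alpha>) = of_real (1 - real i * \<rho>) * (1 + x i)"
      by (simp add: x_def field_simps)
  qed
  have "(\<Prod>i<m. 1 - of_nat i * (of_real \<rho> * cis \<alpha>)) - of_real (\<Prod>i<m. 1 - real i * \<rho>) =
    of_real (\<Prod>i<m. 1 - real i * \<rho>) * ((\<Prod>i<m. 1 + x i) - 1)"
    unfolding eq prod.distrib of_real_prod by (simp only: right_diff_distrib mult_1_right)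
  then have *: "norm ((\<Prod>i<m. 1 - of_nat i * (of_real \<rho> * cis \<alpha>)) - of_real (\<Prod>i<m. 1 - real i * \<rho>)) =
    (\<Prod>i<m. 1 - real i * \<rho>) * norm ((\<Prod>i<m. 1 + x i) - 1)"
    using pn by (simp only: norm_mult norm_of_real abs_of_nonneg)
  have "norm ((\<Prod>i<m. 1 + x i) - 1) \<le> (\<Prod>i<m. 1 + norm (x i)) - 1"
    by (rule norm_prod_minus1_le_prod_minus1)
  also have "(\<Prod>i<m. 1 + norm (x i)) \<le> (\<Prod>i<m. exp (2 * (real i * \<rho>) * \<bar>\<alpha>\<bar>))"
  proof (rule prod_mono)
    fix i assume "i \<in> {..<m}"
    then have "norm (x i) \<le> 2 * (real i * \<rho>) * \<bar>\<alpha>\<bar>" using x[of i] by simp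
    then show "0 \<le> 1 + norm (x i) \<and> 1 + norm (x i) \<le> exp (2 * (real i * \<rho>) * \<bar>\<alpha>\<bar>)"
      using exp_ge_add_one_self[of "2 * (real i * \<rho>) * \<bar>\<alpha>\<bar>"] norm_ge_zero[of "x i"] by linarith
  qed
  also have "(\<Prod>i<m. exp (2 * (real i * \<rho>) * \<bar>\<alpha>\<bar>)) = exp (2 * (\<Sum>i<m. real i) * \<rho> * \<bar>\<alpha>\<bar>)"
    by (simp add: exp_sum[symmetric] sum_distrib_left sum_distrib_right mult_ac)
  also have "\<dots> \<le> exp (real m ^ 2 * \<rho> * \<bar>\<alpha>\<bar>)"
  proof -
    have "2 * (\<Sum>i<m. real i) \<le> real m ^ 2"
      by (induction m) (simp_all add: power2_eq_square algebra_simps)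
    then show ?thesis using assms(1) by (simp add: mult_right_mono)
  qed
  finally have "norm ((\<Prod>i<m. 1 + x i) - 1) \<le> exp (real m ^ 2 * \<rho> * \<bar>\<alpha>\<bar>) - 1" by simp
  from mult_left_mono[OF this pn] show ?thesis
    unfolding * by (simp only: mult.commute)
qed


text \<open>
  With \<open>p (d - k)\<close> written as a Fourier coefficient, the sum becomes a double integral of
  \<open>\<Prod>i<m. 1 - i \<rho> e\<^bsup>i(s+t)\<^esup>\<close>. The first error term comes from the range where
  one of the angles exceeds \<open>\<delta>\<close>, the second from the variation of the product on the rest.
\<close>

theorem simple_ratio_estimate:
  fixes p :: "nat \<Rightarrow> real" and \<rho> \<delta> \<eta> :: real
  assumes p: "\<And>k. 0 \<le> p k" "p sums 1" and pd: "\<And>k. p k \<le> p d" "0 < p d"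
    and \<rho>: "0 \<le> \<rho>" "real m * \<rho> \<le> 1 / 2"
    and \<delta>: "0 < \<delta>" "\<delta> \<le> pi"
    and \<eta>: "\<And>t. \<delta> \<le> \<bar>t\<bar> \<Longrightarrow> \<bar>t\<bar> \<le> pi \<Longrightarrow> norm (fseries p t) \<le> \<eta>"
  shows "\<bar>(\<Sum>k\<le>m. (-1) ^ k * real (stirling m (m - k)) * \<rho> ^ k * (if k \<le> d then p (d - k) / p d else 0)\<^sup>2) -
      (\<Prod>i<m. 1 - real i * \<rho>)\<bar> \<le>
    4 * \<eta> * (\<Prod>i<m. 1 + real i * \<rho>) / (p d)\<^sup>2 +
    (exp (2 * \<delta> * real m ^ 2 * \<rho>) - 1) * (\<Prod>i<m. 1 - real i * \<rho>) * \<delta> / (pi * p d)"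
proof -
  define E where "E = (\<Prod>i<m. 1 + real i * \<rho>)"
  define \<Phi>0 where "\<Phi>0 = (\<Prod>i<m. 1 - real i * \<rho>)"
  define \<Phi> where "\<Phi> = (\<lambda>\<alpha>. \<Prod>i<m. 1 - of_nat i * (of_real \<rho> * cis \<alpha>))"
  define \<kappa> where "\<kappa> = exp (2 * \<delta> * real m ^ 2 * \<rho>) - 1"
  define e where "e = (\<lambda>k. (-1) ^ k * real (stirling m (m - k)) * \<rho> ^ k)"
  define F where "F = fseries p"
  \<comment> \<open>Recentred at the mode \<open>d\<close>, so that the coefficient
    \<open>A k\<close> below is 2 pi p(d - k), and 0 for k > d.\<close>
  define G where "G = (\<lambda>t. F t * cis (- (real d * t)))"
  define cut where "cut = (\<lambda>t. indicator {- \<delta>..\<delta>} t :: real)"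
  define A where "A = (\<lambda>k. integral\<^sup>L circ (\<lambda>t. G t * cis (real k * t)))"
  \<comment> \<open>\<open>A k\<close> with the angle restricted to |t| <= delta; the discarded
    range contributes at most 2 pi eta.\<close>
  define B where "B = (\<lambda>k. integral\<^sup>L circ (\<lambda>t. of_real (cut t) * G t * cis (real k * t)))"
  have sp: "summable (\<lambda>k. \<bar>p k\<bar>)" using p by (simp add: sums_iff)
  have sump: "(\<Sum>k. p k) = 1" using p by (simp add: sums_iff)
  have i: "real i * \<rho> \<le> 1 / 2" if "i < m" for i
    using mult_right_mono[of "real i" "real m" \<rho>] \<rho> that by simp
  have \<Phi>0: "0 \<le> \<Phi>0" "\<Phi>0 \<le> 1"
    unfolding \<Phi>0_def using i \<rho>(1) by (auto intro!: prod_nonneg prod_le_1 order_trans[OF i])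
  have E1: "1 \<le> E" unfolding E_def using \<rho>(1) by (intro prod_ge_1) simp
  have \<kappa>0: "0 \<le> \<kappa>" using \<delta> \<rho> by (simp add: \<kappa>_def)
  have F1: "norm (F t) \<le> 1" for t
    using norm_fseries_le[OF sp, of t] sump p(1) by (simp add: F_def)
  have G1: "norm (G t) = norm (F t)" for t by (simp add: G_def norm_mult)
  have contF [continuous_intros]: "continuous_on UNIV F" unfolding F_def by (rule continuous_fseries[OF sp])
  have contG [continuous_intros]: "continuous_on UNIV G" unfolding G_def by (intro continuous_intros)
  have meas_cut [measurable]: "cut \<in> borel_measurable borel" unfolding cut_def by simp
  have cut01: "0 \<le> cut t" "cut t \<le> 1" for t by (simp_all add: cut_def indicator_def)
  have int_cut: "integrable circ (\<lambda>t. of_real (cut t) * h t)"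
    if "continuous_on UNIV h" "\<And>t. norm (h t) \<le> b" for h :: "real \<Rightarrow> complex" and b
  proof (rule circ.integrable_const_bound[where B = b])
    have [measurable]: "h \<in> borel_measurable borel" by (rule borel_measurable_continuous_onI) (rule that)
    show "(\<lambda>t. of_real (cut t) * h t) \<in> borel_measurable circ" by (rule measurable_circI) measurable
    have "norm (of_real (cut t) * h t) \<le> 1 * b" for t
      unfolding norm_mult by (intro mult_mono that) (use cut01[of t] in auto)
    then show "AE t in circ. norm (of_real (cut t) * h t) \<le> b" by simp
  qed
  have Ak: "A k = of_real (2 * pi * (if k \<le> d then p (d - k) else 0))" for k
  proof -
    have "A k = integral\<^sup>L circ (\<lambda>t. F t * cis (- (of_int (int d - int k) * t)))"
      unfolding A_def G_def by (simp add: mult.assoc cis_mult algebra_simps)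
    also have "\<dots> = (if int d - int k < 0 then 0 else of_real (2 * pi * p (nat (int d - int k))))"
      unfolding F_def by (rule integral_fseries_cis[OF sp])
    finally show ?thesis by (auto simp: nat_diff_distrib' not_less)
  qed
  have \<eta>0: "0 \<le> \<eta>" using order_trans[OF norm_ge_zero \<eta>[of pi]] \<delta> by simp
  have AB: "norm (A k - B k) \<le> 2 * pi * \<eta>" for k
  proof -
    have 1: "integrable circ (\<lambda>t. G t * cis (real k * t))"
      by (rule integrable_circ[where B = 1]) (auto intro!: continuous_intros simp: norm_mult G1 F1)
    have 2: "integrable circ (\<lambda>t. of_real (cut t) * G t * cis (real k * t))"
      unfolding mult.assoc by (rule int_cut[where b = 1]) (auto intro!: continuous_intros simp: norm_mult G1 F1)
    have "norm (A k - B k) = norm (integral\<^sup>L circ (\<lambda>t. G t * cis (real k * t) - of_real (cut t) * G t * cis (real k * t)))"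
      unfolding A_def B_def by (simp add: Bochner_Integration.integral_diff[OF 1 2])
    also have "\<dots> \<le> integral\<^sup>L circ (\<lambda>t. \<eta>)"
    proof (rule Bochner_Integration.integral_norm_bound_integral)
      fix t assume t: "t \<in> space circ"
      have "G t * cis (real k * t) - of_real (cut t) * G t * cis (real k * t) = of_real (1 - cut t) * (G t * cis (real k * t))"
        by (simp add: algebra_simps)
      then have "norm (G t * cis (real k * t) - of_real (cut t) * G t * cis (real k * t)) = (1 - cut t) * norm (F t)"
        using cut01[of t] by (simp only: norm_mult norm_of_real G1) simp
      also have "\<dots> \<le> \<eta>"
      proof (cases "\<bar>t\<bar> \<le> \<delta>")
        case True
        then have "cut t = 1" by (simp add: cut_def indicator_def abs_le_iff)
        then show ?thesis using \<eta>0 by simp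
      next
        case False
        then have "\<delta> \<le> \<bar>t\<bar>" by simp
        moreover have "\<bar>t\<bar> \<le> pi" using t by (simp add: abs_le_iff)
        ultimately have "norm (F t) \<le> \<eta>" unfolding F_def by (rule \<eta>)
        then show ?thesis using mult_mono[of "1 - cut t" 1 "norm (F t)" \<eta>] cut01[of t] by simp
      qed
      finally show "norm (G t * cis (real k * t) - of_real (cut t) * G t * cis (real k * t)) \<le> \<eta>" .
    qed (use 1 2 in auto)
    finally show ?thesis by (simp add: measure_circ)
  qed
  have A1: "norm (A k) \<le> 2 * pi" for k
  proof -
    have "p k \<le> 1" for k
      using sum_le_suminf[of p "{k}"] p sump by (simp add: sums_iff)
    then show ?thesis using p(1) unfolding Ak norm_of_real by (simp add: abs_mult)
  qed
  have B1: "norm (B k) \<le> 2 * pi" for k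
  proof -
    have 2: "integrable circ (\<lambda>t. of_real (cut t) * G t * cis (real k * t))"
      unfolding mult.assoc by (rule int_cut[where b = 1]) (auto intro!: continuous_intros simp: norm_mult G1 F1)
    have "norm (B k) \<le> integral\<^sup>L circ (\<lambda>t. 1)"
      unfolding B_def
    proof (rule Bochner_Integration.integral_norm_bound_integral)
      fix t
      show "norm (of_real (cut t) * G t * cis (real k * t)) \<le> 1"
        using mult_mono[OF cut01(2)[of t] F1[of t]] cut01[of t] by (simp add: norm_mult G1)
    qed (use 2 in auto)
    then show ?thesis by (simp add: measure_circ)
  qed
  have sq_diff: "norm ((A k)\<^sup>2 - (B k)\<^sup>2) \<le> 2 * \<eta> * (2 * pi)\<^sup>2" for k
  proof -
    have "(A k)\<^sup>2 - (B k)\<^sup>2 = (A k - B k) * (A k + B k)" by (simp add: power2_eq_square algebra_simps)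
    moreover have "norm (A k + B k) \<le> 2 * pi + 2 * pi" using norm_triangle_le[of "A k" "B k"] A1[of k] B1[of k] by simp
    ultimately have "norm ((A k)\<^sup>2 - (B k)\<^sup>2) \<le> (2 * pi * \<eta>) * (2 * pi + 2 * pi)"
      using AB[of k] \<eta>0 by (simp only: norm_mult) (intro mult_mono, auto)
    then show ?thesis by (simp add: power2_eq_square algebra_simps)
  qed
  have \<Phi>e: "(\<Sum>k\<le>m. of_real (e k) * cis (real k * \<alpha>)) = \<Phi> \<alpha>" for \<alpha>
  proof -
    have "\<Phi> \<alpha> = (\<Prod>i<m. 1 + of_nat i * (- (of_real \<rho> * cis \<alpha>)))" by (simp add: \<Phi>_def)
    also have "\<dots> = (\<Sum>k\<le>m. of_nat (stirling m (m - k)) * (- (of_real \<rho> * cis \<alpha>)) ^ k)"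
      by (rule prod_one_plus_stirling)
    also have "\<dots> = (\<Sum>k\<le>m. of_real (e k) * cis (real k * \<alpha>))"
    proof (rule sum.cong[OF refl])
      fix k
      have "(- (of_real \<rho> * cis \<alpha>)) ^ k = (-1) ^ k * (of_real \<rho> ^ k * cis (real k * \<alpha>))"
        unfolding power_minus[of "of_real \<rho> * cis \<alpha>"] power_mult_distrib Complex.DeMoivre ..
      then show "of_nat (stirling m (m - k)) * (- (of_real \<rho> * cis \<alpha>)) ^ k = of_real (e k) * cis (real k * \<alpha>)"
        by (simp add: e_def)
    qed
    finally show ?thesis by simp
  qed
  have \<Phi>0_eq: "(\<Sum>k\<le>m. e k) = \<Phi>0"
  proof -
    have "complex_of_real (\<Sum>k\<le>m. e k) = \<Phi> 0" using \<Phi>e[of 0] by simp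
    also have "\<Phi> 0 = of_real \<Phi>0" by (simp add: \<Phi>_def \<Phi>0_def)
    finally show ?thesis by (simp only: of_real_eq_iff)
  qed
  have abs_e: "(\<Sum>k\<le>m. \<bar>e k\<bar>) = E"
    unfolding E_def prod_one_plus_stirling using \<rho>(1) by (simp add: e_def abs_mult)
  \<comment> \<open>The L1 norm of the characteristic function near the origin. By Cauchy-Schwarz
    and Parseval its square is at most 2 delta * 2 pi * sum p(k)^2, and the sum is at most p(d)
    because d is a mode.\<close>
  define X where "X = integral\<^sup>L circ (\<lambda>t. cut t * norm (F t))"
  have int_cutF: "integrable circ (\<lambda>t. cut t * norm (F t))"
    using integrable_norm[OF int_cut[where b = 1, OF contF F1]] cut01 by (simp add: norm_mult)
  have X0: "0 \<le> X" unfolding X_def by (intro Bochner_Integration.integral_nonneg) (use cut01 in auto)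
  have X2: "X\<^sup>2 \<le> 4 * pi * \<delta> * p d"
  proof -
    \<comment> \<open>Cauchy-Schwarz is carried out as |F| <= a/2 + |F|^2 / (2a); this
      \<open>a\<close> makes the two integrated bounds equal.\<close>
    define a where "a = sqrt (pi * p d / \<delta>)"
    have a: "0 < a" "a\<^sup>2 = pi * p d / \<delta>" using pd \<delta> by (simp_all add: a_def)
    have sq: "integral\<^sup>L circ (\<lambda>t. (norm (F t))\<^sup>2) \<le> 2 * pi * p d"
    proof -
      have "(\<Sum>k. (p k)\<^sup>2) \<le> (\<Sum>k. p d * p k)"
      proof (rule suminf_le)
        show "(p k)\<^sup>2 \<le> p d * p k" for k using mult_right_mono[OF pd(1) p(1)] by (simp add: power2_eq_square)
      qed (use parseval(1)[OF sp] p in \<open>auto intro!: summable_mult simp: sums_iff\<close>)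
      also have "\<dots> = p d" using p by (subst suminf_mult) (simp_all add: sums_iff)
      finally show ?thesis unfolding F_def parseval(2)[OF sp] by (simp add: mult_left_mono)
    qed
    have icut: "integrable circ cut"
      by (rule circ.integrable_const_bound[where B = 1]) (use cut01 in \<open>auto intro!: measurable_circI\<close>)
    have iF: "integrable circ (\<lambda>t. (norm (F t))\<^sup>2)"
      by (rule integrable_circ[where B = 1]) (auto intro!: continuous_intros power_le_one F1)
    have int_cut1: "integral\<^sup>L circ cut = 2 * \<delta>"
    proof -
      have "integral\<^sup>L circ cut = measure circ {- \<delta>..\<delta>}"
        unfolding cut_def using \<delta> by (subst Bochner_Integration.integral_indicator) (simp add: Int_absorb2)
      also have "\<dots> = measure lborel {- \<delta>..\<delta>}"
        unfolding circ_def by (rule measure_restrict_space) (use \<delta> in auto)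
      finally show ?thesis using \<delta> by simp
    qed
    have "X \<le> integral\<^sup>L circ (\<lambda>t. (a / 2) * cut t + (1 / (2 * a)) * (norm (F t))\<^sup>2)"
      unfolding X_def
    proof (rule Bochner_Integration.integral_mono)
      show "integrable circ (\<lambda>t. (a / 2) * cut t + (1 / (2 * a)) * (norm (F t))\<^sup>2)"
        by (intro Bochner_Integration.integrable_add integrable_mult_right icut iF)
      fix t
      have "0 \<le> (a - norm (F t))\<^sup>2" by simp
      then have "2 * a * norm (F t) \<le> a\<^sup>2 + (norm (F t))\<^sup>2" by (simp add: power2_diff algebra_simps)
      then have "norm (F t) \<le> (a / 2) + (1 / (2 * a)) * (norm (F t))\<^sup>2"
        using a(1) by (simp add: field_simps power2_eq_square)
      then show "cut t * norm (F t) \<le> (a / 2) * cut t + (1 / (2 * a)) * (norm (F t))\<^sup>2"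
        using a(1) by (simp add: cut_def indicator_def)
    qed (rule int_cutF)
    also have "\<dots> = (a / 2) * (2 * \<delta>) + (1 / (2 * a)) * integral\<^sup>L circ (\<lambda>t. (norm (F t))\<^sup>2)"
      using icut iF by (simp add: int_cut1)
    also have "\<dots> \<le> (a / 2) * (2 * \<delta>) + (1 / (2 * a)) * (2 * pi * p d)"
      using a(1) sq by (intro add_left_mono mult_left_mono) auto
    also have "\<dots> = 2 * a * \<delta>"
    proof -
      have "pi * p d = a\<^sup>2 * \<delta>" using a(2) \<delta> by simp
      then show ?thesis using a(1) by (simp add: power2_eq_square)
    qed
    finally have "X\<^sup>2 \<le> (2 * a * \<delta>)\<^sup>2" using X0 by (intro power_mono) auto
    also have "\<dots> = 4 * a\<^sup>2 * \<delta>\<^sup>2" by (simp add: power_mult_distrib)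
    also have "\<dots> = 4 * pi * \<delta> * p d" unfolding a(2) using \<delta> by (simp add: power2_eq_square)
    finally show ?thesis .
  qed
  have \<Phi>_diff: "norm (\<Phi> \<alpha> - of_real \<Phi>0) \<le> \<kappa> * \<Phi>0" if "\<bar>\<alpha>\<bar> \<le> 2 * \<delta>" for \<alpha>
  proof -
    have "norm (\<Phi> \<alpha> - of_real \<Phi>0) \<le> (exp (real m ^ 2 * \<rho> * \<bar>\<alpha>\<bar>) - 1) * \<Phi>0"
      unfolding \<Phi>_def \<Phi>0_def by (rule norm_prod_ratio_le[OF \<rho>])
    also have "\<dots> \<le> \<kappa> * \<Phi>0"
    proof (intro mult_right_mono \<Phi>0)
      have "real m ^ 2 * \<rho> * \<bar>\<alpha>\<bar> \<le> real m ^ 2 * \<rho> * (2 * \<delta>)" using that \<rho> by (intro mult_left_mono mult_nonneg_nonneg) auto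
      then show "exp (real m ^ 2 * \<rho> * \<bar>\<alpha>\<bar>) - 1 \<le> \<kappa>" by (simp add: \<kappa>_def mult_ac)
    qed
    finally show ?thesis .
  qed
  have icutG: "integrable circ (\<lambda>t. of_real (cut t) * G t * cis (real k * t))" for k
    unfolding mult.assoc by (rule int_cut[where b = 1]) (auto intro!: continuous_intros simp: norm_mult G1 F1)
  \<comment> \<open>The inner integral for a fixed outer angle. \<open>Heq\<close> turns it into a
    finite sum over k, so linearity of the integral replaces Fubini's theorem.\<close>
  define H where "H = (\<lambda>t. integral\<^sup>L circ (\<lambda>u. of_real (cut u) * G u * (\<Phi> (t + u) - of_real \<Phi>0)))"
  have Heq: "H t = (\<Sum>k\<le>m. of_real (e k) * cis (real k * t) * B k) - of_real \<Phi>0 * B 0" for t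
  proof -
    have "(\<lambda>u. of_real (cut u) * G u * (\<Phi> (t + u) - of_real \<Phi>0)) =
      (\<lambda>u. (\<Sum>k\<le>m. of_real (e k) * cis (real k * t) * (of_real (cut u) * G u * cis (real k * u))) -
          of_real \<Phi>0 * (of_real (cut u) * G u * cis (real 0 * u)))"
    proof
      fix u
      have "\<Phi> (t + u) = (\<Sum>k\<le>m. of_real (e k) * (cis (real k * t) * cis (real k * u)))"
        unfolding \<Phi>e[symmetric] cis_mult by (simp add: distrib_left)
      then show "of_real (cut u) * G u * (\<Phi> (t + u) - of_real \<Phi>0) =
        (\<Sum>k\<le>m. of_real (e k) * cis (real k * t) * (of_real (cut u) * G u * cis (real k * u))) -
          of_real \<Phi>0 * (of_real (cut u) * G u * cis (real 0 * u))"
        by (simp add: right_diff_distrib sum_distrib_left mult_ac)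
    qed
    then have "H t = integral\<^sup>L circ (\<lambda>u. (\<Sum>k\<le>m. of_real (e k) * cis (real k * t) * (of_real (cut u) * G u * cis (real k * u))) -
          of_real \<Phi>0 * (of_real (cut u) * G u * cis (real 0 * u)))"
      by (simp only: H_def)
    also have "\<dots> = (\<Sum>k\<le>m. of_real (e k) * cis (real k * t) * B k) - of_real \<Phi>0 * B 0"
      unfolding B_def
      by (subst Bochner_Integration.integral_diff)
        (intro Bochner_Integration.integrable_sum integrable_mult_right icutG
        | subst Bochner_Integration.integral_sum | simp only: integral_mult_right_zero)+
    finally show ?thesis .
  qed
  have H_le: "norm (H t) \<le> \<kappa> * \<Phi>0 * X" if "\<bar>t\<bar> \<le> \<delta>" for t
  proof -
    have "norm (H t) \<le> integral\<^sup>L circ (\<lambda>u. \<kappa> * \<Phi>0 * (cut u * norm (F u)))"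
      unfolding H_def
    proof (rule Bochner_Integration.integral_norm_bound_integral)
      show "integrable circ (\<lambda>u. of_real (cut u) * G u * (\<Phi> (t + u) - of_real \<Phi>0))"
      proof -
        have "norm (\<Phi> \<alpha>) \<le> E" for \<alpha>
        proof -
          have "norm (\<Phi> \<alpha>) \<le> (\<Sum>k\<le>m. norm (of_real (e k) * cis (real k * \<alpha>)))"
            unfolding \<Phi>e[symmetric] by (rule norm_sum)
          then show ?thesis using abs_e by (simp add: norm_mult)
        qed
        then have "norm (\<Phi> (t + u) - of_real \<Phi>0) \<le> E + \<Phi>0" for u
          using norm_triangle_ineq4[of "\<Phi> (t + u)" "of_real \<Phi>0"] \<Phi>0 by (smt (verit) norm_of_real)
        then have "norm (G u * (\<Phi> (t + u) - of_real \<Phi>0)) \<le> 1 * (E + \<Phi>0)" for u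
          unfolding norm_mult G1 by (intro mult_mono F1) auto
        moreover have "continuous_on UNIV (\<lambda>u. G u * (\<Phi> (t + u) - of_real \<Phi>0))"
          unfolding \<Phi>_def by (intro continuous_intros)
        ultimately show ?thesis unfolding mult.assoc by (intro int_cut[where b = "1 * (E + \<Phi>0)"])
      qed
      show "integrable circ (\<lambda>u. \<kappa> * \<Phi>0 * (cut u * norm (F u)))" by (intro integrable_mult_right int_cutF)
      fix u
      show "norm (of_real (cut u) * G u * (\<Phi> (t + u) - of_real \<Phi>0)) \<le> \<kappa> * \<Phi>0 * (cut u * norm (F u))"
      proof (cases "\<bar>u\<bar> \<le> \<delta>")
        case True
        then have "\<bar>t + u\<bar> \<le> 2 * \<delta>" using that by simp
        from mult_left_mono[OF \<Phi>_diff[OF this], of "cut u * norm (F u)"] cut01[of u]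
        show ?thesis by (simp add: norm_mult G1 mult_ac)
      next
        case False
        then show ?thesis by (auto simp: cut_def indicator_def abs_le_iff)
      qed
    qed
    then show ?thesis by (simp add: X_def)
  qed
  \<comment> \<open>The difference is the double integral of G(t) G(u) (Phi(t+u) - Phi(0)) over the
    square |t|, |u| <= delta, where Phi(t+u) deviates from Phi(0) by a relative error of at most
    kappa.\<close>
  have main: "norm ((\<Sum>k\<le>m. of_real (e k) * (B k)\<^sup>2) - of_real \<Phi>0 * (B 0)\<^sup>2) \<le> \<kappa> * \<Phi>0 * X\<^sup>2"
  proof -
    have "(\<lambda>t. of_real (cut t) * G t * H t) =
      (\<lambda>t. (\<Sum>k\<le>m. (of_real (e k) * B k) * (of_real (cut t) * G t * cis (real k * t))) -
          (of_real \<Phi>0 * B 0) * (of_real (cut t) * G t * cis (real 0 * t)))"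
      unfolding Heq by (rule ext) (simp add: right_diff_distrib sum_distrib_left mult_ac)
    then have eq: "integral\<^sup>L circ (\<lambda>t. of_real (cut t) * G t * H t) =
      integral\<^sup>L circ (\<lambda>t. (\<Sum>k\<le>m. (of_real (e k) * B k) * (of_real (cut t) * G t * cis (real k * t))) -
          (of_real \<Phi>0 * B 0) * (of_real (cut t) * G t * cis (real 0 * t)))"
      and int: "integrable circ (\<lambda>t. of_real (cut t) * G t * H t)"
      by (simp_all only:) (intro Bochner_Integration.integrable_diff Bochner_Integration.integrable_sum integrable_mult_right icutG)
    have Bk: "integral\<^sup>L circ (\<lambda>t. of_real (cut t) * G t * cis (real k * t)) = B k" for k
      by (simp add: B_def)
    have "integral\<^sup>L circ (\<lambda>t. (\<Sum>k\<le>m. (of_real (e k) * B k) * (of_real (cut t) * G t * cis (real k * t))) -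
          (of_real \<Phi>0 * B 0) * (of_real (cut t) * G t * cis (real 0 * t))) =
       (\<Sum>k\<le>m. (of_real (e k) * B k) * B k) - (of_real \<Phi>0 * B 0) * B 0"
      by (subst Bochner_Integration.integral_diff)
        (intro Bochner_Integration.integrable_sum integrable_mult_right icutG
        | subst Bochner_Integration.integral_sum | simp only: integral_mult_right_zero Bk)+
    then have "(\<Sum>k\<le>m. of_real (e k) * (B k)\<^sup>2) - of_real \<Phi>0 * (B 0)\<^sup>2 = integral\<^sup>L circ (\<lambda>t. of_real (cut t) * G t * H t)"
      unfolding eq by (simp only: power2_eq_square mult.assoc)
    also have "norm \<dots> \<le> integral\<^sup>L circ (\<lambda>t. \<kappa> * \<Phi>0 * X * (cut t * norm (F t)))"
    proof (rule Bochner_Integration.integral_norm_bound_integral[OF int])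
      show "integrable circ (\<lambda>t. \<kappa> * \<Phi>0 * X * (cut t * norm (F t)))" by (intro integrable_mult_right int_cutF)
      fix t
      show "norm (of_real (cut t) * G t * H t) \<le> \<kappa> * \<Phi>0 * X * (cut t * norm (F t))"
      proof (cases "\<bar>t\<bar> \<le> \<delta>")
        case True
        from mult_left_mono[OF H_le[OF this], of "cut t * norm (F t)"] cut01[of t]
        show ?thesis by (simp add: norm_mult G1 mult_ac)
      next
        case False
        then show ?thesis by (auto simp: cut_def indicator_def abs_le_iff)
      qed
    qed
    also have "\<dots> = \<kappa> * \<Phi>0 * X\<^sup>2" by (simp add: X_def power2_eq_square)
    finally show ?thesis .
  qed
  define S where "S = (\<Sum>k\<le>m. e k * (if k \<le> d then p (d - k) / p d else 0)\<^sup>2)"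
  have SA: "of_real (S * (2 * pi * p d)\<^sup>2) = (\<Sum>k\<le>m. of_real (e k) * (A k)\<^sup>2)"
  proof -
    have "S * (2 * pi * p d)\<^sup>2 = (\<Sum>k\<le>m. e k * (2 * pi * (if k \<le> d then p (d - k) else 0))\<^sup>2)"
      unfolding S_def sum_distrib_right
      by (intro sum.cong) (use pd in \<open>auto simp: power_mult_distrib power_divide\<close>)
    then show ?thesis unfolding Ak by simp
  qed
  have A0: "A 0 = of_real (2 * pi * p d)" by (simp add: Ak)
  have "norm (of_real ((S - \<Phi>0) * (2 * pi * p d)\<^sup>2) :: complex) \<le>
     E * (2 * \<eta> * (2 * pi)\<^sup>2) + \<kappa> * \<Phi>0 * X\<^sup>2 + \<Phi>0 * (2 * \<eta> * (2 * pi)\<^sup>2)"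
  proof -
    have tri: "norm (x + y - z) \<le> a + b + c" if "norm x \<le> a" "norm y \<le> b" "norm z \<le> c" for x y z :: complex and a b c
      using norm_triangle_ineq4[of "x + y" z] norm_triangle_ineq[of x y] that by linarith
    \<comment> \<open>Three errors: passing from A to B in every term, the truncated double
      integral, and passing back from B 0 to A 0.\<close>
    have eq: "of_real ((S - \<Phi>0) * (2 * pi * p d)\<^sup>2) = (\<Sum>k\<le>m. of_real (e k) * ((A k)\<^sup>2 - (B k)\<^sup>2)) +
      ((\<Sum>k\<le>m. of_real (e k) * (B k)\<^sup>2) - of_real \<Phi>0 * (B 0)\<^sup>2) - of_real \<Phi>0 * ((A 0)\<^sup>2 - (B 0)\<^sup>2)"
      using SA by (simp add: A0 right_diff_distrib sum_subtractf left_diff_distrib)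
    have "norm (\<Sum>k\<le>m. of_real (e k) * ((A k)\<^sup>2 - (B k)\<^sup>2)) \<le> E * (2 * \<eta> * (2 * pi)\<^sup>2)"
    proof -
      have "norm (\<Sum>k\<le>m. of_real (e k) * ((A k)\<^sup>2 - (B k)\<^sup>2)) \<le> (\<Sum>k\<le>m. \<bar>e k\<bar> * (2 * \<eta> * (2 * pi)\<^sup>2))"
        by (rule sum_norm_le) (unfold norm_mult norm_of_real, intro mult_left_mono sq_diff abs_ge_zero)
      then show ?thesis by (simp only: abs_e sum_distrib_right[symmetric])
    qed
    moreover have "norm (of_real \<Phi>0 * ((A 0)\<^sup>2 - (B 0)\<^sup>2)) \<le> \<Phi>0 * (2 * \<eta> * (2 * pi)\<^sup>2)"
      using mult_left_mono[OF sq_diff[of 0] \<Phi>0(1)] \<Phi>0(1) by (simp only: norm_mult norm_of_real abs_of_nonneg)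
    ultimately show ?thesis unfolding eq by (intro tri main)
  qed
  also have "\<dots> \<le> 4 * \<eta> * E * (2 * pi)\<^sup>2 + \<kappa> * \<Phi>0 * (4 * pi * \<delta> * p d)"
  proof -
    have "\<Phi>0 * (2 * \<eta> * (2 * pi)\<^sup>2) \<le> E * (2 * \<eta> * (2 * pi)\<^sup>2)" using \<Phi>0 E1 \<eta>0 by (intro mult_right_mono) auto
    moreover have "\<kappa> * \<Phi>0 * X\<^sup>2 \<le> \<kappa> * \<Phi>0 * (4 * pi * \<delta> * p d)" using \<kappa>0 \<Phi>0 X2 by (intro mult_left_mono) auto
    ultimately show ?thesis by (simp add: algebra_simps)
  qed
  finally have fin: "\<bar>S - \<Phi>0\<bar> * (2 * pi * p d)\<^sup>2 \<le> 4 * \<eta> * E * (2 * pi)\<^sup>2 + \<kappa> * \<Phi>0 * (4 * pi * \<delta> * p d)"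
    by (simp only: norm_of_real abs_mult abs_power2)
  have "0 < (2 * pi * p d)\<^sup>2" using pd by simp
  then have "\<bar>S - \<Phi>0\<bar> \<le> (4 * \<eta> * E * (2 * pi)\<^sup>2 + \<kappa> * \<Phi>0 * (4 * pi * \<delta> * p d)) / (2 * pi * p d)\<^sup>2"
    using fin by (simp only: pos_le_divide_eq)
  also have "\<dots> = 4 * \<eta> * E / (p d)\<^sup>2 + \<kappa> * \<Phi>0 * \<delta> / (pi * p d)"
    using pd by (simp add: add_divide_distrib power_mult_distrib) (simp add: field_simps power2_eq_square)
  finally show ?thesis
    unfolding S_def \<Phi>0_def E_def \<kappa>_def e_def by (simp add: mult_ac)
qed

section \<open>The probability of distinct pairs and the tilted Stirling law\<close>

definition stir_ratio :: "nat \<Rightarrow> nat \<Rightarrow> real" where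
  "stir_ratio n m = real (Stirling (m - 1) n) / real (Stirling m n)"

text \<open>
  The probability that two independent uniform surjections \<open>f\<close>, \<open>g\<close> from \<open>{1..m}\<close> onto \<open>{1..n}\<close>
  make \<open>x \<mapsto> (f x, g x)\<close> injective.
\<close>

definition simple_prob :: "nat \<Rightarrow> nat \<Rightarrow> real" where
  "simple_prob n m = (\<Sum>k\<le>m. (-1) ^ k * real (stirling m (m - k)) *
     (real (Stirling (m - k) n) / real (Stirling m n))\<^sup>2)"

lemma card_core_digraphs_eq:
  assumes "1 \<le> n" "n \<le> m"
  shows "real (card (core_digraphs n m)) = (surj_count n m)\<^sup>2 / fact m * simple_prob n m"
proof -
  have S: "0 < real (Stirling m n)" using Stirling_pos[OF assms] by simp
  have "fact m * real (card (core_digraphs n m)) =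
    (\<Sum>k\<le>m. (-1) ^ k * real (stirling m (m - k)) * (fact n * real (Stirling (m - k) n))\<^sup>2)"
    using card_covering_relations[of "{1..n}" "{1..n}" m] by (simp add: card_core_digraphs power2_eq_square)
  also have "\<dots> = (surj_count n m)\<^sup>2 * simple_prob n m"
    unfolding simple_prob_def sum_distrib_left surj_count_def
    by (intro sum.cong refl) (use S in \<open>simp add: power_mult_distrib power_divide\<close>)
  finally show ?thesis by (simp add: field_simps)
qed

context
  fixes n m :: nat and r :: real
  assumes n2: "2 \<le> n" and nm: "n < m"
  defines "r \<equiv> stir_ratio n m"
begin

lemma Stirling_m_pos: "0 < Stirling m n" "0 < Stirling (m - 1) n"
  using Stirling_pos[of n m] Stirling_pos[of n "m - 1"] n2 nm by simp_all

lemma stir_ratio_pos: "0 < r"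
  using Stirling_m_pos by (simp add: r_def stir_ratio_def)

text \<open>By the recurrence. The quotient is the chance that a given point is alone in its fibre
  under a random surjection; it measures how close the largest geometric ratio n r is to 1.\<close>

lemma one_minus_stir_ratio: "1 - real n * r = real (Stirling (m - 1) (n - 1)) / real (Stirling m n)"
proof -
  have "Stirling m n = n * Stirling (m - 1) n + Stirling (m - 1) (n - 1)"
    using n2 nm by (cases m; cases n) simp_all
  then have "real (Stirling m n) = real n * real (Stirling (m - 1) n) + real (Stirling (m - 1) (n - 1))"
    by (simp only: of_nat_add of_nat_mult)
  then show ?thesis using Stirling_m_pos by (simp add: r_def stir_ratio_def field_simps)
qed

lemma stir_ratio_less: "real n * r < 1"
proof -
  have "0 < Stirling (m - 1) (n - 1)" using Stirling_pos[of "n - 1" "m - 1"] n2 nm by simp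
  then have "0 < 1 - real n * r" unfolding one_minus_stir_ratio using Stirling_m_pos by simp
  then show ?thesis by simp
qed

lemma Stirling_ratio_le:
  assumes "1 \<le> j" "j \<le> m"
  shows "real (Stirling (j - 1) n) \<le> r * real (Stirling j n)"
proof -
  have "Stirling (j - 1) n * Stirling (Suc (m - 1)) n \<le> Stirling (Suc (j - 1)) n * Stirling (m - 1) n"
    using assms n2 by (intro Stirling_ratio_mono) auto
  then have "Stirling (j - 1) n * Stirling m n \<le> Stirling j n * Stirling (m - 1) n" using assms nm by simp
  then have "real (Stirling (j - 1) n) * real (Stirling m n) \<le> real (Stirling j n) * real (Stirling (m - 1) n)"
    by (metis of_nat_le_iff of_nat_mult)
  then show ?thesis using Stirling_m_pos by (simp add: r_def stir_ratio_def field_simps)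
qed

lemma Stirling_ratio_ge:
  assumes "m \<le> j"
  shows "r * real (Stirling (Suc j) n) \<le> real (Stirling j n)"
proof -
  have "Stirling (m - 1) n * Stirling (Suc j) n \<le> Stirling (Suc (m - 1)) n * Stirling j n"
    using assms n2 by (intro Stirling_ratio_mono) auto
  then have "Stirling (m - 1) n * Stirling (Suc j) n \<le> Stirling m n * Stirling j n" using nm by simp
  then have "real (Stirling (m - 1) n) * real (Stirling (Suc j) n) \<le> real (Stirling m n) * real (Stirling j n)"
    by (metis of_nat_le_iff of_nat_mult)
  then show ?thesis using Stirling_m_pos by (simp add: r_def stir_ratio_def field_simps)
qed

lemma Stirling_minus_le: "k \<le> m \<Longrightarrow> real (Stirling (m - k) n) \<le> r ^ k * real (Stirling m n)"
proof (induction k)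
  case (Suc k)
  have "real (Stirling (m - k - 1) n) \<le> r * real (Stirling (m - k) n)"
    using Suc.prems by (intro Stirling_ratio_le) auto
  also have "\<dots> \<le> r * (r ^ k * real (Stirling m n))"
    using Suc stir_ratio_pos by (intro mult_left_mono) auto
  finally show ?case by simp
qed simp

lemma Stirling_plus_le: "r ^ k * real (Stirling (m + k) n) \<le> real (Stirling m n)"
proof (induction k)
  case (Suc k)
  have "r ^ Suc k * real (Stirling (m + Suc k) n) = r ^ k * (r * real (Stirling (Suc (m + k)) n))"
    by (simp only: power_Suc add_Suc_right mult_ac)
  also have "\<dots> \<le> r ^ k * real (Stirling (m + k) n)"
    using stir_ratio_pos by (intro mult_left_mono Stirling_ratio_ge) auto
  finally show ?case using Suc by simp
qed simp

text \<open>Each quotient of Stirling numbers is at most r^k, so the terms with k >= 1 sum in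
  absolute value to at most prod (1 + i r^2) - 1. Ignoring the signs is affordable only when m r
  tends to 0.\<close>

lemma simple_prob_near_one: "\<bar>simple_prob n m - 1\<bar> \<le> exp ((real m * r)\<^sup>2) - 1"
proof -
  let ?q = "\<lambda>k. real (Stirling (m - k) n) / real (Stirling m n)"
  have q: "0 \<le> ?q k" "?q k \<le> r ^ k" if "k \<le> m" for k
    using Stirling_minus_le[OF that] Stirling_m_pos by (simp_all add: field_simps)
  have "simple_prob n m = (\<Sum>k\<in>{0} \<union> {1..m}. (-1) ^ k * real (stirling m (m - k)) * (?q k)\<^sup>2)"
    unfolding simple_prob_def by (rule sum.cong) auto
  also have "\<dots> = 1 + (\<Sum>k=1..m. (-1) ^ k * real (stirling m (m - k)) * (?q k)\<^sup>2)"
    using Stirling_m_pos by (subst sum.union_disjoint) auto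
  finally have "\<bar>simple_prob n m - 1\<bar> = \<bar>\<Sum>k=1..m. (-1) ^ k * real (stirling m (m - k)) * (?q k)\<^sup>2\<bar>" by simp
  also have "\<dots> \<le> (\<Sum>k=1..m. real (stirling m (m - k)) * (r\<^sup>2) ^ k)"
  proof (rule sum_abs[THEN order_trans], rule sum_mono)
    fix k assume "k \<in> {1..m}"
    then have "(?q k)\<^sup>2 \<le> (r ^ k)\<^sup>2" using q[of k] by (intro power_mono) auto
    then have "real (stirling m (m - k)) * (?q k)\<^sup>2 \<le> real (stirling m (m - k)) * (r\<^sup>2) ^ k"
      by (intro mult_left_mono) (simp_all add: power_mult[symmetric] mult.commute)
    then show "\<bar>(-1) ^ k * real (stirling m (m - k)) * (?q k)\<^sup>2\<bar> \<le> real (stirling m (m - k)) * (r\<^sup>2) ^ k"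
      by (simp add: abs_mult)
  qed
  also have "\<dots> = (\<Sum>k\<in>{0} \<union> {1..m}. real (stirling m (m - k)) * (r\<^sup>2) ^ k) - 1"
    by (subst sum.union_disjoint) auto
  also have "{0} \<union> {1..m} = {..m}" by auto
  also have "(\<Sum>k\<le>m. real (stirling m (m - k)) * (r\<^sup>2) ^ k) = (\<Prod>i<m. 1 + real i * r\<^sup>2)"
    by (simp add: prod_one_plus_stirling)
  also have "\<dots> \<le> (\<Prod>i<m. exp (real m * r\<^sup>2))"
  proof (rule prod_mono)
    fix i assume "i \<in> {..<m}"
    then have "real i * r\<^sup>2 \<le> real m * r\<^sup>2" by (intro mult_right_mono) auto
    then show "0 \<le> 1 + real i * r\<^sup>2 \<and> 1 + real i * r\<^sup>2 \<le> exp (real m * r\<^sup>2)"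
      using exp_ge_add_one_self[of "real m * r\<^sup>2"] by (simp del: exp_ge_add_one_self)
  qed
  also have "\<dots> = exp ((real m * r)\<^sup>2)"
    by (simp add: exp_of_nat_mult[symmetric] power2_eq_square mult_ac)
  finally show ?thesis by simp
qed

text \<open>\<open>mode_prob\<close> is the law of a sum of independent geometric variables with ratios \<open>r, 2r, \<dots>, nr\<close>;
  the choice of \<open>r\<close> makes \<open>m - n\<close> its mode, which lets Parseval's identity bound
  its Fourier series from above by the value at the mode.\<close>

definition mode_prob :: "nat \<Rightarrow> real" where
  "mode_prob k = real (Stirling (n + k) n) * r ^ k * (\<Prod>i=1..n. 1 - real i * r)"

lemma factor_pos: "i \<le> n \<Longrightarrow> 0 < 1 - real i * r"
proof -
  assume "i \<le> n"
  then have "real i * r \<le> real n * r" using stir_ratio_pos by (intro mult_right_mono) auto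
  then show ?thesis using stir_ratio_less by simp
qed

lemma factor_prod_pos: "0 < (\<Prod>i=1..n. 1 - real i * r)"
  by (rule prod_pos) (use factor_pos in auto)

lemma mode_prob_nonneg: "0 \<le> mode_prob k"
  unfolding mode_prob_def
  by (intro mult_nonneg_nonneg order_less_imp_le[OF factor_prod_pos]) (use stir_ratio_pos in auto)

lemma mode_prob_sums: "mode_prob sums 1"
proof -
  have "real n * norm r < 1" using stir_ratio_less stir_ratio_pos by simp
  from sums_mult2[OF Stirling_ogf[OF this], of "\<Prod>i=1..n. 1 - real i * r"]
  have "mode_prob sums ((\<Prod>i=1..n. inverse (1 - real i * r)) * (\<Prod>i=1..n. 1 - real i * r))"
    unfolding mode_prob_def by (rule sums_transfer) simp_all
  also have "(\<Prod>i=1..n. inverse (1 - real i * r)) * (\<Prod>i=1..n. 1 - real i * r) = 1"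
    unfolding prod.distrib[symmetric]
  proof (rule prod.neutral, rule ballI)
    fix i assume "i \<in> {1..n}"
    then have "0 < 1 - real i * r" by (intro factor_pos) simp
    then show "inverse (1 - real i * r) * (1 - real i * r) = 1" by (intro left_inverse) simp
  qed
  finally show ?thesis .
qed

text \<open>The choice of \<open>r\<close> makes the weights at m - n - 1 and m - n equal, and
  log-concavity then makes the weights fall off on both sides.\<close>

lemma mode_prob_le: "mode_prob k \<le> mode_prob (m - n)"
proof -
  have "real (Stirling (n + k) n) * r ^ k \<le> real (Stirling m n) * r ^ (m - n)"
  proof (cases "k \<le> m - n")
    case True
    then have "real (Stirling (m - (m - n - k)) n) * r ^ k \<le> (r ^ (m - n - k) * real (Stirling m n)) * r ^ k"
      using stir_ratio_pos by (intro mult_right_mono Stirling_minus_le) auto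
    also have "\<dots> = real (Stirling m n) * (r ^ (m - n - k) * r ^ k)" by (simp only: mult_ac)
    also have "r ^ (m - n - k) * r ^ k = r ^ (m - n)"
      by (simp only: power_add[symmetric] le_add_diff_inverse2[OF True])
    also have "m - (m - n - k) = n + k" using True nm by simp
    finally show ?thesis .
  next
    case False
    then have eq: "n + k = m + (k - (m - n))" "k = (m - n) + (k - (m - n))" using nm by simp_all
    have "real (Stirling (n + k) n) * r ^ k = (r ^ (k - (m - n)) * real (Stirling (m + (k - (m - n))) n)) * r ^ (m - n)"
      by (subst eq(1), subst (2) eq(2)) (simp only: power_add mult_ac)
    also have "\<dots> \<le> real (Stirling m n) * r ^ (m - n)"
      using stir_ratio_pos by (intro mult_right_mono Stirling_plus_le) auto
    finally show ?thesis .
  qed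
  then have "real (Stirling (n + k) n) * r ^ k * (\<Prod>i=1..n. 1 - real i * r) \<le>
     real (Stirling m n) * r ^ (m - n) * (\<Prod>i=1..n. 1 - real i * r)"
    using factor_prod_pos by (intro mult_right_mono) auto
  then show ?thesis using nm by (simp add: mode_prob_def)
qed

lemma mode_prob_mode_pos: "0 < mode_prob (m - n)"
  unfolding mode_prob_def
  by (intro mult_pos_pos factor_prod_pos) (use stir_ratio_pos Stirling_m_pos nm in auto)

text \<open>The tilting contributes r^k to each quotient, and squaring turns this into the parameter
  rho = r^2 of \<open>simple_ratio_estimate\<close>, with d = m - n. For k > m - n the Stirling
  number S(m-k,n) is 0, in agreement with the default value.\<close>

lemma simple_prob_eq_mode_prob:
  "simple_prob n m = (\<Sum>k\<le>m. (-1) ^ k * real (stirling m (m - k)) * (r\<^sup>2) ^ k *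
     (if k \<le> m - n then mode_prob (m - n - k) / mode_prob (m - n) else 0)\<^sup>2)"
  unfolding simple_prob_def
proof (rule sum.cong[OF refl])
  fix k
  have "real (Stirling (m - k) n) / real (Stirling m n) =
      r ^ k * (if k \<le> m - n then mode_prob (m - n - k) / mode_prob (m - n) else 0)"
  proof (cases "k \<le> m - n")
    case True
    then have eq: "n + (m - n - k) = m - k" "n + (m - n) = m" using nm by simp_all
    define Q where "Q = (\<Prod>i=1..n. 1 - real i * r)"
    have Q: "Q \<noteq> 0" using less_imp_neq[OF factor_prod_pos, symmetric] unfolding Q_def .
    have "r ^ (m - n) = r ^ k * r ^ (m - n - k)"
      by (simp only: power_add[symmetric] le_add_diff_inverse[OF True])
    then have e: "mode_prob (m - n) = real (Stirling m n) * (r ^ k * r ^ (m - n - k)) * Q"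
      "mode_prob (m - n - k) = real (Stirling (m - k) n) * r ^ (m - n - k) * Q"
      by (simp_all only: mode_prob_def Q_def eq)
    have gen: "a / b = x * (a * y * q / (b * (x * y) * q))" if "b \<noteq> 0" "x \<noteq> 0" "y \<noteq> 0" "q \<noteq> 0" for a b x y q :: real
      using that by simp
    show ?thesis
      unfolding if_P[OF True] e by (rule gen) (use Q stir_ratio_pos Stirling_m_pos in auto)
  next
    case False
    then have "m - k < n" using n2 nm by linarith
    then show ?thesis using False by simp
  qed
  then show "(-1) ^ k * real (stirling m (m - k)) * (real (Stirling (m - k) n) / real (Stirling m n))\<^sup>2 =
    (-1) ^ k * real (stirling m (m - k)) * (r\<^sup>2) ^ k *
     (if k \<le> m - n then mode_prob (m - n - k) / mode_prob (m - n) else 0)\<^sup>2"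
    by (simp only: power_mult_distrib power_mult[symmetric] mult.commute[of k 2] mult.assoc)
qed

text \<open>From |1 - x e^(it)|^2 = (1-x)^2 + 2 x (1 - cos t) in each geometric factor x = i
  r.\<close>

lemma norm_fseries_mode_prob:
  "(norm (fseries mode_prob t))\<^sup>2 =
    (\<Prod>i=1..n. 1 / (1 + 2 * (real i * r) * (1 - cos t) / (1 - real i * r)\<^sup>2))"
proof -
  have "real n * norm (of_real r * cis t) < 1" using stir_ratio_less stir_ratio_pos by (simp add: norm_mult)
  from sums_mult2[OF Stirling_ogf[OF this], of "of_real (\<Prod>i=1..n. 1 - real i * r)"]
  have "(\<lambda>k. of_real (mode_prob k) * cis (real k * t)) sums
    ((\<Prod>i=1..n. inverse (1 - of_nat i * (of_real r * cis t))) * of_real (\<Prod>i=1..n. 1 - real i * r))"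
    by (rule sums_transfer) (simp_all add: mode_prob_def power_mult_distrib Complex.DeMoivre)
  then have "fseries mode_prob t = (\<Prod>i=1..n. of_real (1 - real i * r) / (1 - of_nat i * (of_real r * cis t)))"
    by (simp add: fseries_def sums_iff prod.distrib[symmetric] divide_inverse mult.commute)
  then have "(norm (fseries mode_prob t))\<^sup>2 =
    (\<Prod>i=1..n. (norm (of_real (1 - real i * r) / (1 - of_nat i * (of_real r * cis t))))\<^sup>2)"
    by (simp only: prod_norm[symmetric] prod_power_distrib)
  also have "\<dots> = (\<Prod>i=1..n. 1 / (1 + 2 * (real i * r) * (1 - cos t) / (1 - real i * r)\<^sup>2))"
  proof (rule prod.cong[OF refl])
    fix i assume "i \<in> {1..n}"
    then have pos: "0 < 1 - real i * r" by (intro factor_pos) simp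
    define x where "x = real i * r"
    have "(norm (1 - of_nat i * (of_real r * cis t)))\<^sup>2 = (1 - x * cos t)\<^sup>2 + (x * sin t)\<^sup>2"
      by (simp add: cmod_power2 x_def mult_ac)
    also have "\<dots> = 1 - 2 * x * cos t + x\<^sup>2 * ((sin t)\<^sup>2 + (cos t)\<^sup>2)"
      by algebra
    also have "\<dots> = (1 - x)\<^sup>2 + 2 * x * (1 - cos t)"
      unfolding sin_cos_squared_add by algebra
    also have "\<dots> = (1 - x)\<^sup>2 * (1 + 2 * x * (1 - cos t) / (1 - x)\<^sup>2)"
      using pos by (simp add: x_def distrib_left)
    finally have N: "(norm (1 - of_nat i * (of_real r * cis t)))\<^sup>2 = (1 - x)\<^sup>2 * (1 + 2 * x * (1 - cos t) / (1 - x)\<^sup>2)" .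
    have "(norm (of_real (1 - real i * r) / (1 - of_nat i * (of_real r * cis t))))\<^sup>2 =
       (1 - x)\<^sup>2 / (norm (1 - of_nat i * (of_real r * cis t)))\<^sup>2"
      by (simp only: norm_divide power_divide norm_of_real power2_abs x_def)
    also have "\<dots> = 1 / (1 + 2 * x * (1 - cos t) / (1 - x)\<^sup>2)"
      unfolding N using pos by (simp add: x_def)
    finally show "(norm (of_real (1 - real i * r) / (1 - of_nat i * (of_real r * cis t))))\<^sup>2 =
      1 / (1 + 2 * (real i * r) * (1 - cos t) / (1 - real i * r)\<^sup>2)" by (simp add: x_def)
  qed
  finally show ?thesis .
qed

text \<open>A geometric variable with ratio x has variance x / (1-x)^2, so this bounds the variance
  of \<open>mode_prob\<close>. As 1 - i r = \<tau> + (n-i) r, all terms but the one at i = n are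
  dominated by a telescoping sum, 1/(a+r)^2 <= (1/a - 1/(a+r)) / r.\<close>

lemma sum_variance_le:
  fixes \<tau> :: real
  defines "\<tau> \<equiv> 1 - real n * r"
  shows "(\<Sum>i=1..n. real i * r / (1 - real i * r)\<^sup>2) \<le> 1 / \<tau>\<^sup>2 + 1 / (r * \<tau>)"
proof -
  have \<tau>: "0 < \<tau>" using stir_ratio_less by (simp add: \<tau>_def)
  have r: "0 < r" by (rule stir_ratio_pos)
  have "(\<Sum>i=1..n. real i * r / (1 - real i * r)\<^sup>2) \<le> (\<Sum>i=1..n. 1 / (1 - real i * r)\<^sup>2)"
  proof (rule sum_mono)
    fix i assume "i \<in> {1..n}"
    then have "0 < 1 - real i * r" by (intro factor_pos) simp
    then show "real i * r / (1 - real i * r)\<^sup>2 \<le> 1 / (1 - real i * r)\<^sup>2" by (intro divide_right_mono) auto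
  qed
  also have "\<dots> = (\<Sum>k<n. 1 / (\<tau> + real k * r)\<^sup>2)"
    by (rule sum.reindex_bij_witness[of _ "\<lambda>k. n - k" "\<lambda>i. n - i"])
      (auto simp: \<tau>_def of_nat_diff algebra_simps)
  also have "\<dots> \<le> 1 / \<tau>\<^sup>2 + (1 / r) * (1 / \<tau> - 1 / (\<tau> + real (n - 1) * r))"
  proof -
    have "(\<Sum>k<Suc j. 1 / (\<tau> + real k * r)\<^sup>2) \<le> 1 / \<tau>\<^sup>2 + (1 / r) * (1 / \<tau> - 1 / (\<tau> + real j * r))" for j
    proof (induction j)
      case (Suc j)
      define a where "a = \<tau> + real j * r"
      have a: "0 < a" using \<tau> r by (simp add: a_def add_pos_nonneg)
      have "1 / (a + r)\<^sup>2 \<le> 1 / (a * (a + r))"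
        using a r by (intro divide_left_mono) (auto simp: power2_eq_square intro!: mult_right_mono)
      also have "\<dots> = (1 / r) * (1 / a - 1 / (a + r))" using a r by (simp add: field_simps)
      finally have "1 / (\<tau> + real (Suc j) * r)\<^sup>2 \<le> (1 / r) * (1 / a - 1 / (\<tau> + real (Suc j) * r))"
        by (simp add: a_def algebra_simps)
      then show ?case using Suc.IH unfolding a_def by (simp only: sum.lessThan_Suc[of _ "Suc j"]) (simp only: right_diff_distrib)
    qed simp
    from this[of "n - 1"] show ?thesis using n2 by simp
  qed
  also have "\<dots> \<le> 1 / \<tau>\<^sup>2 + 1 / (r * \<tau>)"
  proof -
    have "(1 / r) * (1 / \<tau> - 1 / (\<tau> + real (n - 1) * r)) \<le> (1 / r) * (1 / \<tau>)"
      using r \<tau> by (intro mult_left_mono) (auto simp: add_pos_nonneg less_imp_le)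
    then show ?thesis by simp
  qed
  finally show ?thesis .
qed

text \<open>A law of variance at most V has a mode of weight at least of order 1 / sqrt V. Here
  |F|^2 >= 1/e for |t| <= 1 / sqrt V, while Parseval bounds the integral of |F|^2 by 2 pi times the
  weight of the mode; 12 bounds e pi.\<close>

lemma mode_prob_mode_ge:
  fixes \<tau> :: real
  defines "\<tau> \<equiv> 1 - real n * r"
  shows "1 \<le> 12 * sqrt (1 / \<tau>\<^sup>2 + 1 / (r * \<tau>)) * mode_prob (m - n)"
proof -
  define V where "V = 1 / \<tau>\<^sup>2 + 1 / (r * \<tau>)"
  have r: "0 < r" by (rule stir_ratio_pos)
  have \<tau>: "0 < \<tau>" "\<tau> \<le> 1" using stir_ratio_less r by (simp_all add: \<tau>_def)
  have "1 \<le> 1 / \<tau>\<^sup>2" using \<tau> by (simp add: power_le_one)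
  then have V: "1 \<le> V" using r \<tau> by (simp add: V_def add_increasing2)
  define s where "s = 1 / sqrt V"
  have s: "0 < s" "s \<le> 1" "s\<^sup>2 = 1 / V" using V by (simp_all add: s_def power_divide)
  have spi: "s \<le> pi" using s pi_ge_two by linarith
  let ?F = "fseries mode_prob"
  have sm: "summable (\<lambda>k. \<bar>mode_prob k\<bar>)" using mode_prob_sums mode_prob_nonneg by (simp add: sums_iff)
  have F_ge: "exp (- 1) * indicator {- s..s} t \<le> (norm (?F t))\<^sup>2" for t
  proof (cases "\<bar>t\<bar> \<le> s")
    case True
    have "t\<^sup>2 \<le> s\<^sup>2" using True s(1) by (simp add: abs_le_square_iff[symmetric])
    have "exp (- 1) \<le> exp (- (\<Sum>i=1..n. 2 * (real i * r) * (1 - cos t) / (1 - real i * r)\<^sup>2))"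
    proof -
      have "(\<Sum>i=1..n. 2 * (real i * r) * (1 - cos t) / (1 - real i * r)\<^sup>2) =
          2 * (1 - cos t) * (\<Sum>i=1..n. real i * r / (1 - real i * r)\<^sup>2)"
        by (simp add: sum_distrib_left mult_ac)
      also have "\<dots> \<le> t\<^sup>2 * V"
        unfolding V_def \<tau>_def
        by (intro mult_mono one_minus_cos_le sum_variance_le sum_nonneg) (use r in auto)
      also have "\<dots> \<le> 1" using \<open>t\<^sup>2 \<le> s\<^sup>2\<close> V by (simp add: s(3) field_simps)
      finally show ?thesis by simp
    qed
    also have "\<dots> = (\<Prod>i=1..n. exp (- (2 * (real i * r) * (1 - cos t) / (1 - real i * r)\<^sup>2)))"
      by (simp add: exp_sum[symmetric] sum_negf)
    also have "\<dots> \<le> (\<Prod>i=1..n. 1 / (1 + 2 * (real i * r) * (1 - cos t) / (1 - real i * r)\<^sup>2))"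
    proof (rule prod_mono)
      fix i
      define x where "x = 2 * (real i * r) * (1 - cos t) / (1 - real i * r)\<^sup>2"
      have "0 \<le> x" unfolding x_def using r by simp
      then have "exp (- x) \<le> 1 / (1 + x)"
        using exp_ge_add_one_self[of x] by (simp add: exp_minus field_simps del: exp_ge_add_one_self)
      then show "0 \<le> exp (- (2 * (real i * r) * (1 - cos t) / (1 - real i * r)\<^sup>2)) \<and>
        exp (- (2 * (real i * r) * (1 - cos t) / (1 - real i * r)\<^sup>2)) \<le> 1 / (1 + 2 * (real i * r) * (1 - cos t) / (1 - real i * r)\<^sup>2)"
        by (simp add: x_def)
    qed
    finally show ?thesis using True by (simp add: norm_fseries_mode_prob indicator_def abs_le_iff)
  next
    case False
    then show ?thesis by (auto simp: indicator_def abs_le_iff)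
  qed
  have "exp (- 1) * (2 * s) = integral\<^sup>L circ (\<lambda>t. exp (- 1) * indicator {- s..s} t)"
  proof -
    have "integral\<^sup>L circ (indicator {- s..s} :: real \<Rightarrow> real) = measure circ {- s..s}"
      using spi by (subst Bochner_Integration.integral_indicator) (simp add: Int_absorb2)
    also have "\<dots> = measure lborel {- s..s}"
      unfolding circ_def by (rule measure_restrict_space) (use spi in auto)
    finally show ?thesis using s by simp
  qed
  also have "\<dots> \<le> integral\<^sup>L circ (\<lambda>t. (norm (?F t))\<^sup>2)"
  proof (rule Bochner_Integration.integral_mono)
    show "integrable circ (\<lambda>t. exp (- 1) * indicator {- s..s} t :: real)"
      by (rule circ.integrable_const_bound[where B = "exp (- 1)"]) (auto intro!: measurable_circI simp: indicator_def)
    show "integrable circ (\<lambda>t. (norm (?F t))\<^sup>2)"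
    proof (rule integrable_circ[where B = "(\<Sum>k. \<bar>mode_prob k\<bar>)\<^sup>2"])
      show "continuous_on UNIV (\<lambda>t. (norm (?F t))\<^sup>2)" by (intro continuous_intros continuous_fseries sm)
      show "norm ((norm (?F t))\<^sup>2) \<le> (\<Sum>k. \<bar>mode_prob k\<bar>)\<^sup>2" for t
        using norm_fseries_le[OF sm, of t] by (simp add: power_mono)
    qed
  qed (rule F_ge)
  also have "\<dots> = 2 * pi * (\<Sum>k. (mode_prob k)\<^sup>2)" by (rule parseval(2)[OF sm])
  also have "(\<Sum>k. (mode_prob k)\<^sup>2) \<le> (\<Sum>k. mode_prob (m - n) * mode_prob k)"
  proof (rule suminf_le)
    show "(mode_prob k)\<^sup>2 \<le> mode_prob (m - n) * mode_prob k" for k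
      using mult_right_mono[OF mode_prob_le mode_prob_nonneg] by (simp add: power2_eq_square)
  qed (use parseval(1)[OF sm] mode_prob_sums in \<open>auto intro!: summable_mult simp: sums_iff\<close>)
  also have "\<dots> = mode_prob (m - n)" using mode_prob_sums by (subst suminf_mult) (simp_all add: sums_iff)
  finally have "exp (- 1) * s \<le> pi * mode_prob (m - n)" by simp
  then have "1 \<le> exp 1 * (pi * mode_prob (m - n)) / s"
    using s by (simp add: exp_minus field_simps)
  also have "\<dots> = exp 1 * pi * (sqrt V * mode_prob (m - n))" by (simp add: s_def)
  also have "\<dots> \<le> (3 * 4) * (sqrt V * mode_prob (m - n))"
    using exp_le pi_less_4 V mode_prob_nonneg by (intro mult_right_mono mult_mono mult_nonneg_nonneg) auto
  finally show ?thesis by (simp add: V_def mult_ac)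
qed

text \<open>Only the \<open>J\<close> factors with i > n - J are kept. For them 1 - i r <= w and i r
  >= n r / 2, so each is at most 1 / (1+u) <= exp (-u/2) with u = (n r / 2) y / w^2 <= 1.\<close>

lemma norm_fseries_mode_prob_le:
  fixes J :: nat and w y t :: real
  assumes J: "2 * J \<le> n" "real J * r + (1 - real n * r) \<le> w"
    and y: "0 \<le> y" "y \<le> 2 * (1 - cos t)" "real n * r / 2 * y \<le> w\<^sup>2"
  shows "norm (fseries mode_prob t) \<le> exp (- (real J * (real n * r / 2 * y / w\<^sup>2) / 4))"
proof -
  have r: "0 < r" by (rule stir_ratio_pos)
  have w: "0 < w" using J(2) stir_ratio_less r by (smt (verit) mult_nonneg_nonneg of_nat_0_le_iff)
  define u where "u = real n * r / 2 * y / w\<^sup>2"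
  have u: "0 \<le> u" "u \<le> 1" using y r w by (simp_all add: u_def divide_le_eq)
  have "(norm (fseries mode_prob t))\<^sup>2 \<le> (\<Prod>i=1..n. if n - J < i then exp (- u / 2) else 1)"
    unfolding norm_fseries_mode_prob
  proof (rule prod_mono)
    fix i assume i: "i \<in> {1..n}"
    define x where "x = 2 * (real i * r) * (1 - cos t) / (1 - real i * r)\<^sup>2"
    have x0: "0 \<le> x" unfolding x_def using r by simp
    have "1 / (1 + x) \<le> (if n - J < i then exp (- u / 2) else 1)"
    proof (cases "n - J < i")
      case True
      have pos: "0 < 1 - real i * r" using i by (intro factor_pos) simp
      have "real n - real i \<le> real J" using True i by linarith
      then have "(real n - real i) * r \<le> real J * r" using r by (intro mult_right_mono) auto
      then have le_w: "1 - real i * r \<le> w" using J(2) by (simp add: algebra_simps)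
      have "real n \<le> 2 * real i" using True J(1) by linarith
      then have ir: "real n * r / 2 \<le> real i * r" using r by simp
      have "u \<le> real i * r * (2 * (1 - cos t)) / (1 - real i * r)\<^sup>2"
        unfolding u_def using ir y r pos le_w
        by (intro frac_le mult_mono power_mono) auto
      then have ux: "u \<le> x" by (simp add: x_def mult_ac)
      have "exp (u / 2) \<le> 1 + u / 2 + (u / 2)\<^sup>2" using u by (intro exp_bound) auto
      also have "\<dots> \<le> 1 + u" using u mult_left_mono[of u 1 u] by (simp add: power2_eq_square)
      finally have "exp (u / 2) \<le> 1 + x" using ux by simp
      then have "1 / (1 + x) \<le> 1 / exp (u / 2)" using x0 by (intro divide_left_mono) auto
      then show ?thesis using True by (simp add: exp_minus field_simps)
    qed (use x0 in auto)
    then show "0 \<le> 1 / (1 + 2 * (real i * r) * (1 - cos t) / (1 - real i * r)\<^sup>2) \<and>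
      1 / (1 + 2 * (real i * r) * (1 - cos t) / (1 - real i * r)\<^sup>2) \<le> (if n - J < i then exp (- u / 2) else 1)"
      using x0 by (simp add: x_def)
  qed
  also have "\<dots> = (\<Prod>i\<in>{n - J<..n}. exp (- u / 2))"
    by (rule prod.mono_neutral_cong_right) auto
  also have "\<dots> = exp (- u / 2) ^ J" using J(1) by simp
  also have "\<dots> = (exp (- (real J * u / 4)))\<^sup>2"
    by (simp add: exp_of_nat_mult[symmetric] exp_double[symmetric] flip: exp_add) 
  finally show ?thesis
    unfolding u_def by (rule power2_le_imp_le) simp
qed

end

lemma prod_one_minus_bounds:
  fixes u :: real
  assumes u: "0 \<le> u" "real m * u \<le> 1 / 2"
  shows "(\<Prod>i<m. 1 - real i * u) \<le> exp (- (real m ^ 2 * u / 2) + real m * u / 2)"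
    and "exp (- (real m ^ 2 * u / 2) - 2 * real m ^ 3 * u\<^sup>2) \<le> (\<Prod>i<m. 1 - real i * u)"
    and "(\<Prod>i<m. 1 + real i * u) \<le> exp (real m ^ 2 * u / 2)"
proof -
  have i: "0 \<le> real i * u" "real i * u \<le> 1 / 2" if "i < m" for i
    using mult_right_mono[of "real i" "real m" u] u that by simp_all
  have s: "(\<Sum>i<m. real i) = real m ^ 2 / 2 - real m / 2"
    by (induction m) (simp_all add: power2_eq_square field_simps)
  have s_le: "(\<Sum>i<m. real i) \<le> real m ^ 2 / 2" unfolding s by simp
  have "(\<Prod>i<m. 1 - real i * u) \<le> (\<Prod>i<m. exp (- (real i * u)))"
  proof (rule prod_mono)
    fix j assume "j \<in> {..<m}"
    then show "0 \<le> 1 - real j * u \<and> 1 - real j * u \<le> exp (- (real j * u))"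
      using i[of j] exp_ge_add_one_self[of "- (real j * u)"] by (simp del: exp_ge_add_one_self)
  qed
  also have "\<dots> = exp (- ((\<Sum>i<m. real i) * u))"
    by (simp add: exp_sum[symmetric] sum_negf sum_distrib_right)
  also have "\<dots> = exp (- (real m ^ 2 * u / 2) + real m * u / 2)" unfolding s by (simp add: algebra_simps)
  finally show "(\<Prod>i<m. 1 - real i * u) \<le> exp (- (real m ^ 2 * u / 2) + real m * u / 2)" .
  have "(\<Prod>i<m. 1 + real i * u) \<le> (\<Prod>i<m. exp (real i * u))"
    using u by (intro prod_mono) simp
  also have "\<dots> = exp ((\<Sum>i<m. real i) * u)" by (simp add: exp_sum[symmetric] sum_distrib_right)
  also have "\<dots> \<le> exp (real m ^ 2 * u / 2)" using mult_right_mono[OF s_le u(1)] by simp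
  finally show "(\<Prod>i<m. 1 + real i * u) \<le> exp (real m ^ 2 * u / 2)" .
  have s2: "(\<Sum>i<m. (real i)\<^sup>2) \<le> real m ^ 3"
  proof -
    have "(\<Sum>i<m. (real i)\<^sup>2) \<le> (\<Sum>i<m. real m ^ 2)" by (intro sum_mono power_mono) auto
    then show ?thesis by (simp add: power2_eq_square power3_eq_cube)
  qed
  have "- (real m ^ 2 * u / 2) - 2 * real m ^ 3 * u\<^sup>2 \<le> - ((\<Sum>i<m. real i) * u) - 2 * (\<Sum>i<m. (real i)\<^sup>2) * u\<^sup>2"
    using mult_right_mono[OF s_le u(1)] mult_right_mono[OF s2, of "2 * u\<^sup>2"] by (simp add: mult_ac)
  also have "\<dots> = (\<Sum>i<m. - (real i * u) - 2 * (real i * u)\<^sup>2)"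
    by (simp add: sum_subtractf sum_negf sum_distrib_right sum_distrib_left power_mult_distrib mult_ac)
  finally have "exp (- (real m ^ 2 * u / 2) - 2 * real m ^ 3 * u\<^sup>2) \<le> (\<Prod>i<m. exp (- (real i * u) - 2 * (real i * u)\<^sup>2))"
    by (simp add: exp_sum[symmetric])
  also have "\<dots> \<le> (\<Prod>i<m. 1 - real i * u)"
  proof (rule prod_mono)
    fix j assume "j \<in> {..<m}"
    then have j: "0 \<le> real j * u" "real j * u \<le> 1 / 2" using i[of j] by simp_all
    then have "- (real j * u) - 2 * (real j * u)\<^sup>2 \<le> ln (1 - real j * u)"
      by (rule ln_one_minus_pos_lower_bound)
    then have "exp (- (real j * u) - 2 * (real j * u)\<^sup>2) \<le> exp (ln (1 - real j * u))" by simp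
    also have "\<dots> = 1 - real j * u" using j by (subst exp_ln) auto
    finally show "0 \<le> exp (- (real j * u) - 2 * (real j * u)\<^sup>2) \<and>
      exp (- (real j * u) - 2 * (real j * u)\<^sup>2) \<le> 1 - real j * u" by simp
  qed
  finally show "exp (- (real m ^ 2 * u / 2) - 2 * real m ^ 3 * u\<^sup>2) \<le> (\<Prod>i<m. 1 - real i * u)" .
qed

section \<open>Uniform estimates\<close>

text \<open>The two error terms of \<open>simple_ratio_estimate\<close>, divided by the main
  product. In the first, the stretched exponential beats exp (8 ln^2 x), which bounds the quotient
  of the products with plus and minus signs.\<close>

definition window_error :: "real \<Rightarrow> real" where
  "window_error x = 576 * (x powr (12/5) + 4 * ln x * x powr (11/5)) * exp (8 * (ln x)\<^sup>2) * exp (- (x powr (1/10) / (9216 * ln x))) +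
     96 * (ln x)\<^sup>2 * (x powr (-9/10) * (1 + x powr (2/5)) + 2 * x powr (-9/10) * sqrt (4 * x * ln x))"

lemma window_error_tendsto: "(\<lambda>n. window_error (real n)) \<longlonglongrightarrow> 0"
  unfolding window_error_def by real_asymp

text \<open>
  Here \<open>simple_ratio_estimate\<close> is applied with the cut-off \<open>\<delta>\<^sup>2 = (\<tau> + n\<^bsup>-4/5\<^esup>) n\<^bsup>-9/10\<^esup>\<close>: the
  Fourier series has width \<open>(\<tau> / n)\<^bsup>1/2\<^esup>\<close> if \<open>\<tau>\<close> is large compared with \<open>1 / n\<close>, and width
  \<open>\<tau>\<close> with a slowly decaying tail otherwise.
\<close>

lemma simple_prob_window:
  fixes n m :: nat and r \<tau> x :: real
  defines "r \<equiv> stir_ratio n m" and "x \<equiv> real n"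
  defines "\<tau> \<equiv> 1 - x * r"
  assumes nm: "n < m" and x3: "3 \<le> x"
    and r_ge: "1 / (4 * ln x) \<le> x * r" and \<tau>_ge: "x powr (-6/5) \<le> \<tau>" and mr_le: "real m * r \<le> 2 * ln x"
    and big: "8 \<le> x powr (1/5)" "4 * ln x \<le> x" "8 * sqrt (2 * x powr (-9/10)) * (ln x)\<^sup>2 \<le> 1"
  shows "\<bar>simple_prob n m / (\<Prod>i<m. 1 - real i * r\<^sup>2) - 1\<bar> \<le> window_error x"
proof -
  have n2: "2 \<le> n" using x3 by (simp add: x_def)
  have lnx: "1 \<le> ln x"
  proof -
    have "exp 1 \<le> x" using exp_le x3 by linarith
    then show ?thesis using x3 by (simp add: ln_ge_iff)
  qed
  have r0: "0 < r" unfolding r_def by (rule stir_ratio_pos[OF n2 nm])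
  have xr: "x * r < 1" unfolding r_def x_def by (rule stir_ratio_less[OF n2 nm])
  have \<tau>0: "0 < \<tau>" "\<tau> \<le> 1" using xr r0 x3 by (simp_all add: \<tau>_def)
  define p where "p = mode_prob n m (m - n)"
  have p0: "0 < p" unfolding p_def by (rule mode_prob_mode_pos[OF n2 nm])
  define V where "V = 1 / \<tau>\<^sup>2 + 1 / (r * \<tau>)"
  have V0: "0 < V" unfolding V_def using \<tau>0 r0 by (simp add: add_pos_pos)
  have "1 \<le> 12 * sqrt V * p"
    using mode_prob_mode_ge[OF n2 nm] by (simp add: V_def p_def \<tau>_def r_def x_def)
  then have pV1: "1 / p \<le> 12 * sqrt V" using p0 by (simp add: field_simps)
  have pV2: "1 / p\<^sup>2 \<le> 144 * V"
  proof -
    have "(1 / p)\<^sup>2 \<le> (12 * sqrt V)\<^sup>2" using pV1 p0 by (intro power_mono) auto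
    then show ?thesis using V0 by (simp add: power_divide power_mult_distrib)
  qed
  \<comment> \<open>A floor for the scale \<tau>, which may be as small as x^(-6/5). The exponent
    exceeds -1, so that x T grows and the number J of useful factors is positive; it is at most
    -3/5, so that T <= sqrt \<tau>.\<close>
  define T where "T = x powr (-4/5)"
  define \<tau>' where "\<tau>' = \<tau> + T"
  \<comment> \<open>The exponent exceeds -1, so that x q, which drives the decay in the far range,
    grows; and it is at most -4/5, so that q <= T.\<close>
  define q where "q = x powr (-9/10)"
  define \<delta> where "\<delta> = sqrt (\<tau>' * q)"
  define \<eta> where "\<eta> = exp (- (x powr (1/10) / (9216 * ln x)))"
  have T: "0 < T" "T \<le> 1" using x3 powr_mono[of "-4/5" 0 x] by (simp_all add: T_def)
  have q: "0 < q" "q \<le> T" unfolding q_def T_def using x3 by (simp_all add: powr_mono)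
  have \<tau>': "0 < \<tau>'" "\<tau>' \<le> 2" "T \<le> \<tau>'" "\<tau> \<le> \<tau>'" using T \<tau>0 by (simp_all add: \<tau>'_def)
  have \<delta>2: "\<delta>\<^sup>2 = \<tau>' * q" using \<tau>' q by (simp add: \<delta>_def)
  have \<delta>0: "0 < \<delta>" using \<tau>' q by (simp add: \<delta>_def)
  have \<delta>_ln: "8 * \<delta> * (ln x)\<^sup>2 \<le> 1"
  proof -
    have "\<delta> \<le> sqrt (2 * q)" unfolding \<delta>_def using \<tau>' q by (intro real_sqrt_le_mono mult_right_mono) auto
    then have "8 * \<delta> * (ln x)\<^sup>2 \<le> 8 * sqrt (2 * q) * (ln x)\<^sup>2" by (intro mult_right_mono) auto
    then show ?thesis using big(3) by (simp add: q_def)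
  qed
  have "8 * \<delta> * 1 \<le> 8 * \<delta> * (ln x)\<^sup>2" using \<delta>0 lnx by (intro mult_left_mono one_le_power) auto
  then have \<delta>pi: "\<delta> \<le> pi" using \<delta>_ln pi_ge_two by linarith
  have r1: "r \<le> 1 / x" using xr x3 by (simp add: field_simps)
  have mr2: "real m * r\<^sup>2 \<le> 1 / 2"
  proof -
    have "real m * r\<^sup>2 = (real m * r) * r" by (simp add: power2_eq_square)
    also have "\<dots> \<le> (2 * ln x) * (1 / x)" by (rule mult_mono[OF mr_le r1]) (use r0 lnx in auto)
    also have "\<dots> \<le> 1 / 2" using big(2) x3 by (simp add: field_simps)
    finally show ?thesis .
  qed
  define mr where "mr = real m * r"
  have mr: "0 < mr" "mr\<^sup>2 \<le> 4 * (ln x)\<^sup>2"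
  proof -
    show "0 < mr" using r0 nm by (simp add: mr_def)
    then have "mr\<^sup>2 \<le> (2 * ln x)\<^sup>2" using mr_le by (intro power_mono) (auto simp: mr_def)
    then show "mr\<^sup>2 \<le> 4 * (ln x)\<^sup>2" by (simp add: power_mult_distrib)
  qed
  define \<Phi> where "\<Phi> = (\<Prod>i<m. 1 - real i * r\<^sup>2)"
  define E where "E = (\<Prod>i<m. 1 + real i * r\<^sup>2)"
  have E: "E \<le> exp (2 * (ln x)\<^sup>2)"
  proof -
    have "E \<le> exp (real m ^ 2 * r\<^sup>2 / 2)"
      unfolding E_def by (rule prod_one_minus_bounds(3)[OF _ mr2]) simp
    also have "real m ^ 2 * r\<^sup>2 / 2 \<le> 2 * (ln x)\<^sup>2" using mr(2) by (simp add: mr_def power_mult_distrib)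
    finally show ?thesis by simp
  qed
  have \<Phi>: "exp (- (6 * (ln x)\<^sup>2)) \<le> \<Phi>"
  proof -
    have "exp (- (real m ^ 2 * r\<^sup>2 / 2) - 2 * real m ^ 3 * (r\<^sup>2)\<^sup>2) \<le> \<Phi>"
      unfolding \<Phi>_def by (rule prod_one_minus_bounds(2)[OF _ mr2]) simp
    moreover have "2 * real m ^ 3 * (r\<^sup>2)\<^sup>2 \<le> mr\<^sup>2"
    proof -
      have "2 * real m ^ 3 * (r\<^sup>2)\<^sup>2 = 2 * (mr\<^sup>2 * (real m * r\<^sup>2))"
        by (simp add: mr_def power2_eq_square power3_eq_cube)
      also have "\<dots> \<le> 2 * (mr\<^sup>2 * (1 / 2))" using mr2 by (intro mult_left_mono) auto
      finally show ?thesis by simp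
    qed
    moreover have "real m ^ 2 * r\<^sup>2 = mr\<^sup>2" by (simp add: mr_def power_mult_distrib)
    ultimately have "- (6 * (ln x)\<^sup>2) \<le> - (real m ^ 2 * r\<^sup>2 / 2) - 2 * real m ^ 3 * (r\<^sup>2)\<^sup>2"
      using mr(2) by simp
    then have "exp (- (6 * (ln x)\<^sup>2)) \<le> exp (- (real m ^ 2 * r\<^sup>2 / 2) - 2 * real m ^ 3 * (r\<^sup>2)\<^sup>2)" by simp
    then show ?thesis using \<open>exp (- (real m ^ 2 * r\<^sup>2 / 2) - 2 * real m ^ 3 * (r\<^sup>2)\<^sup>2) \<le> \<Phi>\<close> by linarith
  qed
  have \<Phi>0: "0 < \<Phi>" using \<Phi> by (rule less_le_trans[rotated]) simp
  have far: "norm (fseries (mode_prob n m) t) \<le> \<eta>" if t: "\<delta> \<le> \<bar>t\<bar>" "\<bar>t\<bar> \<le> pi" for t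
  proof -
    \<comment> \<open>About x \<tau>'/4 factors: then J r < \<tau>'/4, so all these factors satisfy
      1 - i r <= 2 \<tau>'. The value of \<tau>' cancels from the resulting exponent.\<close>
    define J where "J = nat \<lfloor>x * \<tau>' / 4\<rfloor>"
    have J: "real J \<le> x * \<tau>' / 4" "x * \<tau>' / 4 - 1 \<le> real J"
      using x3 \<tau>' unfolding J_def by (simp_all add: of_nat_floor) linarith
    have "x powr (1/5) = x * T" unfolding T_def using x3 by (simp add: powr_mult_base)
    moreover have "x * T \<le> x * \<tau>'" using \<tau>'(3) x3 by (intro mult_left_mono) auto
    ultimately have "8 \<le> x * \<tau>'" using big(1) by linarith
    then have J8: "x * \<tau>' / 8 \<le> real J" using J(2) by simp
    have J1: "2 * J \<le> n"
    proof -
      have "x * \<tau>' \<le> x * 2" using \<tau>'(2) x3 by (intro mult_left_mono) auto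
      then have "2 * real J \<le> real n" using J(1) unfolding x_def[symmetric] by linarith
      then show ?thesis by linarith
    qed
    have J2: "real J * r + \<tau> \<le> 2 * \<tau>'"
    proof -
      have "real J * r \<le> (x * \<tau>' / 4) * r" using J(1) r0 by (intro mult_right_mono) auto
      also have "\<dots> = (x * r) * (\<tau>' / 4)" by simp
      also have "\<dots> \<le> 1 * (\<tau>' / 4)" using xr \<tau>' by (intro mult_right_mono) auto
      finally show ?thesis using \<tau>' by simp
    qed
    define y where "y = \<delta>\<^sup>2 / 9"
    have y0: "0 \<le> y" by (simp add: y_def)
    have y1: "y \<le> 2 * (1 - cos t)"
    proof -
      have "\<delta>\<^sup>2 \<le> \<bar>t\<bar>\<^sup>2" using t \<delta>0 by (intro power_mono) auto
      then show ?thesis using one_minus_cos_ge[OF t(2)] by (simp add: y_def)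
    qed
    have y2: "x * r / 2 * y \<le> (2 * \<tau>')\<^sup>2"
    proof -
      have "x * r / 2 * y \<le> 1 * y" using xr y0 by (intro mult_right_mono) auto
      also have "\<dots> \<le> \<tau>' * \<tau>'" unfolding y_def \<delta>2 using q \<tau>' mult_left_mono[of q \<tau>' \<tau>'] by simp
      also have "\<dots> \<le> (2 * \<tau>')\<^sup>2" by (simp add: power2_eq_square)
      finally show ?thesis .
    qed
    have "norm (fseries (mode_prob n m) t) \<le> exp (- (real J * (x * r / 2 * y / (2 * \<tau>')\<^sup>2) / 4))"
      using norm_fseries_mode_prob_le[OF n2 nm J1 _ y0 y1, of "2 * \<tau>'"] J2 y2
      by (simp add: r_def x_def \<tau>_def)
    also have "\<dots> \<le> \<eta>"
    proof -
      have "x powr (1/10) = x * q" unfolding q_def using x3 by (simp add: powr_mult_base)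
      \<comment> \<open>2304 = 8 * 2 * 9 * 4 * 4, from J >= x \<tau>'/8, n r / 2, y = \<delta>^2/9
        (written with the square in ASCII), w = 2 \<tau>' and the final quarter; the lower bound 1 /
        (4 ln x) for x r turns it into 9216.\<close>
      then have "x powr (1/10) / (9216 * ln x) = (1 / (4 * ln x)) * (x * q) / 2304" by simp
      also have "\<dots> \<le> (x * r) * (x * q) / 2304"
        using r_ge x3 q by (intro divide_right_mono mult_right_mono) auto
      also have "\<dots> = (x * \<tau>' / 8) * (x * r / 2 * y / (2 * \<tau>')\<^sup>2) / 4"
        using \<tau>'(1) unfolding y_def \<delta>2 by (simp add: power2_eq_square)
      also have "\<dots> \<le> real J * (x * r / 2 * y / (2 * \<tau>')\<^sup>2) / 4"
        using J8 y0 r0 x3 by (intro divide_right_mono mult_right_mono) auto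
      finally show ?thesis by (simp add: \<eta>_def)
    qed
    finally show ?thesis .
  qed
  have main: "\<bar>simple_prob n m - \<Phi>\<bar> \<le> 4 * \<eta> * E / p\<^sup>2 + (exp (2 * \<delta> * real m ^ 2 * r\<^sup>2) - 1) * \<Phi> * \<delta> / (pi * p)"
    unfolding simple_prob_eq_mode_prob[OF n2 nm] \<Phi>_def E_def p_def r_def
    by (rule simple_ratio_estimate)
      (use mode_prob_nonneg[OF n2 nm] mode_prob_sums[OF n2 nm] mode_prob_le[OF n2 nm] mode_prob_mode_pos[OF n2 nm]
        mr2 \<delta>0 \<delta>pi far in \<open>auto simp: r_def\<close>)
  have term1: "4 * \<eta> * E / p\<^sup>2 / \<Phi> \<le>
     576 * (x powr (12/5) + 4 * ln x * x powr (11/5)) * exp (8 * (ln x)\<^sup>2) * \<eta>"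
  proof -
    have inv: "1 / \<tau> \<le> x powr (6/5)"
    proof -
      have "1 / \<tau> \<le> 1 / x powr (-6/5)" using \<tau>_ge \<tau>0 x3 by (intro divide_left_mono mult_pos_pos) auto
      then show ?thesis using x3 by (simp add: powr_minus_divide)
    qed
    have inv_r: "1 / r \<le> 4 * x * ln x" using r_ge r0 lnx by (simp add: field_simps)
    have "V = (1 / \<tau>)\<^sup>2 + (1 / r) * (1 / \<tau>)" by (simp add: V_def power_divide)
    also have "\<dots> \<le> (x powr (6/5))\<^sup>2 + (4 * x * ln x) * x powr (6/5)"
      using inv inv_r \<tau>0 r0 x3 lnx by (intro add_mono power_mono mult_mono) auto
    also have "(x powr (6/5))\<^sup>2 = x powr (12/5)" using x3 by (simp add: power2_eq_square flip: powr_add)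
    also have "(4 * x * ln x) * x powr (6/5) = 4 * ln x * x powr (11/5)"
      using x3 powr_mult_base[of x "6/5"] by (simp add: mult_ac)
    finally have V: "V \<le> x powr (12/5) + 4 * ln x * x powr (11/5)" .
    have "E / \<Phi> \<le> exp (2 * (ln x)\<^sup>2) / exp (- (6 * (ln x)\<^sup>2))"
      using E \<Phi> by (intro frac_le) auto
    also have "\<dots> = exp (8 * (ln x)\<^sup>2)" by (simp flip: exp_diff)
    finally have E\<Phi>: "E / \<Phi> \<le> exp (8 * (ln x)\<^sup>2)" .
    have E0: "0 \<le> E" unfolding E_def by (intro prod_nonneg) simp
    have "4 * \<eta> * E / p\<^sup>2 / \<Phi> = 4 * \<eta> * ((1 / p\<^sup>2) * (E / \<Phi>))" by simp
    also have "\<dots> \<le> 4 * \<eta> * ((144 * (x powr (12/5) + 4 * ln x * x powr (11/5))) * exp (8 * (ln x)\<^sup>2))"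
      using pV2 V E\<Phi> E0 \<Phi>0 V0 lnx by (intro mult_left_mono mult_mono) (auto simp: \<eta>_def)
    finally show ?thesis by (simp add: algebra_simps)
  qed
  have term2: "(exp (2 * \<delta> * real m ^ 2 * r\<^sup>2) - 1) * \<Phi> * \<delta> / (pi * p) / \<Phi> \<le>
     96 * (ln x)\<^sup>2 * (q * (1 + x powr (2/5)) + 2 * q * sqrt (4 * x * ln x))"
  proof -
    define z where "z = 2 * \<delta> * real m ^ 2 * r\<^sup>2"
    have z_eq: "z = 2 * \<delta> * mr\<^sup>2" by (simp add: z_def mr_def power_mult_distrib)
    have z_le: "z \<le> 8 * \<delta> * (ln x)\<^sup>2"
      unfolding z_eq using mult_left_mono[OF mr(2), of "2 * \<delta>"] \<delta>0 by simp
    have z0: "0 \<le> z" unfolding z_eq using \<delta>0 by simp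
    have "exp z \<le> 1 + z + z\<^sup>2" using z_le \<delta>_ln z0 by (intro exp_bound) auto
    also have "z\<^sup>2 \<le> z" using z_le \<delta>_ln z0 mult_left_mono[of z 1 z] by (simp add: power2_eq_square)
    finally have ez: "exp z - 1 \<le> 16 * \<delta> * (ln x)\<^sup>2" using z_le by simp
    have ez0: "0 \<le> exp z - 1" using z0 by simp
    have "(exp z - 1) * \<Phi> * \<delta> / (pi * p) / \<Phi> = (exp z - 1) * \<delta> * (1 / p) * (1 / pi)"
      using \<Phi>0 by simp
    also have "\<dots> \<le> (16 * \<delta> * (ln x)\<^sup>2) * \<delta> * (12 * sqrt V) * (1 / 2)"
      using ez ez0 \<delta>0 pV1 p0 V0 pi_ge_two by (intro mult_mono divide_left_mono mult_nonneg_nonneg) auto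
    also have "\<dots> = 96 * (ln x)\<^sup>2 * (\<delta>\<^sup>2 * sqrt V)" by (simp add: power2_eq_square)
    also have "\<dots> \<le> 96 * (ln x)\<^sup>2 * (q * (1 + x powr (2/5)) + 2 * q * sqrt (4 * x * ln x))"
    proof (intro mult_left_mono)
      have "sqrt V \<le> sqrt (1 / \<tau>\<^sup>2) + sqrt (1 / (r * \<tau>))"
        unfolding V_def using \<tau>0 r0 by (intro sqrt_add_le_add_sqrt) auto
      also have "sqrt (1 / \<tau>\<^sup>2) = 1 / \<tau>" using \<tau>0 by (simp add: real_sqrt_divide)
      also have "sqrt (1 / (r * \<tau>)) \<le> sqrt (4 * x * ln x) / sqrt \<tau>"
      proof -
        have "1 / r \<le> 4 * x * ln x" using r_ge r0 lnx by (simp add: field_simps)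
        then have "(1 / r) / \<tau> \<le> (4 * x * ln x) / \<tau>" using \<tau>0 by (intro divide_right_mono) auto
        then show ?thesis by (simp flip: real_sqrt_divide)
      qed
      finally have "\<delta>\<^sup>2 * sqrt V \<le> (\<tau>' * q) * (1 / \<tau> + sqrt (4 * x * ln x) / sqrt \<tau>)"
        unfolding \<delta>2 using \<tau>' q by (intro mult_left_mono) auto
      also have "\<dots> = q * (\<tau>' / \<tau>) + (\<tau>' / sqrt \<tau>) * q * sqrt (4 * x * ln x)"
        by (simp add: distrib_left mult_ac)
      \<comment> \<open>The two cases of small and large \<tau> meet here: T/\<tau> <= x^(-4/5 +
        6/5), whereas \<tau>'/sqrt \<tau> stays bounded.\<close>
      also have "\<dots> \<le> q * (1 + x powr (2/5)) + 2 * q * sqrt (4 * x * ln x)"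
      proof (intro add_mono mult_left_mono mult_right_mono)
        have "T / \<tau> \<le> T / x powr (-6/5)" using \<tau>_ge \<tau>0 x3 T by (intro divide_left_mono mult_pos_pos) auto
        also have "\<dots> = x powr (2/5)" unfolding T_def by (simp flip: powr_diff)
        finally show "\<tau>' / \<tau> \<le> 1 + x powr (2/5)" using \<tau>0 by (simp add: \<tau>'_def add_divide_distrib)
        have "x powr (-3/5) = sqrt (x powr (-6/5))" using x3 by (simp add: powr_half_sqrt[symmetric] powr_powr)
        also have "\<dots> \<le> sqrt \<tau>" using \<tau>_ge by simp
        finally have st: "x powr (-3/5) \<le> sqrt \<tau>" .
        have "T / sqrt \<tau> \<le> T / x powr (-3/5)" using st x3 T \<tau>0 by (intro divide_left_mono mult_pos_pos) auto
        also have "\<dots> = x powr (-1/5)" unfolding T_def by (simp flip: powr_diff)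
        also have "\<dots> \<le> x powr 0" using x3 by (intro powr_mono) auto
        finally have "T / sqrt \<tau> \<le> 1" using x3 by simp
        moreover have "\<tau> / sqrt \<tau> \<le> 1" using \<tau>0 by (simp add: real_div_sqrt)
        ultimately show "\<tau>' / sqrt \<tau> \<le> 2" by (simp add: \<tau>'_def add_divide_distrib)
      qed (use q x3 lnx in auto)
      finally show "\<delta>\<^sup>2 * sqrt V \<le> q * (1 + x powr (2/5)) + 2 * q * sqrt (4 * x * ln x)" .
    qed simp
    finally show ?thesis by (simp add: z_def)
  qed
  have "\<bar>simple_prob n m / \<Phi> - 1\<bar> = \<bar>simple_prob n m - \<Phi>\<bar> / \<Phi>"
  proof -
    have "simple_prob n m / \<Phi> - 1 = (simple_prob n m - \<Phi>) / \<Phi>" using \<Phi>0 by (simp add: diff_divide_distrib)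
    then show ?thesis using \<Phi>0 by (simp add: abs_divide)
  qed
  also have "\<dots> \<le> (4 * \<eta> * E / p\<^sup>2 + (exp (2 * \<delta> * real m ^ 2 * r\<^sup>2) - 1) * \<Phi> * \<delta> / (pi * p)) / \<Phi>"
    using main \<Phi>0 by (intro divide_right_mono) auto
  also have "\<dots> \<le> window_error x"
    unfolding add_divide_distrib window_error_def q_def[symmetric] \<eta>_def[symmetric]
    using term1 term2 by (rule add_mono)
  finally show ?thesis by (simp add: \<Phi>_def)
qed

section \<open>The parameter lambda as a function of c, and uniform surjection counts\<close>

lemma exp_ratio_increment:
  fixes a b :: real
  assumes "0 < a" "a \<le> b"
  shows "(b - a) / 2 \<le> b * exp b / (exp b - 1) - a * exp a / (exp a - 1)"
proof -
  \<comment> \<open>The derivative of x e^x / (e^x - 1) is at least 1/2, by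
    \<open>exp_minus_one_squared_le\<close>. Consequently lambda is increasing and 2-Lipschitz in
    c.\<close>
  define f where "f = (\<lambda>x::real. x * exp x / (exp x - 1) - x / 2)"
  have "f a \<le> f b"
  proof (rule DERIV_nonneg_imp_nondecreasing[where f = f])
    fix x assume "a \<le> x" "x \<le> b"
    then have x: "0 < x" using assms by simp
    then have e: "0 < exp x - 1" by simp
    have "(f has_real_derivative exp x * (exp x - 1 - x) / (exp x - 1)\<^sup>2 - 1 / 2) (at x)"
      unfolding f_def using e
      by (auto intro!: derivative_eq_intros simp: power2_eq_square algebra_simps)
    moreover have "1 / 2 \<le> exp x * (exp x - 1 - x) / (exp x - 1)\<^sup>2"
      using exp_minus_one_squared_le[of x] x e by (simp add: field_simps)
    ultimately show "\<exists>y. (f has_real_derivative y) (at x) \<and> 0 \<le> y" by (intro exI conjI) auto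
  qed (use assms in auto)
  then show ?thesis by (simp add: f_def diff_divide_distrib)
qed

text \<open>Yields lambda <= 2 (c - 1), by which a lower bound on lambda becomes one on the excess m
  - n.\<close>

lemma exp_ratio_ge:
  fixes l :: real
  assumes "0 < l"
  shows "1 + l / 2 \<le> l * exp l / (exp l - 1)"
proof -
  define f where "f = (\<lambda>x::real. x * exp x - 2 * exp x + 2 + x)"
  have "f 0 \<le> f l"
  proof (rule DERIV_nonneg_imp_nondecreasing[where f = f])
    fix x :: real assume "0 \<le> x" "x \<le> l"
    have "(f has_real_derivative x * exp x - exp x + 1) (at x)"
      unfolding f_def by (auto intro!: derivative_eq_intros simp: algebra_simps)
    moreover have "0 \<le> x * exp x - exp x + 1"
    proof -
      have "(1 - x) * exp x \<le> exp (- x) * exp x"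
        using exp_ge_add_one_self[of "- x"] by (intro mult_right_mono) auto
      then show ?thesis by (simp add: algebra_simps flip: exp_add)
    qed
    ultimately show "\<exists>y. (f has_real_derivative y) (at x) \<and> 0 \<le> y" by blast
  qed (use assms in auto)
  then have "0 \<le> l * exp l - 2 * exp l + 2 + l" by (simp add: f_def)
  then show ?thesis using assms by (simp add: field_simps)
qed

lemma lambda_param:
  assumes "1 < c"
  shows "0 < lambda_param c" "c = lambda_param c * exp (lambda_param c) / (exp (lambda_param c) - 1)"
  using theI'[OF lambda_param_ex1[OF assms]] by (auto simp: lambda_param_def)

lemma lambda_param_bounds:
  assumes "1 < c"
  shows "c - 1 \<le> lambda_param c" "lambda_param c \<le> c" "lambda_param c \<le> 2 * (c - 1)"
  using exp_ratio_bounds[OF lambda_param(1)[OF assms]] exp_ratio_ge[OF lambda_param(1)[OF assms]]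
  unfolding lambda_param(2)[OF assms, symmetric] by simp_all

lemma lambda_param_mono:
  assumes "1 < c" "c \<le> d"
  shows "lambda_param c \<le> lambda_param d" "lambda_param d \<le> lambda_param c + 2 * (d - c)"
proof -
  note c = lambda_param[OF assms(1)] and d = lambda_param[OF less_le_trans[OF assms]]
  show le: "lambda_param c \<le> lambda_param d"
  proof (rule ccontr)
    assume "\<not> ?thesis"
    then have "lambda_param d < lambda_param c" by simp
    then show False
      using exp_ratio_increment[OF d(1), of "lambda_param c"] c(2) d(2) assms by (simp add: field_simps)
  qed
  show "lambda_param d \<le> lambda_param c + 2 * (d - c)"
    using exp_ratio_increment[OF c(1) le] c(2) d(2) by (simp add: field_simps)
qed

text \<open>The logarithm of the right-hand side has derivative (n/x) (c(x) - c(l)) with c(x) = x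
  e^x / (e^x - 1) increasing, so \<open>l\<close> is its global minimum. This allows saddle points
  of different \<open>m\<close> to be exchanged without expansions.\<close>

lemma saddle_point_min:
  fixes l x :: real
  assumes "0 < l" "0 < x" and m: "real m = real n * (l * exp l / (exp l - 1))"
  shows "(exp l - 1) ^ n / l ^ m \<le> (exp x - 1) ^ n / x ^ m"
proof -
  define f where "f = (\<lambda>x::real. real n * ln (exp x - 1) - real m * ln x)"
  have der: "(f has_real_derivative real n / y * (y * exp y / (exp y - 1) - l * exp l / (exp l - 1))) (at y)" if "0 < y" for y
  proof -
    have "(f has_real_derivative real n * (exp y / (exp y - 1)) - real m * (1 / y)) (at y)"
      unfolding f_def using that by (auto intro!: derivative_eq_intros)
    moreover have "real n * (exp y / (exp y - 1)) - real m * (1 / y) =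
      real n / y * (y * exp y / (exp y - 1) - l * exp l / (exp l - 1))"
    proof -
      have "a * w - (a * Q) * (1 / y) = a / y * (y * w - Q)" for a w Q :: real
        using that by (simp add: right_diff_distrib)
      from this[of "real n" "exp y / (exp y - 1)" "l * exp l / (exp l - 1)"] show ?thesis
        unfolding m times_divide_eq_right[of y] .
    qed
    ultimately show ?thesis by simp
  qed
  have "f l \<le> f x"
  proof (cases "l \<le> x")
    case True
    show ?thesis
    proof (rule DERIV_nonneg_imp_nondecreasing[OF True, where f = f])
      fix y assume y: "l \<le> y" "y \<le> x"
      have y0: "0 < y" using y assms(1) by simp
      have "0 \<le> y * exp y / (exp y - 1) - l * exp l / (exp l - 1)"
        by (rule order_trans[OF _ exp_ratio_increment[OF assms(1) y(1)]]) (use y(1) in simp)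
      then have "0 \<le> real n / y * (y * exp y / (exp y - 1) - l * exp l / (exp l - 1))"
        using y0 by (intro mult_nonneg_nonneg) simp_all
      then show "\<exists>d. (f has_real_derivative d) (at y) \<and> 0 \<le> d" using der[OF y0] by blast
    qed
  next
    case False
    then have "x \<le> l" by simp
    then show ?thesis
    proof (rule DERIV_nonpos_imp_nonincreasing[where f = f])
      fix y assume y: "x \<le> y" "y \<le> l"
      have y0: "0 < y" using y assms(2) by simp
      have "0 \<le> l * exp l / (exp l - 1) - y * exp y / (exp y - 1)"
        by (rule order_trans[OF _ exp_ratio_increment[OF y0 y(2)]]) (use y(2) in simp)
      then have "y * exp y / (exp y - 1) - l * exp l / (exp l - 1) \<le> 0"
        by (simp only: diff_ge_0_iff_ge diff_le_0_iff_le)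
      then have "real n / y * (y * exp y / (exp y - 1) - l * exp l / (exp l - 1)) \<le> 0"
        using y0 by (intro mult_nonneg_nonpos) simp_all
      then show "\<exists>d. (f has_real_derivative d) (at y) \<and> d \<le> 0" using der[OF y0] by blast
    qed
  qed
  moreover have "exp (f y) = (exp y - 1) ^ n / y ^ m" if "0 < y" for y
    using that unfolding f_def by (simp add: exp_diff exp_of_nat_mult)
  ultimately show ?thesis using assms(1,2) exp_le_cancel_iff[of "f l" "f x"] by simp
qed

definition surj_normalized :: "nat \<Rightarrow> nat \<Rightarrow> real" where
  "surj_normalized n m = (let c = real m / real n; l = lambda_param c in
     surj_count n m * l ^ m / (fact m * (exp l - 1) ^ n) * sqrt (2 * pi * real n * (c * (1 + l - c))))"

text \<open>The hypothesis of \<open>surj_count_asymp\<close> follows from n lambda >= m - n, which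
  handles small lambda, and from lambda <= m/n = O(log n). The sequence is shifted by
  \<open>n0\<close> so that the eventual facts hold at every index.\<close>

lemma surj_normalized_tendsto:
  fixes m :: "nat \<Rightarrow> nat"
  assumes O: "(\<lambda>n. real (m n)) \<in> O(\<lambda>n. real n * ln (real n))"
    and lim: "filterlim (\<lambda>n. real (m n) - real n) at_top at_top"
  shows "(\<lambda>n. surj_normalized n (m n)) \<longlonglongrightarrow> 1"
proof -
  obtain A where A: "0 < A" "\<forall>\<^sub>F n in at_top. norm (real (m n)) \<le> A * norm (real n * ln (real n))"
    using O by (auto elim: landau_o.bigE)
  have "\<forall>\<^sub>F n in sequentially. 2 \<le> n \<and> n < m n \<and> real (m n) \<le> A * (real n * ln (real n))"
    using A(2) lim[unfolded filterlim_at_top, rule_format, of 1] eventually_ge_at_top[of 2]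
    by eventually_elim (auto simp: abs_mult)
  then obtain n0 where n0: "\<And>n. n0 \<le> n \<Longrightarrow> 2 \<le> n \<and> n < m n \<and> real (m n) \<le> A * (real n * ln (real n))"
    by (auto simp: eventually_sequentially)
  define N where "N = (\<lambda>k. k + n0)"
  define M where "M = (\<lambda>k. m (k + n0))"
  define C where "C = (\<lambda>k. real (M k) / real (N k))"
  define L where "L = (\<lambda>k. lambda_param (C k))"
  have N: "2 \<le> N k" "N k < M k" "real (M k) \<le> A * (real (N k) * ln (real (N k)))" for k
    using n0[of "k + n0"] by (simp_all add: N_def M_def)
  have C1: "1 < C k" for k using N[of k] by (simp add: C_def)
  have bound: "(1 + L k) ^ 4 / (real (N k) * L k) \<le> 16 / (real (M k) - real (N k)) + 16 * (A * ln (real (N k))) ^ 3 / real (N k)" for k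
  proof -
    have L0: "0 < L k" unfolding L_def by (rule lambda_param(1)[OF C1])
    have NL: "real (M k) - real (N k) \<le> real (N k) * L k"
    proof -
      have "real (M k) - real (N k) = real (N k) * (C k - 1)"
        using N(1)[of k] by (simp add: C_def right_diff_distrib)
      also have "\<dots> \<le> real (N k) * L k"
        unfolding L_def by (intro mult_left_mono lambda_param_bounds C1) simp
      finally show ?thesis .
    qed
    have Lc: "L k \<le> A * ln (real (N k))"
    proof -
      have "L k \<le> C k" unfolding L_def by (intro lambda_param_bounds C1)
      also have "\<dots> \<le> A * ln (real (N k))" using N[of k] by (simp add: C_def field_simps)
      finally show ?thesis .
    qed
    have "(1 + L k) ^ 4 \<le> 16 + 16 * L k ^ 4"
    proof (cases "L k \<le> 1")
      case True
      then have "(1 + L k) ^ 4 \<le> 2 ^ 4" using L0 by (intro power_mono) auto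
      then show ?thesis using L0 by (simp add: add_increasing2)
    next
      case False
      then have "(1 + L k) ^ 4 \<le> (2 * L k) ^ 4" by (intro power_mono) auto
      then show ?thesis by (simp add: power_mult_distrib)
    qed
    then have "(1 + L k) ^ 4 / (real (N k) * L k) \<le> (16 + 16 * L k ^ 4) / (real (N k) * L k)"
      using L0 by (intro divide_right_mono) auto
    also have "\<dots> = 16 / (real (N k) * L k) + 16 * L k ^ 3 / real (N k)"
      using L0 by (simp add: add_divide_distrib eval_nat_numeral)
    also have "\<dots> \<le> 16 / (real (M k) - real (N k)) + 16 * (A * ln (real (N k))) ^ 3 / real (N k)"
      using NL Lc L0 N(2)[of k]
      by (intro add_mono divide_left_mono divide_right_mono mult_left_mono power_mono) auto
    finally show ?thesis .
  qed
  have "(\<lambda>n. 16 / (real (m n) - real n) + 16 * (A * ln (real n)) ^ 3 / real n) \<longlonglongrightarrow> 0 + 0"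
  proof (rule tendsto_add)
    show "(\<lambda>n. 16 / (real (m n) - real n)) \<longlonglongrightarrow> 0"
      by (rule tendsto_divide_0[OF tendsto_const filterlim_at_top_imp_at_infinity[OF lim]])
    show "(\<lambda>n. 16 * (A * ln (real n)) ^ 3 / real n) \<longlonglongrightarrow> 0"
      using A(1) by real_asymp
  qed
  from LIMSEQ_ignore_initial_segment[OF this, of n0]
  have bl: "(\<lambda>k. 16 / (real (M k) - real (N k)) + 16 * (A * ln (real (N k))) ^ 3 / real (N k)) \<longlonglongrightarrow> 0"
    by (simp only: M_def N_def add_0)
  have "(\<lambda>k. (1 + L k) ^ 4 / (real (N k) * L k)) \<longlonglongrightarrow> 0"
  proof (rule tendsto_sandwich[OF _ _ tendsto_const bl])
    show "\<forall>\<^sub>F k in sequentially. 0 \<le> (1 + L k) ^ 4 / (real (N k) * L k)"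
      using lambda_param(1)[OF C1] by (intro always_eventually allI) (simp add: L_def less_imp_le)
  qed (use bound in auto)
  then have "(\<lambda>k. surj_count (N k) (M k) * L k ^ M k / (fact (M k) * (exp (L k) - 1) ^ N k) *
    sqrt (2 * pi * real (N k) * (C k * (1 + L k - C k)))) \<longlonglongrightarrow> 1"
  proof (rule surj_count_asymp[rotated -1])
    fix k
    show "0 < L k" unfolding L_def by (rule lambda_param(1)[OF C1])
    show "C k = L k * exp (L k) / (exp (L k) - 1)" unfolding L_def by (rule lambda_param(2)[OF C1])
    show "0 < N k" using N(1)[of k] by simp
    show "real (M k) = real (N k) * C k" using N(1)[of k] by (simp add: C_def)
  qed
  then have "(\<lambda>k. surj_normalized (k + n0) (m (k + n0))) \<longlonglongrightarrow> 1"
    by (simp add: surj_normalized_def Let_def L_def C_def N_def M_def)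
  then show ?thesis by (rule LIMSEQ_offset)
qed

section \<open>Locating m * stir_ratio by comparing distant values of m\<close>

lemma fact_power_bounds:
  assumes "m1 \<le> m2"
  shows "fact m1 * real m1 ^ (m2 - m1) \<le> fact m2" "fact m2 \<le> fact m1 * real m2 ^ (m2 - m1)"
proof -
  have "(fact m1 * real m1 ^ k \<le> fact (m1 + k)) \<and> (fact (m1 + k) \<le> fact m1 * real (m1 + k) ^ k)" for k
  proof (induction k)
    case (Suc k)
    have "fact m1 * real m1 ^ Suc k = real m1 * (fact m1 * real m1 ^ k)" by simp
    also have "\<dots> \<le> real (Suc (m1 + k)) * fact (m1 + k)" using Suc by (intro mult_mono) auto
    finally have 1: "fact m1 * real m1 ^ Suc k \<le> fact (m1 + Suc k)" by simp
    have "real (m1 + k) ^ k \<le> real (m1 + Suc k) ^ k" by (intro power_mono) auto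
    then have "fact m1 * real (m1 + k) ^ k \<le> fact m1 * real (m1 + Suc k) ^ k"
      by (intro mult_left_mono) auto
    then have "fact (m1 + k) \<le> fact m1 * real (m1 + Suc k) ^ k"
      using Suc by linarith
    then have "real (m1 + Suc k) * fact (m1 + k) \<le> real (m1 + Suc k) * (fact m1 * real (m1 + Suc k) ^ k)"
      by (intro mult_left_mono) auto
    then show ?case using 1 by (simp add: mult_ac)
  qed simp
  from this[of "m2 - m1"] assms
  show "fact m1 * real m1 ^ (m2 - m1) \<le> fact m2" "fact m2 \<le> fact m1 * real m2 ^ (m2 - m1)" by simp_all
qed

text \<open>Each saddle value is estimated by evaluating at the saddle point of the other
  \<open>m\<close>, using minimality. The constants are 8 = 2 * 4 and 4 = 2 * 2: a factor 2 from the
  normalised counts, times the square root of the quotient of variances. They are harmless, since a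
  root of order m2 - m1 is taken later.\<close>

lemma surj_count_ratio:
  fixes n m1 m2 :: nat
  defines "l1 \<equiv> lambda_param (real m1 / real n)" and "l2 \<equiv> lambda_param (real m2 / real n)"
  assumes n: "1 \<le> n" "n < m1" "m1 \<le> m2"
    and Z: "surj_normalized n m1 \<le> 2 * surj_normalized n m2" "surj_normalized n m2 \<le> 2 * surj_normalized n m1"
  shows "l2 \<le> 4 * l1 \<Longrightarrow> real m1 ^ (m2 - m1) * surj_count n m1 \<le> 8 * l2 ^ (m2 - m1) * surj_count n m2"
    and "l1 ^ (m2 - m1) * surj_count n m2 \<le> 4 * real m2 ^ (m2 - m1) * surj_count n m1"
proof -
  define K where "K = m2 - m1"
  have mK: "m2 = m1 + K" using n by (simp add: K_def)
  define F where "F = (\<lambda>m l. (exp l - 1) ^ n / l ^ m :: real)"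
  define v where "v = (\<lambda>m l. (real m / real n) * (1 + l - real m / real n))"
  have c: "1 < real m1 / real n" "real m1 / real n \<le> real m2 / real n"
    using n by (simp_all add: divide_right_mono)
  then have c2: "1 < real m2 / real n" by linarith
  have l1: "0 < l1" "real m1 / real n = l1 * exp l1 / (exp l1 - 1)"
    unfolding l1_def using lambda_param[OF c(1)] by simp_all
  have l2: "0 < l2" "real m2 / real n = l2 * exp l2 / (exp l2 - 1)"
    unfolding l2_def using lambda_param[OF c2] by simp_all
  have l12: "l1 \<le> l2" unfolding l1_def l2_def by (rule lambda_param_mono[OF c])
  have v1: "l1 / 2 \<le> v m1 l1" "v m1 l1 \<le> 2 * l1" unfolding v_def by (rule variance_bounds[OF l1])+
  have v2: "l2 / 2 \<le> v m2 l2" "v m2 l2 \<le> 2 * l2" unfolding v_def by (rule variance_bounds[OF l2])+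
  have F1: "0 < F m1 l1" and F2: "0 < F m2 l2" using l1 l2 by (simp_all add: F_def)
  define Z1 where "Z1 = surj_normalized n m1"
  define Z2 where "Z2 = surj_normalized n m2"
  have gen: "s * q = s * p / (f * e) * q * f * (e / p)" if "0 < p" "0 < e" "0 < f" for s q p f e :: real
    using that by simp
  have s1: "surj_count n m1 * sqrt (2 * pi * real n * v m1 l1) = Z1 * fact m1 * F m1 l1"
    unfolding Z1_def surj_normalized_def Let_def F_def v_def l1_def[symmetric]
    by (rule gen) (use l1(1) in auto)
  have s2: "surj_count n m2 * sqrt (2 * pi * real n * v m2 l2) = Z2 * fact m2 * F m2 l2"
    unfolding Z2_def surj_normalized_def Let_def F_def v_def l2_def[symmetric]
    by (rule gen) (use l2(1) in auto)
  have "real m1 = real n * (l1 * exp l1 / (exp l1 - 1))" using l1(2) n by (simp add: field_simps)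
  then have "F m1 l1 \<le> F m1 l2" unfolding F_def by (intro saddle_point_min l1(1) l2(1))
  also have "\<dots> = F m2 l2 * l2 ^ K" using l2(1) by (simp add: F_def mK power_add)
  finally have FF1: "F m1 l1 \<le> F m2 l2 * l2 ^ K" .
  have "real m2 = real n * (l2 * exp l2 / (exp l2 - 1))" using l2(2) n by (simp add: field_simps)
  then have "F m2 l2 \<le> F m2 l1" unfolding F_def by (intro saddle_point_min l1(1) l2(1))
  then have "l1 ^ K * F m2 l2 \<le> l1 ^ K * F m2 l1" using l1(1) by (intro mult_left_mono) auto
  also have "\<dots> = F m1 l1" using l1(1) by (simp add: F_def mK power_add)
  finally have FF2: "l1 ^ K * F m2 l2 \<le> F m1 l1" .
  have sc: "0 < surj_count n m1" "0 < surj_count n m2"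
    using Stirling_pos[of n m1] Stirling_pos[of n m2] n by (simp_all add: surj_count_def)
  have q: "0 < sqrt (2 * pi * real n * v m1 l1)" "0 < sqrt (2 * pi * real n * v m2 l2)"
    using v1(1) v2(1) l1(1) l2(1) n by simp_all
  have Z0: "0 < Z1" "0 < Z2"
  proof -
    have "0 < Z1 * fact m1 * F m1 l1" unfolding s1[symmetric] using sc q by simp
    then show "0 < Z1" using F1 by (simp add: zero_less_mult_iff)
    have "0 < Z2 * fact m2 * F m2 l2" unfolding s2[symmetric] using sc q by simp
    then show "0 < Z2" using F2 by (simp add: zero_less_mult_iff)
  qed
  have ZZ: "Z1 \<le> 2 * Z2" "Z2 \<le> 2 * Z1" using Z by (simp_all add: Z1_def Z2_def)
  show "real m1 ^ (m2 - m1) * surj_count n m1 \<le> 8 * l2 ^ (m2 - m1) * surj_count n m2" if le: "l2 \<le> 4 * l1"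
  proof -
    have "sqrt (2 * pi * real n * v m2 l2) \<le> sqrt (16 * (2 * pi * real n * v m1 l1))"
    proof (rule real_sqrt_le_mono)
      have "v m2 l2 \<le> 16 * v m1 l1" using v1(1) v2(2) le by linarith
      then have "(2 * pi * real n) * v m2 l2 \<le> (2 * pi * real n) * (16 * v m1 l1)" by (intro mult_left_mono) auto
      then show "2 * pi * real n * v m2 l2 \<le> 16 * (2 * pi * real n * v m1 l1)" by simp
    qed
    also have "\<dots> = 4 * sqrt (2 * pi * real n * v m1 l1)" by (simp only: real_sqrt_mult) simp
    finally have sq: "sqrt (2 * pi * real n * v m2 l2) \<le> 4 * sqrt (2 * pi * real n * v m1 l1)" .
    have "real m1 ^ K * surj_count n m1 * sqrt (2 * pi * real n * v m1 l1) = Z1 * (fact m1 * real m1 ^ K) * F m1 l1"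
      using s1 by (simp add: mult_ac)
    also have "\<dots> \<le> (2 * Z2) * fact m2 * (F m2 l2 * l2 ^ K)"
      using ZZ Z0 F1 FF1 fact_power_bounds(1)[OF n(3)] unfolding K_def[symmetric]
      by (intro mult_mono) auto
    also have "\<dots> = 2 * l2 ^ K * (surj_count n m2 * sqrt (2 * pi * real n * v m2 l2))"
      unfolding s2 by simp
    also have "\<dots> \<le> 2 * l2 ^ K * (surj_count n m2 * (4 * sqrt (2 * pi * real n * v m1 l1)))"
      using sq sc l2(1) by (intro mult_left_mono) auto
    finally have "(real m1 ^ K * surj_count n m1) * sqrt (2 * pi * real n * v m1 l1) \<le>
        (8 * l2 ^ K * surj_count n m2) * sqrt (2 * pi * real n * v m1 l1)" by (simp add: mult_ac)
    then show ?thesis using q(1) by (simp add: K_def mult_le_cancel_right)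
  qed
  show "l1 ^ (m2 - m1) * surj_count n m2 \<le> 4 * real m2 ^ (m2 - m1) * surj_count n m1"
  proof -
    have "sqrt (2 * pi * real n * v m1 l1) \<le> sqrt (4 * (2 * pi * real n * v m2 l2))"
    proof (rule real_sqrt_le_mono)
      have "v m1 l1 \<le> 4 * v m2 l2" using v1(2) v2(1) l12 by linarith
      then have "(2 * pi * real n) * v m1 l1 \<le> (2 * pi * real n) * (4 * v m2 l2)" by (intro mult_left_mono) auto
      then show "2 * pi * real n * v m1 l1 \<le> 4 * (2 * pi * real n * v m2 l2)" by simp
    qed
    also have "\<dots> = 2 * sqrt (2 * pi * real n * v m2 l2)" by (simp only: real_sqrt_mult) simp
    finally have sq: "sqrt (2 * pi * real n * v m1 l1) \<le> 2 * sqrt (2 * pi * real n * v m2 l2)" .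
    have "l1 ^ K * surj_count n m2 * sqrt (2 * pi * real n * v m2 l2) = Z2 * fact m2 * (l1 ^ K * F m2 l2)"
      using s2 by (simp add: mult_ac)
    also have "\<dots> \<le> (2 * Z1) * (fact m1 * real m2 ^ K) * F m1 l1"
      using ZZ Z0 F1 F2 FF2 l1(1) fact_power_bounds(2)[OF n(3)] unfolding K_def[symmetric]
      by (intro mult_mono) auto
    also have "\<dots> = 2 * real m2 ^ K * (surj_count n m1 * sqrt (2 * pi * real n * v m1 l1))"
      unfolding s1 by simp
    also have "\<dots> \<le> 2 * real m2 ^ K * (surj_count n m1 * (2 * sqrt (2 * pi * real n * v m2 l2)))"
      using sq sc by (intro mult_left_mono) auto
    finally have "(l1 ^ K * surj_count n m2) * sqrt (2 * pi * real n * v m2 l2) \<le>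
        (4 * real m2 ^ K * surj_count n m1) * sqrt (2 * pi * real n * v m2 l2)" by (simp add: mult_ac)
    then show ?thesis using q(2) by (simp add: K_def mult_le_cancel_right)
  qed
qed

text \<open>Log-concavity gives r^K S(m+K,n) <= S(m,n) and S(m-K,n) <= r^K S(m,n). As
  \<open>m\<close> is the smaller index in the first comparison and the larger one in the second,
  the quotient of factorials contributes the same power m^K both times, which combines with
  r^K.\<close>

lemma stir_ratio_power_bounds:
  fixes n m K :: nat
  defines "x \<equiv> real m * stir_ratio n m"
  assumes n: "2 \<le> n" and nm: "n < m"
  shows "surj_normalized n m \<le> 2 * surj_normalized n (m + K) \<Longrightarrow> surj_normalized n (m + K) \<le> 2 * surj_normalized n m \<Longrightarrow>
      lambda_param (real (m + K) / real n) \<le> 4 * lambda_param (real m / real n) \<Longrightarrow>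
      x ^ K \<le> 8 * lambda_param (real (m + K) / real n) ^ K"
    and "n < m - K \<Longrightarrow> surj_normalized n m \<le> 2 * surj_normalized n (m - K) \<Longrightarrow> surj_normalized n (m - K) \<le> 2 * surj_normalized n m \<Longrightarrow>
      lambda_param (real (m - K) / real n) ^ K \<le> 4 * x ^ K"
proof -
  let ?l2 = "lambda_param (real (m + K) / real n)"
  assume Z: "surj_normalized n m \<le> 2 * surj_normalized n (m + K)" "surj_normalized n (m + K) \<le> 2 * surj_normalized n m"
    and le: "?l2 \<le> 4 * lambda_param (real m / real n)"
  have S: "0 < real (Stirling (m + K) n)" using Stirling_pos[of n "m + K"] n nm by simp
  have "real m ^ (m + K - m) * surj_count n m \<le> 8 * ?l2 ^ (m + K - m) * surj_count n (m + K)"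
    using n nm by (intro surj_count_ratio(1) Z le) auto
  then have 1: "real m ^ K * real (Stirling m n) \<le> 8 * ?l2 ^ K * real (Stirling (m + K) n)"
    by (simp add: surj_count_def)
  have "x ^ K * real (Stirling (m + K) n) = real m ^ K * (stir_ratio n m ^ K * real (Stirling (m + K) n))"
    by (simp add: x_def power_mult_distrib)
  also have "\<dots> \<le> real m ^ K * real (Stirling m n)" by (intro mult_left_mono Stirling_plus_le n nm) simp
  also have "\<dots> \<le> 8 * ?l2 ^ K * real (Stirling (m + K) n)" by (rule 1)
  finally show "x ^ K \<le> 8 * ?l2 ^ K" using S by (simp add: mult_le_cancel_right)
next
  let ?l1 = "lambda_param (real (m - K) / real n)"
  assume mK: "n < m - K" and Z: "surj_normalized n m \<le> 2 * surj_normalized n (m - K)" "surj_normalized n (m - K) \<le> 2 * surj_normalized n m"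
  have S: "0 < real (Stirling m n)" using Stirling_pos[of n m] n nm by simp
  have "?l1 ^ (m - (m - K)) * surj_count n m \<le> 4 * real m ^ (m - (m - K)) * surj_count n (m - K)"
    using n mK by (intro surj_count_ratio(2) Z) auto
  moreover have "m - (m - K) = K" using mK by simp
  ultimately have "?l1 ^ K * real (Stirling m n) \<le> 4 * real m ^ K * real (Stirling (m - K) n)"
    by (simp add: surj_count_def)
  also have "\<dots> \<le> 4 * real m ^ K * (stir_ratio n m ^ K * real (Stirling m n))"
    using mK by (intro mult_left_mono Stirling_minus_le n nm) auto
  also have "\<dots> = (4 * x ^ K) * real (Stirling m n)" by (simp add: x_def power_mult_distrib)
  finally show "?l1 ^ K \<le> 4 * x ^ K" using S by (simp add: mult_le_cancel_right)
qed

text \<open>8 <= e^3, so the constant costs a factor e^(3/K) after the K-th root.\<close>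

lemma power_le_exp:
  fixes x y :: real
  assumes "x ^ K \<le> 8 * y ^ K" "0 < K" "0 \<le> y"
  shows "x \<le> exp (3 / real K) * y"
proof (rule power_le_imp_le_base[of _ "K - 1"])
  have "(2::real) ^ 3 \<le> exp 1 ^ 3" using exp_ge_add_one_self[of 1] by (intro power_mono) auto
  then have "(8::real) \<le> exp 3" by (simp add: exp_of_nat_mult[symmetric])
  then have "x ^ K \<le> exp 3 * y ^ K" using assms(1) mult_right_mono[of 8 "exp 3" "y ^ K"] assms(3) by simp
  also have "exp 3 = exp (3 / real K) ^ K" using assms(2) by (simp add: exp_of_nat_mult[symmetric])
  finally show "x ^ Suc (K - 1) \<le> (exp (3 / real K) * y) ^ Suc (K - 1)"
    using assms(2) by (simp add: power_mult_distrib)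
qed (use assms in simp)

text \<open>The logarithm of the product is -m^2 u / 2 up to m u / 2, as the sum of the i < m is
  m^2/2 - m/2, and up to the quadratic Taylor terms 2 m^3 u^2. Deviations below 1 are absorbed by 1
  - e^(-w) <= e^w - 1.\<close>

lemma prod_exp_near_one:
  fixes u s B :: real
  assumes u: "0 \<le> u" "real m * u \<le> 1 / 2" and B: "\<bar>real m ^ 2 * u - s\<bar> \<le> B"
  shows "\<bar>(\<Prod>i<m. 1 - real i * u) * exp (s / 2) - 1\<bar> \<le>
    exp (2 * (real m ^ 2 * u) * (real m * u) + real m * u + B / 2) - 1"
proof -
  define w where "w = 2 * (real m ^ 2 * u) * (real m * u) + real m * u + B / 2"
  have mu: "0 \<le> real m * u" "0 \<le> 2 * (real m ^ 2 * u) * (real m * u)" using u by simp_all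
  have B0: "0 \<le> B" using B by linarith
  have eq: "2 * real m ^ 3 * u\<^sup>2 = 2 * (real m ^ 2 * u) * (real m * u)"
    by (simp add: power2_eq_square power3_eq_cube)
  have le: "(\<Prod>i<m. 1 - real i * u) * exp (s / 2) \<le> exp w"
  proof -
    have "(\<Prod>i<m. 1 - real i * u) * exp (s / 2) \<le> exp (- (real m ^ 2 * u / 2) + real m * u / 2) * exp (s / 2)"
      by (intro mult_right_mono prod_one_minus_bounds u) simp
    also have "\<dots> = exp (- (real m ^ 2 * u / 2) + real m * u / 2 + s / 2)" by (simp add: exp_add)
    also have "\<dots> \<le> exp w"
    proof -
      have "- (real m ^ 2 * u / 2) + real m * u / 2 + s / 2 \<le> w"
        unfolding w_def using B mu by linarith
      then show ?thesis by simp
    qed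
    finally show ?thesis .
  qed
  have ge: "exp (- w) \<le> (\<Prod>i<m. 1 - real i * u) * exp (s / 2)"
  proof -
    have "exp (- w) \<le> exp (- (real m ^ 2 * u / 2) - 2 * real m ^ 3 * u\<^sup>2 + s / 2)"
    proof -
      have "- w \<le> - (real m ^ 2 * u / 2) - 2 * real m ^ 3 * u\<^sup>2 + s / 2"
        unfolding w_def eq using B mu by linarith
      then show ?thesis by simp
    qed
    also have "\<dots> = exp (- (real m ^ 2 * u / 2) - 2 * real m ^ 3 * u\<^sup>2) * exp (s / 2)" by (simp add: exp_add)
    also have "\<dots> \<le> (\<Prod>i<m. 1 - real i * u) * exp (s / 2)"
      by (intro mult_right_mono prod_one_minus_bounds u) simp
    finally show ?thesis .
  qed
  have "1 - exp (- w) \<le> exp w - 1"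
    using exp_ge_add_one_self[of w] exp_ge_add_one_self[of "- w"] by linarith
  then show ?thesis using le ge by (simp add: w_def[symmetric] abs_le_iff)
qed

lemma mult_near_one:
  fixes a b \<alpha> \<beta> :: real
  assumes "\<bar>a - 1\<bar> \<le> \<alpha>" "\<bar>b - 1\<bar> \<le> \<beta>"
  shows "\<bar>a * b - 1\<bar> \<le> \<alpha> * (1 + \<beta>) + \<beta>"
proof -
  have "\<bar>a * b - 1\<bar> = \<bar>(a - 1) * b + (b - 1)\<bar>" by (simp add: algebra_simps)
  also have "\<dots> \<le> \<bar>a - 1\<bar> * \<bar>b\<bar> + \<bar>b - 1\<bar>" by (metis abs_mult abs_triangle_ineq)
  also have "\<dots> \<le> \<alpha> * (1 + \<beta>) + \<beta>"
    using assms by (intro add_mono mult_mono) auto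
  finally show ?thesis .
qed

text \<open>By log-concavity \<open>stir_ratio\<close> grows with m, so the worst case is the
  largest admissible m = Suc M. There the quotient S(M,n-1) / S(M+1,n) is estimated by union bounds
  for surjections and is about (1 - 1/n)^M, roughly n^(-11/10); the exponent -6/5 leaves room for
  the corrections.\<close>

lemma eventually_one_minus_stir_ratio_ge:
  "\<forall>\<^sub>F n in sequentially. \<forall>m. n < m \<and> real m \<le> 11/10 * (real n * ln (real n)) \<longrightarrow>
     real n powr (-6/5) \<le> 1 - real n * stir_ratio n m"
proof -
  have 1: "\<forall>\<^sub>F n in sequentially. real n powr (-6/5) \<le>
      exp (- (11/10 * real n * ln (real n)) * (1 / real n + 2 * (1 / real n)\<^sup>2)) *
      (1 - real n * exp (- (11/10 * (real n * ln (real n)) - 2) / real n))"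
    by real_asymp
  have 2: "\<forall>\<^sub>F n in sequentially. 0 \<le> 1 - real n * exp (- (11/10 * (real n * ln (real n)) - 2) / real n)"
    by real_asymp
  have 3: "\<forall>\<^sub>F n in sequentially. real n + 2 \<le> 11/10 * (real n * ln (real n))" by real_asymp
  have "\<forall>\<^sub>F n in sequentially. 3 \<le> n" by (rule eventually_ge_at_top)
  with 1 2 3 show ?thesis
  proof eventually_elim
    case (elim n)
    show ?case
    proof (intro allI impI, elim conjE)
      fix m assume nm: "n < m" and mle: "real m \<le> 11/10 * (real n * ln (real n))"
      define M where "M = nat \<lfloor>11/10 * (real n * ln (real n))\<rfloor> - 1"
      define y where "y = 11/10 * (real n * ln (real n))"
      have y: "real n + 2 \<le> y" using elim by (simp add: y_def)
      have fl: "real (nat \<lfloor>y\<rfloor>) \<le> y" "y - 1 < real (nat \<lfloor>y\<rfloor>)" using y by linarith+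
      have "M = nat \<lfloor>y\<rfloor> - 1" by (simp only: M_def y_def)
      then have Suc_M: "Suc M = nat \<lfloor>y\<rfloor>" using fl y by linarith
      have mM: "m \<le> Suc M" unfolding Suc_M by (rule le_nat_floor) (use mle in \<open>simp only: y_def\<close>)
      have M: "real M \<le> y" "y - 2 \<le> real M" using fl Suc_M by linarith+
      have n: "2 \<le> n" "n < Suc M" using nm mM elim by simp_all
      have rm: "stir_ratio n m \<le> stir_ratio n (Suc M)"
      proof -
        have "real (Stirling (m - 1) n) \<le> stir_ratio n (Suc M) * real (Stirling m n)"
          by (rule Stirling_ratio_le[OF n]) (use nm mM in auto)
        moreover have "0 < real (Stirling m n)" using Stirling_pos[of n m] n nm by simp
        ultimately show ?thesis by (simp add: stir_ratio_def divide_le_eq)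
      qed
      define a where "a = 1 - 1 / real n"
      have n3: "3 \<le> real n" using elim by simp
      have a: "0 < a" "a < 1" using n3 by (simp_all add: a_def)
      \<comment> \<open>The numerator is bounded below by \<open>fact_Stirling_ge\<close>, the
        denominator above by \<open>fact_Stirling_le\<close>; n - 2 <= n (1 - 1/n)^2 expresses the
        correction through the same power a^M.\<close>
      have top: "a ^ M * (1 - real n * a ^ M) \<le> 1 - real n * stir_ratio n (Suc M)"
      proof -
        have S: "0 < real (Stirling (Suc M) n)" using Stirling_pos[of n "Suc M"] n by simp
        have "real ((n - 1) ^ M) \<le> real (fact (n - 1) * Stirling M (n - 1) + (n - 1) * (n - 1 - 1) ^ M)"
          using fact_Stirling_ge[of "n - 1" M] by (rule of_nat_mono)
        then have lo: "(real n - 1) ^ M - (real n - 1) * (real n - 2) ^ M \<le> fact (n - 1) * real (Stirling M (n - 1))"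
          using n by (simp add: of_nat_diff)
        have "real (fact n * Stirling (Suc M) n) \<le> real (n ^ Suc M)" by (rule of_nat_mono) (rule fact_Stirling_le)
        then have hi: "fact n * real (Stirling (Suc M) n) \<le> real n ^ Suc M" by simp
        have fn: "fact n = real n * fact (n - 1)" using n by (simp add: fact_reduce)
        have pw: "(real n - 1) ^ M = real n ^ M * a ^ M"
          using n3 by (simp add: a_def power_mult_distrib[symmetric] right_diff_distrib)
        have pw2: "(real n - 2) ^ M \<le> real n ^ M * (a ^ M) ^ 2"
        proof -
          have "real n - 2 \<le> real n * a\<^sup>2" using n3 by (simp add: a_def power2_eq_square field_simps)
          then have "(real n - 2) ^ M \<le> (real n * a\<^sup>2) ^ M" using n3 by (intro power_mono) auto
          then show ?thesis by (simp add: power_mult_distrib power_mult[symmetric] mult.commute)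
        qed
        have "real n ^ M * (a ^ M * (1 - real n * a ^ M)) = real n ^ M * a ^ M - real n * (real n ^ M * (a ^ M) ^ 2)"
          by (simp add: algebra_simps power2_eq_square)
        also have "\<dots> \<le> (real n - 1) ^ M - (real n - 1) * (real n - 2) ^ M"
        proof -
          have "(real n - 1) * (real n - 2) ^ M \<le> real n * (real n ^ M * (a ^ M) ^ 2)"
            using pw2 n3 by (intro mult_mono) auto
          then show ?thesis using pw by simp
        qed
        also have "\<dots> \<le> fact (n - 1) * real (Stirling M (n - 1))" by (rule lo)
        finally have *: "real n ^ M * (a ^ M * (1 - real n * a ^ M)) \<le> fact (n - 1) * real (Stirling M (n - 1))" .
        have r_eq: "1 - real n * stir_ratio n (Suc M) = real (Stirling M (n - 1)) / real (Stirling (Suc M) n)"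
          using one_minus_stir_ratio[OF n] by simp
        show ?thesis
        proof (cases "0 \<le> a ^ M * (1 - real n * a ^ M)")
          case True
          have "fact n * real (Stirling (Suc M) n) * (a ^ M * (1 - real n * a ^ M)) \<le> real n ^ Suc M * (a ^ M * (1 - real n * a ^ M))"
            using hi True by (intro mult_right_mono) auto
          also have "\<dots> = real n * (real n ^ M * (a ^ M * (1 - real n * a ^ M)))" by simp
          also have "\<dots> \<le> real n * (fact (n - 1) * real (Stirling M (n - 1)))" using * by (intro mult_left_mono) auto
          also have "\<dots> = fact n * real (Stirling M (n - 1))" using fn by simp
          finally have "real (Stirling (Suc M) n) * (a ^ M * (1 - real n * a ^ M)) \<le> real (Stirling M (n - 1))"
            by (simp add: mult.assoc)
          then show ?thesis unfolding r_eq using S by (simp add: le_divide_eq mult.commute)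
        next
          case False
          then show ?thesis unfolding r_eq using S by (smt (verit) divide_nonneg_nonneg of_nat_0_le_iff)
        qed
      qed
      have up: "a ^ M \<le> exp (- (y - 2) / real n)"
      proof -
        have "a ^ M \<le> exp (- (1 / real n)) ^ M"
          using exp_ge_add_one_self[of "- (1 / real n)"] a by (intro power_mono) (auto simp: a_def)
        also have "\<dots> = exp (- real M / real n)" by (simp add: exp_of_nat_mult[symmetric])
        also have "\<dots> \<le> exp (- (y - 2) / real n)"
          unfolding exp_le_cancel_iff using M by (intro divide_right_mono) auto
        finally show ?thesis .
      qed
      have lo: "exp (- y * (1 / real n + 2 * (1 / real n)\<^sup>2)) \<le> a ^ M"
      proof -
        define w where "w = 1 / real n + 2 * (1 / real n)\<^sup>2"
        have w0: "0 \<le> w" by (simp add: w_def)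
        have "- (1 / real n) - 2 * (1 / real n)\<^sup>2 \<le> ln (1 - 1 / real n)"
          by (rule ln_one_minus_pos_lower_bound) (use n3 in auto)
        then have "exp (- w) \<le> exp (ln a)" by (simp add: w_def a_def)
        then have "exp (- w) ^ M \<le> a ^ M" using a by (intro power_mono) auto
        moreover have "exp (- w) ^ M = exp (- real M * w)" by (simp add: exp_of_nat_mult[symmetric])
        moreover have "exp (- y * w) \<le> exp (- real M * w)" using M(1) w0 by (simp add: mult_right_mono)
        ultimately show ?thesis unfolding w_def by linarith
      qed
      have "real n powr (-6/5) \<le> exp (- y * (1 / real n + 2 * (1 / real n)\<^sup>2)) * (1 - real n * exp (- (y - 2) / real n))"
        using elim(1) by (simp add: y_def mult.assoc)
      also have "\<dots> \<le> a ^ M * (1 - real n * exp (- (y - 2) / real n))"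
        using lo elim(2) by (intro mult_right_mono) (auto simp: y_def)
      also have "\<dots> \<le> a ^ M * (1 - real n * a ^ M)"
        using up a n3 by (intro mult_left_mono diff_left_mono) auto
      finally have "real n powr (-6/5) \<le> a ^ M * (1 - real n * a ^ M)" .
      then show "real n powr (-6/5) \<le> 1 - real n * stir_ratio n m"
        using top rm n3 mult_left_mono[OF rm, of "real n"] by linarith
    qed
  qed
qed

text \<open>
  Comparing \<open>m\<close> with \<open>m \<plusminus> K\<close> determines \<open>stir_ratio\<close> up to a factor \<open>e\<^bsup>\<plusminus>3/K\<^esup>\<close> and a shift of
  \<open>\<lambda>\<close> by \<open>2K/n\<close>; \<open>\<lambda>\<^sup>2\<close> has to be found up to \<open>o(1)\<close> although it may be of order \<open>ln\<^sup>2 n\<close>.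
\<close>

definition smoothing_window :: "(nat \<Rightarrow> nat) \<Rightarrow> nat \<Rightarrow> nat" where
  "smoothing_window m n = min (nat \<lceil>ln (real n) ^ 4\<rceil>) ((m n - n) div 2)"

context
  fixes m :: "nat \<Rightarrow> nat"
  assumes O: "(\<lambda>n. real (m n)) \<in> O(\<lambda>n. real n * ln (real n))"
    and lim: "filterlim (\<lambda>n. real (m n) - real n) at_top at_top"
begin

lemma eventually_gap: "\<forall>\<^sub>F n in sequentially. C \<le> real (m n) - real n"
  using lim by (simp add: filterlim_at_top)

lemma eventually_le_n_ln_n: "\<exists>A>0. \<forall>\<^sub>F n in sequentially. real (m n) \<le> A * (real n * ln (real n))"
proof -
  obtain A where A: "0 < A" "\<forall>\<^sub>F n in at_top. norm (real (m n)) \<le> A * norm (real n * ln (real n))"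
    using O by (auto elim: landau_o.bigE)
  from A(2) eventually_ge_at_top[of 1]
  have "\<forall>\<^sub>F n in sequentially. real (m n) \<le> A * (real n * ln (real n))"
    by eventually_elim (auto simp: abs_mult)
  then show ?thesis using A(1) by blast
qed

text \<open>The local limit theorem is applied along m - K, m and m + K. The bound K <= (m-n)/2
  keeps the excess of m - K over n unbounded and yields 2K/n <= lambda. Normalised counts within 1/4
  of 1 differ by a factor below 2.\<close>

lemma eventually_stir_ratio_bounds:
  "\<forall>\<^sub>F n in sequentially. 2 \<le> n \<and> n < m n \<and> 0 < smoothing_window m n \<and>
     real (m n) * stir_ratio n (m n) \<le> exp (3 / real (smoothing_window m n)) *
       (lambda_param (real (m n) / real n) + 2 * real (smoothing_window m n) / real n) \<and>
     lambda_param (real (m n) / real n) - 2 * real (smoothing_window m n) / real n \<le>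
       exp (3 / real (smoothing_window m n)) * (real (m n) * stir_ratio n (m n)) \<and>
     2 * real (smoothing_window m n) / real n \<le> lambda_param (real (m n) / real n)"
proof -
  let ?K = "smoothing_window m"
  have K_le: "2 * real (?K n) \<le> real (m n) - real n" if "n < m n" for n
  proof -
    have "2 * ?K n \<le> m n - n" by (simp add: smoothing_window_def)
    then show ?thesis using that by linarith
  qed
  have "(\<lambda>n. surj_normalized n (m n + ?K n)) \<longlonglongrightarrow> 1"
  proof (rule surj_normalized_tendsto)
    have "(\<lambda>n. real (m n + ?K n)) \<in> O(\<lambda>n. real (m n))"
    proof (rule bigoI[where c = 2])
      have "\<forall>\<^sub>F n in sequentially. n < m n" using eventually_gap[of 1] by eventually_elim linarith
      then show "\<forall>\<^sub>F n in sequentially. norm (real (m n + ?K n)) \<le> 2 * norm (real (m n))"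
      proof eventually_elim
        case (elim n)
        then show ?case using K_le[of n] by simp
      qed
    qed
    then show "(\<lambda>n. real (m n + ?K n)) \<in> O(\<lambda>n. real n * ln (real n))" by (rule landau_o.big_trans) (rule O)
    show "filterlim (\<lambda>n. real (m n + ?K n) - real n) at_top at_top"
      by (rule filterlim_at_top_mono[OF lim]) simp
  qed
  moreover have "(\<lambda>n. surj_normalized n (m n - ?K n)) \<longlonglongrightarrow> 1"
  proof (rule surj_normalized_tendsto)
    have "(\<lambda>n. real (m n - ?K n)) \<in> O(\<lambda>n. real (m n))"
      by (rule bigoI[where c = 1]) simp
    then show "(\<lambda>n. real (m n - ?K n)) \<in> O(\<lambda>n. real n * ln (real n))" by (rule landau_o.big_trans) (rule O)
    have "filterlim (\<lambda>n. (real (m n) - real n) * (1 / 2)) at_top at_top"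
      by (rule filterlim_at_top_mult_tendsto_pos[OF tendsto_const _ lim]) simp
    moreover have "\<forall>\<^sub>F n in sequentially. n < m n" using eventually_gap[of 1] by eventually_elim linarith
    then have "\<forall>\<^sub>F n in sequentially. (real (m n) - real n) * (1 / 2) \<le> real (m n - ?K n) - real n"
    proof eventually_elim
      case (elim n)
      then show ?case using K_le[OF elim] by (simp add: of_nat_diff)
    qed
    ultimately show "filterlim (\<lambda>n. real (m n - ?K n) - real n) at_top at_top"
      by (rule filterlim_at_top_mono)
  qed
  moreover have "(\<lambda>n. surj_normalized n (m n)) \<longlonglongrightarrow> 1" by (rule surj_normalized_tendsto[OF O lim])
  moreover have "\<forall>\<^sub>F n in sequentially. \<bar>f n - 1\<bar> < 1 / 4" if "f \<longlonglongrightarrow> 1" for f :: "nat \<Rightarrow> real"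
    using tendstoD[OF that, of "1 / 4"] by (simp add: dist_real_def)
  ultimately have Z: "\<forall>\<^sub>F n in sequentially. \<bar>surj_normalized n (m n + ?K n) - 1\<bar> < 1 / 4"
    "\<forall>\<^sub>F n in sequentially. \<bar>surj_normalized n (m n - ?K n) - 1\<bar> < 1 / 4"
    "\<forall>\<^sub>F n in sequentially. \<bar>surj_normalized n (m n) - 1\<bar> < 1 / 4"
    by blast+
  have "\<forall>\<^sub>F n in sequentially. 3 \<le> n" by (rule eventually_ge_at_top)
  with Z eventually_gap[of 2] show ?thesis
  proof eventually_elim
    case (elim n)
    define K where "K = ?K n"
    define c where "c = real (m n) / real n"
    define l where "l = lambda_param c"
    have n: "2 \<le> n" "n < m n" "0 < real n" using elim by linarith+
    have K: "2 * real K \<le> real (m n) - real n" unfolding K_def by (rule K_le[OF n(2)])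
    have K0: "0 < K"
    proof -
      have "0 < ln (real n) ^ 4" using elim by simp
      moreover have "2 \<le> m n - n" using elim by linarith
      ultimately show ?thesis by (simp add: K_def smoothing_window_def div_greater_zero_iff)
    qed
    have c1: "1 < c" using n by (simp add: c_def)
    have Kc: "2 * real K / real n \<le> c - 1" using K n by (simp add: c_def field_simps)
    have Kl: "2 * real K / real n \<le> l" using Kc lambda_param_bounds(1)[OF c1] by (simp add: l_def)
    have p: "lambda_param (real (m n + K) / real n) \<le> l + 2 * real K / real n"
    proof -
      have "lambda_param (real (m n + K) / real n) \<le> l + 2 * (real (m n + K) / real n - c)"
        unfolding l_def by (rule lambda_param_mono[OF c1]) (simp add: c_def divide_right_mono)
      also have "real (m n + K) / real n - c = real K / real n" by (simp add: c_def add_divide_distrib)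
      finally show ?thesis by simp
    qed
    have c1': "1 < real (m n + K) / real n" using n by simp
    have mK: "n < m n - K" "real (m n - K) = real (m n) - real K" using K K0 n by linarith+
    have c1'': "1 < real (m n - K) / real n" using mK n by simp
    have q: "l - 2 * real K / real n \<le> lambda_param (real (m n - K) / real n)"
    proof -
      have "l \<le> lambda_param (real (m n - K) / real n) + 2 * (c - real (m n - K) / real n)"
        unfolding l_def by (rule lambda_param_mono[OF c1'']) (simp add: c_def divide_right_mono)
      also have "c - real (m n - K) / real n = real K / real n" by (simp add: c_def mK(2) diff_divide_distrib)
      finally show ?thesis by simp
    qed
    have l0: "0 < l" unfolding l_def by (rule lambda_param(1)[OF c1])
    have r0: "0 < stir_ratio n (m n)" by (rule stir_ratio_pos[OF n(1,2)])
    define e where "e = exp (3 / real K)"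
    have U: "real (m n) * stir_ratio n (m n) \<le> e * (l + 2 * real K / real n)"
    proof -
      have "(real (m n) * stir_ratio n (m n)) ^ K \<le> 8 * lambda_param (real (m n + K) / real n) ^ K"
        using elim p Kl l0
        by (intro stir_ratio_power_bounds(1) n) (auto simp: K_def[symmetric] l_def[symmetric] c_def[symmetric] abs_if split: if_splits)
      then have "real (m n) * stir_ratio n (m n) \<le> e * lambda_param (real (m n + K) / real n)"
        unfolding e_def by (rule power_le_exp[OF _ K0]) (use lambda_param(1)[OF c1'] in simp)
      also have "\<dots> \<le> e * (l + 2 * real K / real n)" using p by (simp add: e_def)
      finally show ?thesis .
    qed
    have Lo: "l - 2 * real K / real n \<le> e * (real (m n) * stir_ratio n (m n))"
    proof -
      have "lambda_param (real (m n - K) / real n) ^ K \<le> 4 * (real (m n) * stir_ratio n (m n)) ^ K"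
        using elim mK
        by (intro stir_ratio_power_bounds(2) n) (auto simp: K_def[symmetric] abs_if split: if_splits)
      also have "\<dots> \<le> 8 * (real (m n) * stir_ratio n (m n)) ^ K" using r0 by simp
      finally have "lambda_param (real (m n - K) / real n) \<le> e * (real (m n) * stir_ratio n (m n))"
        unfolding e_def by (rule power_le_exp[OF _ K0]) (use r0 in simp)
      then show ?thesis using q by linarith
    qed
    show ?case
      using n K0 U Lo Kl by (simp add: K_def l_def c_def e_def)
  qed
qed

section \<open>The three ranges of m\<close>

definition saddle :: "nat \<Rightarrow> real" where "saddle n = lambda_param (real (m n) / real n)"

text \<open>Here K may be as small as 1, so m r is known only up to a constant factor; this suffices
  because lambda, and hence m r, tends to 0. The form with an explicit null sequence
  \<open>b\<close> is shared by the three ranges, since one sequence m may move between them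
  infinitely often.\<close>

lemma simple_prob_small:
  "\<exists>b. b \<longlonglongrightarrow> 0 \<and> (\<forall>\<^sub>F n in sequentially. saddle n \<le> 1 / ln (real n) \<longrightarrow>
     \<bar>simple_prob n (m n) * exp ((saddle n)\<^sup>2 / 2) - 1\<bar> \<le> b n)"
proof (intro exI conjI)
  \<comment> \<open>54 = 27 * 2: e^(3/K) <= 27 for K >= 1, and lambda + 2K/n <= 2 lambda.\<close>
  define b where "b = (\<lambda>n. (exp ((54 / ln (real n))\<^sup>2) - 1) * exp ((1 / ln (real n))\<^sup>2) + (exp ((1 / ln (real n))\<^sup>2) - 1))"
  show "b \<longlonglongrightarrow> 0" unfolding b_def by real_asymp
  have "\<forall>\<^sub>F n in sequentially. 3 \<le> n" by (rule eventually_ge_at_top)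
  with eventually_stir_ratio_bounds
  show "\<forall>\<^sub>F n in sequentially. saddle n \<le> 1 / ln (real n) \<longrightarrow>
     \<bar>simple_prob n (m n) * exp ((saddle n)\<^sup>2 / 2) - 1\<bar> \<le> b n"
  proof eventually_elim
    case (elim n)
    define K where "K = smoothing_window m n"
    define x where "x = real (m n) * stir_ratio n (m n)"
    have n: "2 \<le> n" "n < m n" "0 < K" using elim by (simp_all add: K_def)
    have c1: "1 < real (m n) / real n" using n by simp
    have l0: "0 < saddle n" unfolding saddle_def by (rule lambda_param(1)[OF c1])
    have xU: "x \<le> exp (3 / real K) * (saddle n + 2 * real K / real n)" and Kl: "2 * real K / real n \<le> saddle n"
      using elim by (simp_all add: x_def K_def saddle_def)
    have x0: "0 < x" unfolding x_def using stir_ratio_pos[OF n(1,2)] n by simp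
    show ?case
    proof
      assume le: "saddle n \<le> 1 / ln (real n)"
      have "exp (3 / real K) \<le> exp 3" using n(3) by (simp add: divide_le_eq)
      also have "exp (3::real) = exp 1 ^ 3" by (simp add: exp_of_nat_mult[symmetric])
      also have "\<dots> \<le> 3 ^ 3" by (intro power_mono exp_le) simp
      finally have e27: "exp (3 / real K) \<le> 27" by simp
      have "saddle n + 2 * real K / real n \<le> 2 * saddle n" "0 \<le> saddle n + 2 * real K / real n"
        using Kl l0 by (linarith, simp)
      then have "exp (3 / real K) * (saddle n + 2 * real K / real n) \<le> 27 * (2 * saddle n)"
        using e27 by (intro mult_mono) auto
      with xU have "x \<le> 27 * (2 * saddle n)" by (rule order_trans)
      also have "\<dots> \<le> 54 / ln (real n)" using le by simp
      finally have "x\<^sup>2 \<le> (54 / ln (real n))\<^sup>2" using x0 by (intro power_mono) auto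
      then have "exp (x\<^sup>2) \<le> exp ((54 / ln (real n))\<^sup>2)" by simp
      then have P: "\<bar>simple_prob n (m n) - 1\<bar> \<le> exp ((54 / ln (real n))\<^sup>2) - 1"
        using simple_prob_near_one[OF n(1,2)] unfolding x_def by linarith
      define E where "E = exp ((saddle n)\<^sup>2 / 2)"
      have "(saddle n)\<^sup>2 \<le> (1 / ln (real n))\<^sup>2" using le l0 by (intro power_mono) auto
      then have "(saddle n)\<^sup>2 / 2 \<le> (1 / ln (real n))\<^sup>2" using zero_le_power2[of "saddle n"] by linarith
      then have E: "1 \<le> E" "E \<le> exp ((1 / ln (real n))\<^sup>2)" by (simp_all add: E_def)
      have "\<bar>simple_prob n (m n) * E - 1\<bar> = \<bar>(simple_prob n (m n) - 1) * E + (E - 1)\<bar>"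
        by (simp add: algebra_simps)
      also have "\<dots> \<le> \<bar>simple_prob n (m n) - 1\<bar> * E + (E - 1)"
        using E(1) abs_triangle_ineq[of "(simple_prob n (m n) - 1) * E" "E - 1"] by (simp add: abs_mult)
      also have "\<dots> \<le> b n"
        unfolding b_def using P E by (intro add_mono mult_mono) auto
      finally show "\<bar>simple_prob n (m n) * exp ((saddle n)\<^sup>2 / 2) - 1\<bar> \<le> b n" by (simp add: E_def)
    qed
  qed
qed


text \<open>A bound for |m r - lambda| when K is about ln^4 x and lambda <= 1.1 ln x: the relative
  error e^(3/K) - 1 times the size of both quantities, plus the shift 2K/n. It is of order ln^(-3)
  x.\<close>

definition smoothing_error :: "real \<Rightarrow> real" where
  "smoothing_error x = (exp (3 / ln x ^ 4) - 1) * (11/10 * ln x + exp (3 / ln x ^ 4) * (11/10 * ln x + 2 * (ln x ^ 4 + 1) / x)) +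
     exp (3 / ln x ^ 4) * (2 * (ln x ^ 4 + 1) / x)"

text \<open>Two relative errors are multiplied: \<open>simple_prob\<close> against prod (1 - i r^2),
  from \<open>simple_prob_window\<close>, and this product against exp (-lambda^2/2), from
  \<open>prod_exp_near_one\<close> with |(m r)^2 - lambda^2| of order ln^(-2) n.\<close>

lemma simple_prob_mid:
  "\<exists>b. b \<longlonglongrightarrow> 0 \<and> (\<forall>\<^sub>F n in sequentially. 1 / ln (real n) < saddle n \<and> real (m n) \<le> 11/10 * (real n * ln (real n)) \<longrightarrow>
     \<bar>simple_prob n (m n) * exp ((saddle n)\<^sup>2 / 2) - 1\<bar> \<le> b n)"
proof (intro exI conjI)
  define D where "D = (\<lambda>n. smoothing_error (real n))"
  define g where "g = (\<lambda>n. exp (2 * (4 * (ln (real n))\<^sup>2) * (2 * ln (real n) / real n) + 2 * ln (real n) / real n +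
      D n * (22/10 * ln (real n) + D n) / 2) - 1)"
  define b where "b = (\<lambda>n. window_error (real n) * (1 + g n) + g n)"
  have g: "g \<longlonglongrightarrow> 0" unfolding g_def D_def smoothing_error_def by real_asymp
  have "b \<longlonglongrightarrow> 0 * (1 + 0) + 0" unfolding b_def by (intro tendsto_intros g window_error_tendsto)
  then show "b \<longlonglongrightarrow> 0" by simp
  have e: "\<forall>\<^sub>F n in sequentially. real n / (2 * ln (real n)) \<ge> 2 * ln (real n) ^ 4 + 4"
    "\<forall>\<^sub>F n in sequentially. D n \<le> 1 / (4 * ln (real n))"
    "\<forall>\<^sub>F n in sequentially. 8 \<le> real n powr (1/5)"
    "\<forall>\<^sub>F n in sequentially. 4 * ln (real n) \<le> real n"
    "\<forall>\<^sub>F n in sequentially. 8 * sqrt (2 * real n powr (-9/10)) * (ln (real n))\<^sup>2 \<le> 1"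
    "\<forall>\<^sub>F n in sequentially. 1 \<le> ln (real n)"
    unfolding D_def smoothing_error_def by real_asymp+
  have "\<forall>\<^sub>F n in sequentially. 3 \<le> n" by (rule eventually_ge_at_top)
  with e eventually_stir_ratio_bounds eventually_one_minus_stir_ratio_ge
  show "\<forall>\<^sub>F n in sequentially. 1 / ln (real n) < saddle n \<and> real (m n) \<le> 11/10 * (real n * ln (real n)) \<longrightarrow>
     \<bar>simple_prob n (m n) * exp ((saddle n)\<^sup>2 / 2) - 1\<bar> \<le> b n"
  proof eventually_elim
    case (elim n)
    define K where "K = smoothing_window m n"
    define r where "r = stir_ratio n (m n)"
    define x where "x = real (m n) * r"
    define c where "c = real (m n) / real n"
    define \<kappa> where "\<kappa> = 2 * real K / real n"
    define e where "e = exp (3 / real K)"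
    define lx where "lx = ln (real n)"
    have n: "2 \<le> n" "n < m n" "0 < K" using elim by (simp_all add: K_def)
    have n3: "3 \<le> real n" using elim by simp
    have lx: "1 \<le> lx" using elim by (simp add: lx_def)
    have c1: "1 < c" using n by (simp add: c_def)
    have l0: "0 < saddle n" unfolding saddle_def using lambda_param(1)[OF c1] by (simp add: c_def)
    have lc: "saddle n \<le> c" "c - 1 \<le> saddle n" "saddle n \<le> 2 * (c - 1)"
      unfolding saddle_def using lambda_param_bounds[OF c1] by (simp_all add: c_def)
    have xU: "x \<le> e * (saddle n + \<kappa>)" and xL: "saddle n - \<kappa> \<le> e * x"
      using elim by (simp_all add: x_def K_def saddle_def r_def e_def \<kappa>_def)
    have r0: "0 < r" unfolding r_def by (rule stir_ratio_pos[OF n(1,2)])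
    have x0: "0 < x" unfolding x_def using r0 n by simp
    have nr1: "real n * r < 1" unfolding r_def by (rule stir_ratio_less[OF n(1,2)])
    show ?case
    proof (intro impI, elim conjE)
      assume l_gt: "1 / ln (real n) < saddle n" and m_le: "real (m n) \<le> 11/10 * (real n * ln (real n))"
      have c_le: "c \<le> 11/10 * lx" using m_le n3 by (simp add: c_def lx_def field_simps)
      \<comment> \<open>lambda > 1 / ln n forces m - n >= n / (2 ln n), so the minimum in
        \<open>smoothing_window\<close> is attained by its first argument.\<close>
      have KK: "lx ^ 4 \<le> real K" "real K \<le> lx ^ 4 + 1"
      proof -
        define h where "h = 1 / lx"
        have "h < saddle n" using l_gt by (simp only: h_def lx_def)
        then have "h < 2 * (c - 1)" using lc(3) by (rule less_le_trans)
        then have "h / 2 < c - 1" by simp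
        then have "1 / (2 * lx) < c - 1" by (simp add: h_def)
        then have "real n * (1 / (2 * lx)) \<le> real n * (c - 1)" by (intro mult_left_mono) auto
        also have "\<dots> = real (m n) - real n" using n3 by (simp add: c_def right_diff_distrib)
        finally have gap: "real n / (2 * lx) \<le> real (m n) - real n" by simp
        have ceil: "lx ^ 4 \<le> real (nat \<lceil>lx ^ 4\<rceil>)" "real (nat \<lceil>lx ^ 4\<rceil>) \<le> lx ^ 4 + 1" using lx by simp_all
        have "nat \<lceil>lx ^ 4\<rceil> \<le> (m n - n) div 2"
        proof -
          have "2 * lx ^ 4 + 4 \<le> real n / (2 * lx)" using elim(1) by (simp add: lx_def)
          then have "2 * lx ^ 4 + 4 \<le> real (m n) - real n" using gap by (rule order_trans)
          then have "2 * real (nat \<lceil>lx ^ 4\<rceil>) \<le> real (m n) - real n"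
            using ceil(2) by linarith
          then have "2 * nat \<lceil>lx ^ 4\<rceil> \<le> m n - n" using n(2) by linarith
          then show ?thesis by linarith
        qed
        then show "lx ^ 4 \<le> real K" "real K \<le> lx ^ 4 + 1"
          using ceil by (simp_all add: K_def smoothing_window_def lx_def[symmetric] min_def)
      qed
      define E where "E = exp (3 / lx ^ 4)"
      define \<kappa>' where "\<kappa>' = 2 * (lx ^ 4 + 1) / real n"
      have \<kappa>: "0 \<le> \<kappa>" "\<kappa> \<le> \<kappa>'" unfolding \<kappa>_def \<kappa>'_def using KK n3 by (simp_all add: divide_right_mono)
      have "0 < lx ^ 4" using lx by simp
      then have "3 / real K \<le> 3 / lx ^ 4" by (intro frac_le KK(1)) simp_all
      then have eE: "1 \<le> e" "e \<le> E" by (simp_all add: e_def E_def)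
      have l_le: "saddle n \<le> 11/10 * lx" using lc c_le by linarith
      have D_eq: "D n = (E - 1) * (11/10 * lx + E * (11/10 * lx + \<kappa>')) + E * \<kappa>'"
        by (simp add: D_def smoothing_error_def E_def lx_def \<kappa>'_def)
      have x_le': "x \<le> E * (11/10 * lx + \<kappa>')"
      proof -
        have "e * (saddle n + \<kappa>) \<le> E * (11/10 * lx + \<kappa>')"
          using eE l_le \<kappa> l0 by (intro mult_mono add_mono) auto
        then show ?thesis using xU by linarith
      qed
      have E1: "1 \<le> E" using eE by linarith
      have xx: "0 \<le> E * (11/10 * lx + \<kappa>')" using x_le' x0 by linarith
      have \<kappa>'0: "0 \<le> \<kappa>'" using \<kappa> by linarith
      have d1: "x - saddle n \<le> D n"
      proof -
        have "x - saddle n \<le> (e - 1) * saddle n + e * \<kappa>" using xU by (simp add: algebra_simps)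
        also have "\<dots> \<le> (E - 1) * (11/10 * lx + E * (11/10 * lx + \<kappa>')) + E * \<kappa>'"
        proof (rule add_mono)
          have "saddle n \<le> 11/10 * lx + E * (11/10 * lx + \<kappa>')" using l_le xx by (rule add_increasing2[rotated])
          then show "(e - 1) * saddle n \<le> (E - 1) * (11/10 * lx + E * (11/10 * lx + \<kappa>'))"
            using eE l0 by (intro mult_mono) auto
          show "e * \<kappa> \<le> E * \<kappa>'" using eE \<kappa> by (intro mult_mono) auto
        qed
        finally show ?thesis by (simp add: D_eq)
      qed
      have d2: "saddle n - x \<le> D n"
      proof -
        have "saddle n - x \<le> (e - 1) * x + \<kappa>" using xL by (simp add: algebra_simps)
        also have "\<dots> \<le> (E - 1) * (11/10 * lx + E * (11/10 * lx + \<kappa>')) + E * \<kappa>'"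
        proof (rule add_mono)
          show "(e - 1) * x \<le> (E - 1) * (11/10 * lx + E * (11/10 * lx + \<kappa>'))"
          proof (rule mult_mono)
            show "x \<le> 11/10 * lx + E * (11/10 * lx + \<kappa>')"
              by (rule add_increasing[OF _ x_le']) (use lx in simp)
          qed (use eE x0 in auto)
          show "\<kappa> \<le> E * \<kappa>'" using \<kappa>(2) mult_right_mono[OF E1 \<kappa>'0] by simp
        qed
        finally show ?thesis by (simp add: D_eq)
      qed
      have D0: "0 \<le> D n" using d1 d2 by linarith
      have D_le: "D n \<le> 1 / (4 * lx)" using elim(2) by (simp add: lx_def)
      have "1 / (4 * lx) \<le> 1 / 4" using lx by (simp add: divide_le_eq)
      then have D14: "D n \<le> 1 / 4" using D_le by linarith
      have x2: "x \<le> 2 * lx" using d1 l_le D14 lx by linarith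
      have xl: "\<bar>x\<^sup>2 - (saddle n)\<^sup>2\<bar> \<le> D n * (22/10 * lx + D n)"
      proof -
        have "x\<^sup>2 - (saddle n)\<^sup>2 = (x - saddle n) * (x + saddle n)" by (simp add: power2_eq_square algebra_simps)
        then have "\<bar>x\<^sup>2 - (saddle n)\<^sup>2\<bar> = \<bar>x - saddle n\<bar> * (x + saddle n)" using x0 l0 by (simp add: abs_mult)
        also have "\<dots> \<le> D n * (22/10 * lx + D n)"
          using d1 d2 D0 x0 l0 l_le by (intro mult_mono) auto
        finally show ?thesis .
      qed
      \<comment> \<open>n r = (m r) / c, where m r >= (3/4) lambda and c <= 1 + lambda is at most of
        order lambda ln n. The decay of the characteristic function depends on n r not being too
        small.\<close>
      have nr: "1 / (4 * lx) \<le> real n * r"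
      proof -
        have "saddle n * (1 / 4) \<ge> 1 / (4 * lx)" using l_gt lx by (simp add: lx_def field_simps)
        then have x34: "3 / 4 * saddle n \<le> x" using d2 D_le by linarith
        have "c \<le> 1 + saddle n" using lc by linarith
        moreover have "1 < lx * saddle n" using l_gt lx by (simp add: lx_def field_simps)
        moreover have "1 * saddle n \<le> lx * saddle n" using lx l0 by (intro mult_right_mono) auto
        ultimately have "c \<le> 3 * lx * saddle n" by linarith
        also have "\<dots> \<le> 4 * lx * x" using mult_left_mono[OF x34, of "4 * lx"] lx by simp
        finally have "c \<le> 4 * lx * (c * (real n * r))" using n3 by (simp add: x_def c_def)
        then have "c * 1 \<le> c * (4 * lx * (real n * r))" by (simp add: mult_ac)
        then have "1 \<le> 4 * lx * (real n * r)" using c1 by (simp only: mult_le_cancel_left)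
        then show ?thesis using lx by (simp add: field_simps)
      qed
      have \<tau>: "real n powr (-6/5) \<le> 1 - real n * r"
        using elim m_le n by (simp add: r_def)
      have W: "\<bar>simple_prob n (m n) / (\<Prod>i<m n. 1 - real i * r\<^sup>2) - 1\<bar> \<le> window_error (real n)"
        unfolding r_def
        by (rule simple_prob_window) (use n n3 nr \<tau> x2 elim in \<open>simp_all add: r_def x_def lx_def\<close>)
      define \<Phi> where "\<Phi> = (\<Prod>i<m n. 1 - real i * r\<^sup>2)"
      have r1: "r \<le> 1 / real n" using nr1 n3 by (simp add: field_simps)
      have mr2: "real (m n) * r\<^sup>2 \<le> 2 * lx / real n"
      proof -
        have "real (m n) * r\<^sup>2 = x * r" by (simp add: x_def power2_eq_square)
        also have "\<dots> \<le> (2 * lx) * (1 / real n)" by (rule mult_mono[OF x2 r1]) (use lx r0 in auto)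
        finally show ?thesis by simp
      qed
      have half: "2 * lx / real n \<le> 1 / 2" using elim n3 by (simp add: lx_def field_simps)
      have x2eq: "real (m n) ^ 2 * r\<^sup>2 = x\<^sup>2" by (simp add: x_def power_mult_distrib)
      have G: "\<bar>\<Phi> * exp ((saddle n)\<^sup>2 / 2) - 1\<bar> \<le> g n"
      proof -
        have "\<bar>\<Phi> * exp ((saddle n)\<^sup>2 / 2) - 1\<bar> \<le> exp (2 * (real (m n) ^ 2 * r\<^sup>2) * (real (m n) * r\<^sup>2) + real (m n) * r\<^sup>2 + D n * (22/10 * lx + D n) / 2) - 1"
          unfolding \<Phi>_def
          by (rule prod_exp_near_one) (use mr2 half xl in \<open>auto simp: x2eq\<close>)
        also have "\<dots> \<le> g n"
        proof -
          have "x\<^sup>2 \<le> (2 * lx)\<^sup>2" using x2 x0 by (intro power_mono) auto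
          then have "x\<^sup>2 \<le> 4 * lx\<^sup>2" by (simp add: power_mult_distrib)
          then have "2 * x\<^sup>2 * (real (m n) * r\<^sup>2) \<le> 2 * (4 * lx\<^sup>2) * (2 * lx / real n)"
            using mr2 by (intro mult_mono) auto
          then show ?thesis unfolding g_def x2eq lx_def[symmetric] using mr2 by simp
        qed
        finally show ?thesis .
      qed
      have \<Phi>0: "\<Phi> \<noteq> 0"
      proof -
        have "exp (- (real (m n) ^ 2 * r\<^sup>2 / 2) - 2 * real (m n) ^ 3 * (r\<^sup>2)\<^sup>2) \<le> \<Phi>"
          unfolding \<Phi>_def by (rule prod_one_minus_bounds(2)) (use mr2 half in auto)
        moreover have "0 < exp (- (real (m n) ^ 2 * r\<^sup>2 / 2) - 2 * real (m n) ^ 3 * (r\<^sup>2)\<^sup>2)" by simp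
        ultimately show ?thesis by linarith
      qed
      have "simple_prob n (m n) * exp ((saddle n)\<^sup>2 / 2) = (simple_prob n (m n) / \<Phi>) * (\<Phi> * exp ((saddle n)\<^sup>2 / 2))"
        using \<Phi>0 by simp
      then show "\<bar>simple_prob n (m n) * exp ((saddle n)\<^sup>2 / 2) - 1\<bar> \<le> b n"
        using mult_near_one[OF W[folded \<Phi>_def] G] by (simp add: b_def)
    qed
  qed
qed

end

text \<open>C(a,k) / C(b,k) <= (a/b)^k, because (a-i)/(b-i) <= a/b factor by factor.\<close>

lemma binomial_power_le:
  assumes "a \<le> b"
  shows "(a choose k) * b ^ k \<le> (b choose k) * a ^ k"
proof (induction k)
  case (Suc k)
  have r: "Suc k * (x choose Suc k) = (x - k) * (x choose k)" for x
    by (simp only: binomial_absorb_comp binomial_absorption)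
  have "Suc k * ((a choose Suc k) * b ^ Suc k) = ((a - k) * b) * ((a choose k) * b ^ k)"
    unfolding mult.assoc[symmetric] r power_Suc by (simp only: mult_ac)
  also have "\<dots> \<le> ((b - k) * a) * ((b choose k) * a ^ k)"
  proof (rule mult_le_mono)
    have "k * a \<le> k * b" using assms by simp
    then have "b * a - k * b \<le> b * a - k * a" by (rule diff_le_mono2)
    then show "(a - k) * b \<le> (b - k) * a" by (simp only: diff_mult_distrib mult.commute[of a b])
  qed (rule Suc.IH)
  also have "\<dots> = Suc k * ((b choose Suc k) * a ^ Suc k)"
    unfolding mult.assoc[symmetric] r power_Suc by (simp only: mult_ac)
  finally show ?case using Suc_mult_le_cancel1[of k] by blast
qed simp

text \<open>\<open>\<Phi>\<close> is the probability that two unrestricted random maps have distinct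
  pairs of values. With \<open>q\<close> bounding the expected number of missed values, restricting
  to surjections changes each count of maps by a factor between 1 - q and 1, and the count of
  relations by one between 1 - 2q and 1.\<close>

lemma simple_prob_sandwich:
  fixes n m :: nat and q :: real
  defines "\<Phi> \<equiv> \<Prod>i<m. 1 - real i * (1 / real n ^ 2)"
  assumes n: "2 \<le> n" "n < m" and q: "real n * exp (- (real m / real n)) \<le> q" "2 * q < 1" and \<Phi>: "0 < \<Phi>"
  shows "\<bar>simple_prob n m / \<Phi> - 1\<bar> \<le> 2 * q + (1 / (1 - q)\<^sup>2 - 1)"
proof -
  define N where "N = real (card (core_digraphs n m))"
  define s where "s = surj_count n m"
  define c where "c = fact m * real (n * n choose m)"
  have q0: "0 \<le> q" by (rule order_trans[OF _ q(1)]) simp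
  have s0: "0 < s" using Stirling_pos[of n m] n by (simp add: s_def surj_count_def)
  have P: "simple_prob n m = fact m * N / s\<^sup>2"
    using card_core_digraphs_eq[of n m] n s0 by (simp add: N_def s_def)
  have c: "c = real n ^ m * real n ^ m * \<Phi>"
  proof -
    have "c = (\<Prod>i<m. real (n * n) - real i)"
      unfolding c_def by (simp only: binomial_gbinomial gbinomial_prod_rev lessThan_atLeast0) simp
    also have "\<dots> = (\<Prod>i<m. real n * real n * (1 - real i * (1 / real n ^ 2)))"
      using n by (intro prod.cong) (simp_all add: right_diff_distrib power2_eq_square)
    finally show ?thesis by (simp add: prod.distrib \<Phi>_def power_mult_distrib)
  qed
  have e: "(1 - 1 / real n) ^ m \<le> exp (- (real m / real n))"
  proof -
    have "(1 - 1 / real n) ^ m \<le> exp (- (1 / real n)) ^ m"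
      using exp_ge_add_one_self[of "- (1 / real n)"] n by (intro power_mono) auto
    then show ?thesis by (simp add: exp_of_nat_mult[symmetric])
  qed
  have nn: "real (n - 1) = real n * (1 - 1 / real n)" using n by (simp add: of_nat_diff right_diff_distrib)
  have s_le: "s \<le> real n ^ m" unfolding s_def by (rule surj_count_le)
  have s_ge: "real n ^ m * (1 - q) \<le> s"
  proof -
    have "real (n ^ m) \<le> real (fact n * Stirling m n + n * (n - 1) ^ m)" by (rule of_nat_mono) (rule fact_Stirling_ge)
    then have "real n ^ m \<le> s + real n * real (n - 1) ^ m" by (simp add: s_def surj_count_def)
    also have "real n * real (n - 1) ^ m = real n ^ m * (real n * (1 - 1 / real n) ^ m)"
      unfolding nn by (simp add: power_mult_distrib mult_ac)
    also have "\<dots> \<le> real n ^ m * q"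
      using e q(1) mult_left_mono[OF e, of "real n"] by (intro mult_left_mono) auto
    finally show ?thesis by (simp add: right_diff_distrib)
  qed
  have N_le: "fact m * N \<le> c"
    using card_covering_relations_le[of "{1..n}" "{1..n}" m] by (simp add: N_def c_def card_core_digraphs)
  have N_ge: "c * (1 - 2 * q) \<le> fact m * N"
  proof -
    have b: "real ((n - 1) * n choose m) \<le> real (n * n choose m) * exp (- (real m / real n))"
    proof -
      have "((n - 1) * n choose m) * (n * n) ^ m \<le> (n * n choose m) * ((n - 1) * n) ^ m"
        by (rule binomial_power_le) simp
      then have "real (((n - 1) * n choose m) * (n * n) ^ m) \<le> real ((n * n choose m) * ((n - 1) * n) ^ m)"
        by (rule of_nat_mono)
      then have "real ((n - 1) * n choose m) * (real n * real n) ^ m \<le> real (n * n choose m) * (real (n - 1) * real n) ^ m"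
        by (simp only: of_nat_mult of_nat_power)
      also have "(real (n - 1) * real n) ^ m = (1 - 1 / real n) ^ m * (real n * real n) ^ m"
        unfolding nn by (simp add: power_mult_distrib mult_ac)
      finally have "real ((n - 1) * n choose m) * (real n * real n) ^ m \<le> (real (n * n choose m) * (1 - 1 / real n) ^ m) * (real n * real n) ^ m"
        by (simp only: mult.assoc)
      then have "real ((n - 1) * n choose m) \<le> real (n * n choose m) * (1 - 1 / real n) ^ m"
        using n by (simp add: mult_le_cancel_right)
      also have "\<dots> \<le> real (n * n choose m) * exp (- (real m / real n))" using e by (intro mult_left_mono) auto
      finally show ?thesis .
    qed
    have "real (n * n choose m) \<le> N + 2 * (real n * real ((n - 1) * n choose m))"
    proof -
      have "n * n choose m \<le> card (covering_relations {1..n} {1..n} m) + n * ((n - 1) * n choose m) + n * (n * (n - 1) choose m)"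
        using card_covering_relations_ge[of "{1..n}" "{1..n}" m] by simp
      then have "real (n * n choose m) \<le> real (card (covering_relations {1..n} {1..n} m) + n * ((n - 1) * n choose m) + n * (n * (n - 1) choose m))"
        by (rule of_nat_mono)
      then show ?thesis by (simp add: N_def card_core_digraphs mult.commute[of n "n - Suc 0"])
    qed
    also have "real n * real ((n - 1) * n choose m) \<le> real (n * n choose m) * q"
    proof -
      have "real n * real ((n - 1) * n choose m) \<le> real n * (real (n * n choose m) * exp (- (real m / real n)))"
        using b by (intro mult_left_mono) auto
      also have "\<dots> = real (n * n choose m) * (real n * exp (- (real m / real n)))" by simp
      also have "\<dots> \<le> real (n * n choose m) * q" using q by (intro mult_left_mono) auto
      finally show ?thesis .
    qed
    finally have "real (n * n choose m) * (1 - 2 * q) \<le> N" by (simp add: algebra_simps)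
    then have "fact m * (real (n * n choose m) * (1 - 2 * q)) \<le> fact m * N" by (intro mult_left_mono) auto
    then show ?thesis by (simp add: c_def mult.assoc)
  qed
  have lo: "1 - 2 * q \<le> simple_prob n m / \<Phi>"
  proof -
    have "s\<^sup>2 \<le> (real n ^ m)\<^sup>2" using s_le s0 by (intro power_mono) auto
    then have "(1 - 2 * q) * (\<Phi> * s\<^sup>2) \<le> (1 - 2 * q) * (\<Phi> * (real n ^ m)\<^sup>2)"
      using \<Phi> q by (intro mult_left_mono) auto
    also have "\<dots> = c * (1 - 2 * q)" unfolding c by (simp add: power2_eq_square)
    also have "\<dots> \<le> fact m * N" by (rule N_ge)
    finally show ?thesis unfolding P using \<Phi> s0 by (simp add: field_simps)
  qed
  have hi: "simple_prob n m / \<Phi> \<le> 1 / (1 - q)\<^sup>2"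
  proof -
    have q1: "0 < 1 - q" using q(2) q0 by linarith
    have "fact m * N * (1 - q)\<^sup>2 \<le> c * (1 - q)\<^sup>2" using N_le by (intro mult_right_mono) auto
    also have "\<dots> = \<Phi> * (real n ^ m * (1 - q))\<^sup>2" unfolding c by (simp add: power2_eq_square)
    also have "\<dots> \<le> \<Phi> * s\<^sup>2" using s_ge q1 \<Phi> by (intro mult_left_mono power_mono) auto
    finally show ?thesis unfolding P using \<Phi> s0 q1 by (simp add: field_simps)
  qed
  have "1 \<le> 1 / (1 - q)\<^sup>2" using q q0 by (simp add: power_le_one)
  then show ?thesis using lo hi q0 by linarith
qed

text \<open>The gap c - lambda = lambda / (e^lambda - 1) is exponentially small; the polynomial
  bound e^lambda - 1 >= lambda^4/64 is enough.\<close>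

lemma lambda_param_square_near:
  assumes "2 \<le> c"
  shows "\<bar>c\<^sup>2 - (lambda_param c)\<^sup>2\<bar> \<le> 256 / (c - 1)\<^sup>2"
proof -
  define l where "l = lambda_param c"
  have c1: "1 < c" using assms by simp
  have l: "0 < l" "c = l * exp l / (exp l - 1)" "c - 1 \<le> l" "l \<le> c"
    unfolding l_def using lambda_param[OF c1] lambda_param_bounds[OF c1] by simp_all
  have l1: "1 \<le> l" using l(3) assms by simp
  have e: "0 < exp l - 1" using l(1,3,4) by simp
  have cl: "c - l = l / (exp l - 1)" unfolding l(2) using e by (simp add: field_simps)
  \<comment> \<open>Squares the quadratic Taylor bound for e^(l/2), whose last term is
    l^2/8.\<close>
  have q: "l ^ 4 / 64 \<le> exp l - 1"
  proof -
    have "1 + l / 2 + (l / 2)\<^sup>2 / 2 \<le> exp (l / 2)" using l(1,3,4) by (intro exp_lower_Taylor_quadratic) simp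
    then have "(1 + l / 2 + (l / 2)\<^sup>2 / 2)\<^sup>2 \<le> exp (l / 2) ^ 2" using l(1,3,4) by (intro power_mono) auto
    also have "\<dots> = exp l" by (simp add: exp_of_nat_mult[symmetric])
    finally have "(1 + l / 2 + (l / 2)\<^sup>2 / 2)\<^sup>2 \<le> exp l" .
    moreover have "1 + l ^ 4 / 64 \<le> (1 + l / 2 + (l / 2)\<^sup>2 / 2)\<^sup>2"
      using l(1,3,4) by (simp add: power2_eq_square eval_nat_numeral algebra_simps)
    ultimately show ?thesis by linarith
  qed
  have "c\<^sup>2 - l\<^sup>2 = (c - l) * (c + l)" by (simp add: power2_eq_square algebra_simps)
  also have "\<dots> = l / (exp l - 1) * (c + l)" unfolding cl ..
  also have "\<dots> \<le> l / (l ^ 4 / 64) * (4 * l)"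
  proof (rule mult_mono)
    show "l / (exp l - 1) \<le> l / (l ^ 4 / 64)" using q l(1) by (intro divide_left_mono mult_pos_pos) auto
    show "c + l \<le> 4 * l" using l(3) l1 by linarith
  qed (use l(1,3,4) e c1 in auto)
  also have "\<dots> = 256 / l\<^sup>2" using l(1,3,4) by (simp add: eval_nat_numeral)
  also have "\<dots> \<le> 256 / (c - 1)\<^sup>2"
    using l(1,3,4) c1 by (intro divide_left_mono power_mono mult_pos_pos) auto
  finally have "c\<^sup>2 - l\<^sup>2 \<le> 256 / (c - 1)\<^sup>2" .
  moreover have "l\<^sup>2 \<le> c\<^sup>2" using l(1,3,4) by (intro power_mono) auto
  ultimately show ?thesis unfolding l_def[symmetric] by linarith
qed

lemma simple_prob_large:
  fixes m :: "nat \<Rightarrow> nat"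
  assumes O: "(\<lambda>n. real (m n)) \<in> O(\<lambda>n. real n * ln (real n))"
    and lim: "filterlim (\<lambda>n. real (m n) - real n) at_top at_top"
  shows "\<exists>b. b \<longlonglongrightarrow> 0 \<and> (\<forall>\<^sub>F n in sequentially. 11/10 * (real n * ln (real n)) < real (m n) \<longrightarrow>
     \<bar>simple_prob n (m n) * exp ((saddle m n)\<^sup>2 / 2) - 1\<bar> \<le> b n)"
proof -
  obtain A where A: "0 < A" "\<forall>\<^sub>F n in sequentially. real (m n) \<le> A * (real n * ln (real n))"
    using eventually_le_n_ln_n[OF O lim] by blast
  \<comment> \<open>This equals n^(-1/10), which tends to 0 because the threshold constant 11/10
    exceeds 1.\<close>
  define q where "q = (\<lambda>n. real n * exp (- (11/10 * ln (real n))))"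
  define B where "B = (\<lambda>n. 256 / (11/10 * ln (real n) - 1)\<^sup>2)"
  define g where "g = (\<lambda>n. exp (2 * (A * ln (real n))\<^sup>2 * (A * ln (real n) / real n) + A * ln (real n) / real n + B n / 2) - 1)"
  define w where "w = (\<lambda>n. 2 * q n + (1 / (1 - q n)\<^sup>2 - 1))"
  have g: "g \<longlonglongrightarrow> 0" unfolding g_def B_def using A(1) by real_asymp
  have w: "w \<longlonglongrightarrow> 0" unfolding w_def q_def by real_asymp
  have "(\<lambda>n. w n * (1 + g n) + g n) \<longlonglongrightarrow> 0 * (1 + 0) + 0" by (intro tendsto_intros g w)
  then have b: "(\<lambda>n. w n * (1 + g n) + g n) \<longlonglongrightarrow> 0" by simp
  have ev: "\<forall>\<^sub>F n in sequentially. 2 * q n < 1"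
    "\<forall>\<^sub>F n in sequentially. A * ln (real n) / real n \<le> 1 / 2"
    "\<forall>\<^sub>F n in sequentially. 2 \<le> ln (real n)"
    unfolding q_def using A(1) by real_asymp+
  have "\<forall>\<^sub>F n in sequentially. 3 \<le> n" by (rule eventually_ge_at_top)
  with ev A(2) eventually_gap[OF O lim, of 1]
  have "\<forall>\<^sub>F n in sequentially. 11/10 * (real n * ln (real n)) < real (m n) \<longrightarrow>
     \<bar>simple_prob n (m n) * exp ((saddle m n)\<^sup>2 / 2) - 1\<bar> \<le> w n * (1 + g n) + g n"
  proof eventually_elim
    case (elim n)
    define c where "c = real (m n) / real n"
    define u where "u = 1 / real n ^ 2"
    have n: "2 \<le> n" "n < m n" "3 \<le> real n" using elim by linarith+
    show ?case
    proof
      assume gt: "11/10 * (real n * ln (real n)) < real (m n)"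
      have c: "11/10 * ln (real n) \<le> c" "c \<le> A * ln (real n)"
        using gt elim n by (simp_all add: c_def field_simps)
      have c2: "2 \<le> c" using c(1) elim by linarith
      have mu: "real (m n) * u = c / real n" "real (m n) ^ 2 * u = c\<^sup>2"
        using n by (simp_all add: u_def c_def power2_eq_square)
      have mu_le: "real (m n) * u \<le> A * ln (real n) / real n"
        unfolding mu using c n by (intro divide_right_mono) auto
      then have half: "real (m n) * u \<le> 1 / 2" using elim by linarith
      have u0: "0 \<le> u" by (simp add: u_def)
      have cB: "\<bar>c\<^sup>2 - (saddle m n)\<^sup>2\<bar> \<le> B n"
      proof -
        have "\<bar>c\<^sup>2 - (saddle m n)\<^sup>2\<bar> \<le> 256 / (c - 1)\<^sup>2"
          using lambda_param_square_near[OF c2] by (simp add: saddle_def[OF O lim] c_def)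
        also have "\<dots> \<le> B n" unfolding B_def
          using c elim by (intro divide_left_mono power_mono mult_pos_pos zero_less_power) auto
        finally show ?thesis .
      qed
      define \<Phi> where "\<Phi> = (\<Prod>i<m n. 1 - real i * u)"
      have \<Phi>0: "0 < \<Phi>"
        by (rule less_le_trans[OF _ prod_one_minus_bounds(2)[OF u0 half, folded \<Phi>_def]]) simp
      have G: "\<bar>\<Phi> * exp ((saddle m n)\<^sup>2 / 2) - 1\<bar> \<le> g n"
      proof -
        have "\<bar>\<Phi> * exp ((saddle m n)\<^sup>2 / 2) - 1\<bar> \<le> exp (2 * (real (m n) ^ 2 * u) * (real (m n) * u) + real (m n) * u + B n / 2) - 1"
          unfolding \<Phi>_def by (rule prod_exp_near_one[OF u0 half]) (use cB in \<open>simp add: mu\<close>)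
        also have "\<dots> \<le> g n"
        proof -
          have "c\<^sup>2 \<le> (A * ln (real n))\<^sup>2" using c c2 by (intro power_mono) auto
          then have "2 * (real (m n) ^ 2 * u) * (real (m n) * u) \<le> 2 * (A * ln (real n))\<^sup>2 * (A * ln (real n) / real n)"
            using mu_le u0 unfolding mu(2) by (intro mult_mono) auto
          then show ?thesis unfolding g_def using mu_le by simp
        qed
        finally show ?thesis .
      qed
      have qn: "real n * exp (- (real (m n) / real n)) \<le> q n"
        unfolding q_def c_def[symmetric] using c(1) by (intro mult_left_mono) auto
      have W: "\<bar>simple_prob n (m n) / \<Phi> - 1\<bar> \<le> w n"
        using simple_prob_sandwich[OF n(1,2) qn] elim \<Phi>0 by (simp add: w_def \<Phi>_def u_def)
      have "simple_prob n (m n) * exp ((saddle m n)\<^sup>2 / 2) = (simple_prob n (m n) / \<Phi>) * (\<Phi> * exp ((saddle m n)\<^sup>2 / 2))"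
        using \<Phi>0 by simp
      then show "\<bar>simple_prob n (m n) * exp ((saddle m n)\<^sup>2 / 2) - 1\<bar> \<le> w n * (1 + g n) + g n"
        using mult_near_one[OF W G] by simp
    qed
  qed
  with b show ?thesis by blast
qed

lemma simple_prob_tendsto:
  fixes m :: "nat \<Rightarrow> nat"
  assumes O: "(\<lambda>n. real (m n)) \<in> O(\<lambda>n. real n * ln (real n))"
    and lim: "filterlim (\<lambda>n. real (m n) - real n) at_top at_top"
  shows "(\<lambda>n. simple_prob n (m n) * exp ((saddle m n)\<^sup>2 / 2)) \<longlonglongrightarrow> 1"
proof -
  obtain b1 where b1: "b1 \<longlonglongrightarrow> 0" and ev1: "\<forall>\<^sub>F n in sequentially. saddle m n \<le> 1 / ln (real n) \<longrightarrow>
       \<bar>simple_prob n (m n) * exp ((saddle m n)\<^sup>2 / 2) - 1\<bar> \<le> b1 n"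
    using simple_prob_small[OF O lim] by auto
  obtain b2 where b2: "b2 \<longlonglongrightarrow> 0" and ev2: "\<forall>\<^sub>F n in sequentially. 1 / ln (real n) < saddle m n \<and> real (m n) \<le> 11/10 * (real n * ln (real n)) \<longrightarrow>
       \<bar>simple_prob n (m n) * exp ((saddle m n)\<^sup>2 / 2) - 1\<bar> \<le> b2 n"
    using simple_prob_mid[OF O lim] by auto
  obtain b3 where b3: "b3 \<longlonglongrightarrow> 0" and ev3: "\<forall>\<^sub>F n in sequentially. 11/10 * (real n * ln (real n)) < real (m n) \<longrightarrow>
       \<bar>simple_prob n (m n) * exp ((saddle m n)\<^sup>2 / 2) - 1\<bar> \<le> b3 n"
    using simple_prob_large[OF O lim] by auto
  have "(\<lambda>n. \<bar>b1 n\<bar> + \<bar>b2 n\<bar> + \<bar>b3 n\<bar>) \<longlonglongrightarrow> \<bar>0\<bar> + \<bar>0\<bar> + \<bar>0\<bar>"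
    by (intro tendsto_add tendsto_rabs b1 b2 b3)
  then have "(\<lambda>n. \<bar>b1 n\<bar> + \<bar>b2 n\<bar> + \<bar>b3 n\<bar>) \<longlonglongrightarrow> 0" by simp
  moreover from ev1 ev2 ev3 have "\<forall>\<^sub>F n in sequentially. norm (simple_prob n (m n) * exp ((saddle m n)\<^sup>2 / 2) - 1) \<le> \<bar>b1 n\<bar> + \<bar>b2 n\<bar> + \<bar>b3 n\<bar>"
  proof eventually_elim
    case (elim n)
    consider "saddle m n \<le> 1 / ln (real n)" | "1 / ln (real n) < saddle m n \<and> real (m n) \<le> 11/10 * (real n * ln (real n))"
      | "11/10 * (real n * ln (real n)) < real (m n)" by linarith
    then show ?case
    proof cases
      case 1
      then show ?thesis using elim(1) by simp
    next
      case 2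
      then show ?thesis using elim(2) by simp
    next
      case 3
      then show ?thesis using elim(3) by simp
    qed
  qed
  ultimately have "(\<lambda>n. simple_prob n (m n) * exp ((saddle m n)\<^sup>2 / 2) - 1) \<longlonglongrightarrow> 0"
    by (rule Lim_null_comparison[rotated])
  then show ?thesis by (rule Lim_null[THEN iffD2])
qed

theorem theorem1p2:
  fixes m :: "nat \<Rightarrow> nat"
  assumes "(\<lambda>n. real (m n)) \<in> O(\<lambda>n. real n * ln (real n))"
    and "filterlim (\<lambda>n. real (m n) - real n) at_top at_top"
  shows "(\<lambda>n. real (card (core_digraphs n (m n))))
           \<sim>[at_top]
         (\<lambda>n. let c = real (m n) / real n; l = lambda_param c in
            fact (m n) * (exp l - 1) ^ (2 * n)
              / (2 * pi * real n * c * (1 + l - c) * l ^ (2 * m n))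
              * exp (- (l\<^sup>2 / 2)))"
proof (rule asymp_equivI')
  let ?f = "\<lambda>n. let c = real (m n) / real n; l = lambda_param c in
            fact (m n) * (exp l - 1) ^ (2 * n)
              / (2 * pi * real n * c * (1 + l - c) * l ^ (2 * m n))
              * exp (- (l\<^sup>2 / 2))"
  have "(\<lambda>n. (surj_normalized n (m n))\<^sup>2 * (simple_prob n (m n) * exp ((saddle m n)\<^sup>2 / 2))) \<longlonglongrightarrow> 1\<^sup>2 * 1"
    by (intro tendsto_mult tendsto_power surj_normalized_tendsto simple_prob_tendsto assms)
  then have "(\<lambda>n. (surj_normalized n (m n))\<^sup>2 * (simple_prob n (m n) * exp ((saddle m n)\<^sup>2 / 2))) \<longlonglongrightarrow> 1" by simp
  moreover have "\<forall>\<^sub>F n in sequentially. 1 \<le> n" by (rule eventually_ge_at_top)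
  with eventually_gap[OF assms, of 1]
  \<comment> \<open>An exact identity once 1 <= n < m: squaring the normalised count removes the
    square root and supplies the denominator 2 pi n c (1 + l - c).\<close>
  have "\<forall>\<^sub>F n in sequentially. (surj_normalized n (m n))\<^sup>2 * (simple_prob n (m n) * exp ((saddle m n)\<^sup>2 / 2)) =
    real (card (core_digraphs n (m n))) / ?f n"
  proof eventually_elim
    case (elim n)
    define c where "c = real (m n) / real n"
    define l where "l = lambda_param c"
    define s where "s = surj_count n (m n)"
    define v where "v = c * (1 + l - c)"
    have n: "1 \<le> n" "n < m n" using elim by linarith+
    have c1: "1 < c" using n by (simp add: c_def)
    have l: "0 < l" "c = l * exp l / (exp l - 1)" unfolding l_def using lambda_param[OF c1] by simp_all
    have v0: "0 < v" using variance_bounds(1)[OF l] l(1) by (simp add: v_def)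
    define E where "E = (exp l - 1) ^ n"
    define y where "y = l ^ m n"
    have E0: "0 < E" and y0: "0 < y" using l(1) by (simp_all add: E_def y_def)
    have "surj_normalized n (m n) = s * y / (fact (m n) * E) * sqrt (2 * pi * real n * v)"
      by (simp only: surj_normalized_def Let_def c_def l_def v_def s_def E_def y_def)
    then have Z: "(surj_normalized n (m n))\<^sup>2 = s\<^sup>2 * y\<^sup>2 / ((fact (m n))\<^sup>2 * E\<^sup>2) * (2 * pi * real n * v)"
      using v0 by (simp add: power_mult_distrib power_divide)
    have N: "real (card (core_digraphs n (m n))) = s\<^sup>2 / fact (m n) * simple_prob n (m n)"
      using card_core_digraphs_eq[of n "m n"] n by (simp add: s_def)
    have F: "?f n = fact (m n) * E\<^sup>2 / (2 * pi * real n * v * y\<^sup>2) * exp (- (l\<^sup>2 / 2))"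
      by (simp add: Let_def c_def[symmetric] l_def[symmetric] E_def y_def v_def power_mult[symmetric] mult.commute[of 2] mult.assoc)
    have saddle: "saddle m n = l" by (simp add: saddle_def[OF assms] l_def c_def)
    have gen: "S * Y / (f\<^sup>2 * e) * w * (P * x) = S / f * P / (f * e / (w * Y) * inverse x)"
      if "f \<noteq> 0" "e \<noteq> 0" "w \<noteq> 0" "Y \<noteq> 0" "x \<noteq> 0" for S Y f e w P x :: real
      using that by (simp add: field_simps power2_eq_square)
    show ?case
      unfolding F unfolding Z N saddle exp_minus by (rule gen) (use n v0 E0 y0 in auto)
  qed
  ultimately show "(\<lambda>n. real (card (core_digraphs n (m n))) / ?f n) \<longlonglongrightarrow> 1"
    by (rule Lim_transform_eventually)
qed

end
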